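(* Let $d,r\ge 1$ and let $(X,Y),(X_1,Y_1),(X_2,Y_2),\ldots$ be i.i.d. random vectors with values in $\mathbb{R}^d\times\mathbb{R}^r$ having a common joint Lebesgue density $f$ on $\mathbb{R}^{d+r}$, and assume that $f$ is bounded. Let $\mathcal{G}$ be a class of measurable functions $g:\mathbb{R}^d\times\mathbb{R}^r\to\mathbb{R}$ such that (G.i) $\sup_{g\in\mathcal{G}}\|g\|_\infty=:\kappa<\infty$; (G.ii) $\sup_{g\in\mathcal{G}}\int_{\mathbb{R}^{d+r}}g^2(x,y)\,dx\,dy=:L<\infty$. Let $\mathcal{F}_{\mathcal{G}}$ be the class of all functions $(s,t)\mapsto g(z-s\lambda,t)$ on $\mathbb{R}^{d}\times\mathbb{R}^r$ with $\lambda\ge 1$, $z\in\mathbb{R}^d$, $g\in\mathcal{G}$, and assume that (F.i) for some $C_0>0$ and $\nu_0>0$, $N(\epsilon,\mathcal{F}_{\mathcal{G}})\le C_0\epsilon^{-\nu_0}$ for all $0<\epsilon<1$, where the uniform covering number $N(\epsilon,\mathcal{F}_{\mathcal{G}})$ is taken with the constant $\kappa$ as envelope function; (F.ii) $\mathcal{F}_{\mathcal{G}}$ is a pointwise measurable class. For $g\in\mathcal{G}$, $0<h<1$ and $n\ge1$ put $$g_{n,h}(x):=\frac1{nh}\sum_{i=1}^n g\left(\frac{x-X_i}{h^{1/d}},Y_i\right),\qquad x\in\mathbb{R}^d .$$ Then for every $c>0$ and $0<h_0<1$, with probability 1, $$\limsup_{n\to\infty}\ \sup_{\frac{c\log n}{n}\le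 h\le h_0}\ \sup_{g\in\mathcal{G}}\ \frac{\sqrt{nh}\,\left\|g_{n,h}-\mathbb{E}g_{n,h}\right\|_\infty}{\sqrt{|\log h|\vee\log\log n}}=:G(c)<\infty .$$
   Context: $\|\cdot\|_\infty$ denotes the supremum norm on $\mathbb{R}^d$ or $\mathbb{R}^{d+r}$, as appropriate; $a\vee b=\max(a,b)$; $\mathbb{E}g_{n,h}$ is the function $x\mapsto\mathbb{E}[g_{n,h}(x)]$. Pointwise measurable class: a class $\mathcal{H}$ of real-valued functions on a measurable space $(\mathcal{X},\mathcal{A})$ is pointwise measurable if there is a countable subclass $\mathcal{H}_0\subset\mathcal{H}$ such that for every $u\in\mathcal{H}$ there is a sequence $\{u_m\}$ in $\mathcal{H}_0$ with $u_m(x)\to u(x)$ for all $x\in\mathcal{X}$. Uniform covering number: for a class $\mathcal{H}$ of measurable real functions on $(\mathcal{X},\mathcal{A})$ with a finite-valued measurable envelope $H\ge\sup_{u\in\mathcal{H}}|u|$ (pointwise), $N(\epsilon,\mathcal{H}):=\sup_Q N(\epsilon\sqrt{Q(H^2)},\mathcal{H},d_Q)$, where the supremum is over all probability measures $Q$ on $(\mathcal{X},\mathcal{A})$ with $0<Q(H^2)<\infty$, $Q(H^2)=\int H^2\,dQ$, $d_Q$ is the $L_2(Q)$-metric, and $N(\epsilon,\mathcal{H},d)$ is the minimal number of balls $\{u:d(u,v)<\epsilon\}$ of $d$-radius $\epsilon$ needed to cover $\mathcal{H}$. *)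

theory Defs
  imports "HOL-Probability.Probability"
begin

text \<open>
  Suprema of nonnegative quantities are taken in \<^typ>\<open>ennreal\<close>, so that they always exist and
  finiteness is an explicit claim.
\<close>

definition sup_norm :: "('a \<Rightarrow> real) \<Rightarrow> ennreal" where
  "sup_norm u = (SUP x. ennreal \<bar>u x\<bar>)"

definition pointwise_measurable_class :: "'a measure \<Rightarrow> ('a \<Rightarrow> real) set \<Rightarrow> bool" where
  "pointwise_measurable_class A \<H> \<longleftrightarrow>
     (\<exists>\<H>\<^sub>0 \<subseteq> \<H>. countable \<H>\<^sub>0 \<and>
        (\<forall>u\<in>\<H>. \<exists>U :: nat \<Rightarrow> 'a \<Rightarrow> real. range U \<subseteq> \<H>\<^sub>0 \<and>
           (\<forall>x\<in>space A. (\<lambda>m. U m x) \<longlonglongrightarrow> u x)))"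

definition L2_functions :: "'a measure \<Rightarrow> ('a \<Rightarrow> real) set" where
  "L2_functions Q = {v \<in> borel_measurable Q. integrable Q (\<lambda>x. (v x)\<^sup>2)}"

text \<open>
  A genuine (pseudo)distance only on \<^const>\<open>L2_functions\<close>; outside, the Bochner integral of a
  non-integrable function would be 0.
\<close>

definition L2_dist :: "'a measure \<Rightarrow> ('a \<Rightarrow> real) \<Rightarrow> ('a \<Rightarrow> real) \<Rightarrow> real" where
  "L2_dist Q u v = sqrt (LINT x|Q. (u x - v x)\<^sup>2)"

text \<open>
  Minimal number of open balls of radius \<open>\<epsilon>\<close>, with centres in the ambient space \<open>S\<close>
  (not necessarily in the class itself), needed to cover \<open>\<H>\<close>; it is \<open>\<infinity>\<close> if no finite cover exists.
\<close>

definition covering_number :: "'b set \<Rightarrow> ('b \<Rightarrow> 'b \<Rightarrow> real) \<Rightarrow> real \<Rightarrow> 'b set \<Rightarrow> ennreal" where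
  "covering_number S dst \<epsilon> \<H> =
     (INF V \<in> {V. finite V \<and> V \<subseteq> S \<and> \<H> \<subseteq> (\<Union>v\<in>V. {u \<in> S. dst u v < \<epsilon>})}. of_nat (card V))"

text \<open>
  Intended for classes of \<open>A\<close>-measurable functions with measurable envelope \<open>H\<close>. Then
  every member of the class lies in \<^const>\<open>L2_functions\<close> for each of the measures \<open>Q\<close> considered.
\<close>

definition uniform_covering_number ::
    "'a measure \<Rightarrow> ('a \<Rightarrow> real) \<Rightarrow> real \<Rightarrow> ('a \<Rightarrow> real) set \<Rightarrow> ennreal" where
  "uniform_covering_number A H \<epsilon> \<H> =
     (SUP Q \<in> {Q. prob_space Q \<and> sets Q = sets A \<and>
                  0 < (\<integral>\<^sup>+x. ennreal ((H x)\<^sup>2) \<partial>Q) \<and> (\<integral>\<^sup>+x. ennreal ((H x)\<^sup>2) \<partial>Q) < \<infinity>}.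
        covering_number (L2_functions Q) (L2_dist Q) (\<epsilon> * sqrt (LINT x|Q. (H x)\<^sup>2)) \<H>)"

definition dilation_class ::
    "('a::real_vector \<times> 'b \<Rightarrow> real) set \<Rightarrow> ('a \<times> 'b \<Rightarrow> real) set" where
  "dilation_class \<G> = {(\<lambda>(s, t). g (z - l *\<^sub>R s, t)) | l z g. 1 \<le> l \<and> g \<in> \<G>}"

definition kernel_average ::
    "(nat \<Rightarrow> 'w \<Rightarrow> real^'d) \<Rightarrow> (nat \<Rightarrow> 'w \<Rightarrow> real^'r) \<Rightarrow> ((real^'d) \<times> (real^'r) \<Rightarrow> real)
      \<Rightarrow> nat \<Rightarrow> real \<Rightarrow> 'w \<Rightarrow> real^'d \<Rightarrow> real" where
  "kernel_average X Y g n h \<omega> x =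
     1 / (real n * h) *
     (\<Sum>i=1..n. g ((x - X i \<omega>) /\<^sub>R (h powr (1 / real CARD('d))), Y i \<omega>))"

end

theory Submission
  imports Defs "HOL-Real_Asymp.Real_Asymp"
begin

text \<open>
  For a bandwidth \<open>h\<close> and \<open>u (s, t) = g (x / h^(1/d) - s / h^(1/d), t)\<close>, the deviation at \<open>x\<close> is
  the centred sum of \<open>u\<close> over the sample divided by \<open>n h\<close>, and \<open>u\<close> has second moment \<open>O(h)\<close>
  because the density is bounded.

  Finiteness. For \<open>n \<le> N = 2^k\<close>, \<open>h \<approx> 2^(-j)\<close> and \<open>l = max (j ln 2) (ln k)\<close>, a maximal Bernstein
  inequality is applied to one net in \<open>L\<^sub>2(P)\<close> of log-cardinality \<open>O(l)\<close> and to the links from it to a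
  net of radius \<open>O(N^(-2))\<close>. What remains are pairs of functions that nearly agree \<open>P\<close>-almost
  everywhere; by a ghost sample argument, which is where the entropy with respect to empirical measures
  enters, all such pairs simultaneously differ by \<open>O(1)\<close> in total over the sample.
  Everything is summable in \<open>j\<close> and \<open>k\<close>.

  Constancy. By the same ghost sample bound, the supremum may be replaced by a maximum over a finite
  net of the index set, up to an error that vanishes almost surely. The limit superior of these maxima
  is measurable with respect to the tail, so Kolmogorov's zero-one law applies.
\<close>

section \<open>A maximal Bernstein inequality\<close>

text \<open>The obstacle is measurability. A pointwise measurable \<open>F\<close> may have
  subclasses, such as the members with second moment at most a multiple of \<open>h\<close>, over
  which suprema are not measurable. So the random suprema whose probability is estimated run over
  finite sets; the exception is \<open>agrees\<close>, a statement about pairs, which passes from a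
  countable subclass to all of \<open>F\<close> by limits. Everything else is deterministic
  approximation in L_2(P). \<open>AE\<close> asks only for a null set outside which the claim holds,
  so the limsup itself may stay nonmeasurable. The lower limit on \<open>h\<close> enters through N
  h l >= c' (ln N)^2 with c' > 0: the target sqrt(N h l) is then at least of order ln N. This makes
  the exponential parameters in Bernstein's inequality admissible and absorbs the bounded remainder
  left by near agreement. The maximum over n <= N inside Bernstein's inequality makes one event per
  pair (j, k) enough, so that the failure probabilities, of order exp(-4 l), can be summed.\<close>

primrec stopped_prod :: "real \<Rightarrow> (nat \<Rightarrow> real) \<Rightarrow> nat \<Rightarrow> real" where
  "stopped_prod b w 0 = 1"
| "stopped_prod b w (Suc n) =
     (if b \<le> stopped_prod b w n then stopped_prod b w n else stopped_prod b w n * w (Suc n))"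

lemma stopped_prod_nonneg: "(\<And>i. 0 \<le> w i) \<Longrightarrow> 0 \<le> stopped_prod b w n"
  by (induction n) auto

lemma stopped_prod_cong:
  "(\<And>i. i \<in> {1..n} \<Longrightarrow> w i = w' i) \<Longrightarrow> stopped_prod b w n = stopped_prod b w' n"
  by (induction n) auto

lemma stopped_prod_ge_or_eq:
  "b \<le> stopped_prod b w n \<or> (stopped_prod b w n = (\<Prod>i=1..n. w i) \<and> (\<forall>k\<le>n. (\<Prod>i=1..k. w i) < b))"
  by (induction n) (auto simp: le_Suc_eq)

lemma measurable_stopped_prod:
  "n \<le> m \<Longrightarrow> (\<lambda>w. stopped_prod b w n) \<in> borel_measurable (PiM {1..m} (\<lambda>_. borel))"
proof (induction n)
  case (Suc n)
  then have [measurable]: "(\<lambda>w. stopped_prod b w n) \<in> borel_measurable (PiM {1..m} (\<lambda>_. borel))"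
    by simp
  have [measurable]: "(\<lambda>w. w (Suc n)) \<in> borel_measurable (PiM {1..m} (\<lambda>_. borel))"
    using Suc.prems by (intro measurable_component_singleton) auto
  show ?case by (simp only: stopped_prod.simps) measurable
qed simp

lemma (in prob_space) nn_integral_stopped_prod_le:
  fixes W :: "nat \<Rightarrow> 'a \<Rightarrow> real"
  assumes ind: "indep_vars (\<lambda>_. borel) W UNIV"
    and pos: "\<And>i \<omega>. 0 \<le> W i \<omega>"
    and mean: "\<And>i. (\<integral>\<^sup>+\<omega>. W i \<omega> \<partial>M) \<le> ennreal m" and m: "1 \<le> m"
  shows "(\<integral>\<^sup>+\<omega>. stopped_prod b (\<lambda>i. W i \<omega>) n \<partial>M) \<le> ennreal (m ^ n)"
proof (induction n)
  case 0
  then show ?case by (simp add: emeasure_space_1)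
next
  case (Suc n)
  have W[measurable]: "random_variable borel (W i)" for i
    using ind by (auto simp: indep_vars_def)
  define T where "T = (\<lambda>\<omega>. stopped_prod b (\<lambda>i. W i \<omega>) n)"
  have Tn: "stopped_prod b (\<lambda>i. W i \<omega>) n = T \<omega>" for \<omega>
    by (simp add: T_def)
  define S where "S = (\<lambda>\<omega>. if b \<le> T \<omega> then 0 else T \<omega>)"
  have eq: "T \<omega> = stopped_prod b (restrict (\<lambda>i. W i \<omega>) {1..n}) n" for \<omega>
    unfolding T_def by (rule stopped_prod_cong) auto
  have rv: "(\<lambda>\<omega>. restrict (\<lambda>i. W i \<omega>) {1..n}) \<in> measurable M (PiM {1..n} (\<lambda>_. borel))"
    by (rule measurable_restrict) simp
  have T[measurable]: "random_variable borel T"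
    unfolding eq by (rule measurable_compose[OF rv measurable_stopped_prod]) simp
  have T0: "0 \<le> T \<omega>" for \<omega> unfolding T_def by (rule stopped_prod_nonneg) (rule pos)
  then have S0: "0 \<le> S \<omega>" for \<omega> by (simp add: S_def)
  have "indep_var (PiM {1..n} (\<lambda>_. borel)) (\<lambda>\<omega>. restrict (\<lambda>i. W i \<omega>) {1..n})
          (PiM {Suc n} (\<lambda>_. borel)) (\<lambda>\<omega>. restrict (\<lambda>i. W i \<omega>) {Suc n})"
    by (rule indep_var_restrict[OF ind]) auto
  then have "indep_var borel ((\<lambda>w. if b \<le> stopped_prod b w n then 0 else stopped_prod b w n) \<circ>
        (\<lambda>\<omega>. restrict (\<lambda>i. W i \<omega>) {1..n})) borel
        ((\<lambda>w. w (Suc n)) \<circ> (\<lambda>\<omega>. restrict (\<lambda>i. W i \<omega>) {Suc n}))"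
  proof (rule indep_var_compose)
    have [measurable]: "(\<lambda>w. stopped_prod b w n) \<in> borel_measurable (PiM {1..n} (\<lambda>_. borel))"
      by (rule measurable_stopped_prod) simp
    show "(\<lambda>w. if b \<le> stopped_prod b w n then 0 else stopped_prod b w n)
        \<in> borel_measurable (PiM {1..n} (\<lambda>_. borel))"
      by measurable
    show "(\<lambda>w. w (Suc n)) \<in> borel_measurable (PiM {Suc n} (\<lambda>_. borel))"
      by (rule measurable_component_singleton) simp
  qed
  also have "(\<lambda>w. if b \<le> stopped_prod b w n then 0 else stopped_prod b w n) \<circ>
        (\<lambda>\<omega>. restrict (\<lambda>i. W i \<omega>) {1..n}) = S"
    by (auto simp: S_def eq fun_eq_iff)
  also have "(\<lambda>w. w (Suc n)) \<circ> (\<lambda>\<omega>. restrict (\<lambda>i. W i \<omega>) {Suc n}) = W (Suc n)"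
    by auto
  finally have "indep_vars (case_bool borel borel) (case_bool S (W (Suc n))) UNIV"
    by (simp add: indep_var_def)
  also have "case_bool borel borel = (\<lambda>_. borel :: real measure)"
    by (auto simp: fun_eq_iff split: bool.split)
  finally have "indep_vars (\<lambda>_. borel) (\<lambda>i \<omega>. ennreal (case_bool S (W (Suc n)) i \<omega>)) UNIV"
    by (rule indep_vars_compose2) simp
  then have "(\<integral>\<^sup>+\<omega>. (\<Prod>i\<in>UNIV. ennreal (case_bool S (W (Suc n)) i \<omega>)) \<partial>M) =
      (\<Prod>i\<in>UNIV. \<integral>\<^sup>+\<omega>. case_bool S (W (Suc n)) i \<omega> \<partial>M)"
    by (intro indep_vars_nn_integral) auto
  then have prod: "(\<integral>\<^sup>+\<omega>. ennreal (S \<omega>) * ennreal (W (Suc n) \<omega>) \<partial>M) =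
      (\<integral>\<^sup>+\<omega>. S \<omega> \<partial>M) * (\<integral>\<^sup>+\<omega>. W (Suc n) \<omega> \<partial>M)"
    by (simp add: UNIV_bool mult.commute)
  have S[measurable]: "random_variable borel S" unfolding S_def by measurable
  have "(\<integral>\<^sup>+\<omega>. stopped_prod b (\<lambda>i. W i \<omega>) (Suc n) \<partial>M) =
      (\<integral>\<^sup>+\<omega>. ennreal (T \<omega> - S \<omega>) + ennreal (S \<omega>) * ennreal (W (Suc n) \<omega>) \<partial>M)"
    by (rule nn_integral_cong) (auto simp: S_def Tn ennreal_mult T0 pos)
  also have "\<dots> = (\<integral>\<^sup>+\<omega>. ennreal (T \<omega> - S \<omega>) \<partial>M) + (\<integral>\<^sup>+\<omega>. S \<omega> \<partial>M) * (\<integral>\<^sup>+\<omega>. W (Suc n) \<omega> \<partial>M)"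
    by (subst nn_integral_add) (auto simp: prod)
  also have "\<dots> \<le> (\<integral>\<^sup>+\<omega>. ennreal (T \<omega> - S \<omega>) \<partial>M) * ennreal m + (\<integral>\<^sup>+\<omega>. S \<omega> \<partial>M) * ennreal m"
    using mean m by (intro add_mono mult_left_mono) (auto intro: order_trans[OF _ mult_left_mono[of 1]])
  also have "\<dots> = (\<integral>\<^sup>+\<omega>. ennreal (T \<omega> - S \<omega>) + ennreal (S \<omega>) \<partial>M) * ennreal m"
    by (subst nn_integral_add) (auto simp: distrib_right)
  also have "(\<integral>\<^sup>+\<omega>. ennreal (T \<omega> - S \<omega>) + ennreal (S \<omega>) \<partial>M) = (\<integral>\<^sup>+\<omega>. T \<omega> \<partial>M)"
    by (rule nn_integral_cong) (auto simp: S_def T0)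
  also have "\<dots> * ennreal m \<le> ennreal (m ^ n) * ennreal m"
    using Suc.IH unfolding T_def by (rule mult_right_mono) simp
  also have "\<dots> = ennreal (m ^ Suc n)"
    using m by (simp add: ennreal_mult mult.commute)
  finally show ?case .
qed

text \<open>Markov's inequality at the final time: a product that has once reached \<open>b\<close>
  stays frozen there, so the maximum over n <= N is read off from a single stopped product.\<close>

lemma (in prob_space) prob_partial_prod_ge_le:
  fixes W :: "nat \<Rightarrow> 'a \<Rightarrow> real"
  assumes ind: "indep_vars (\<lambda>_. borel) W UNIV"
    and pos: "\<And>i \<omega>. 0 \<le> W i \<omega>"
    and mean: "\<And>i. (\<integral>\<^sup>+\<omega>. W i \<omega> \<partial>M) \<le> ennreal m" and m: "1 \<le> m" and b: "0 < b"
  shows "prob {\<omega>\<in>space M. \<exists>n\<le>N. b \<le> (\<Prod>i=1..n. W i \<omega>)} \<le> m ^ N / b"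
proof -
  have W[measurable]: "random_variable borel (W i)" for i
    using ind by (auto simp: indep_vars_def)
  define T where "T = (\<lambda>\<omega>. stopped_prod b (\<lambda>i. W i \<omega>) N)"
  have [measurable]: "random_variable borel (\<lambda>\<omega>. stopped_prod b (\<lambda>i. W i \<omega>) n)" for n
    by (induction n) simp_all
  have [measurable]: "random_variable borel T" unfolding T_def by measurable
  have "emeasure M {\<omega>\<in>space M. \<exists>n\<le>N. b \<le> (\<Prod>i=1..n. W i \<omega>)} \<le> emeasure M {\<omega>\<in>space M. 1 \<le> ennreal (1/b) * ennreal (T \<omega>)}"
  proof (rule emeasure_mono)
    show "{\<omega>\<in>space M. \<exists>n\<le>N. b \<le> (\<Prod>i=1..n. W i \<omega>)} \<subseteq> {\<omega>\<in>space M. 1 \<le> ennreal (1/b) * ennreal (T \<omega>)}"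
    proof safe
      fix \<omega> n assume "n \<le> N" "b \<le> (\<Prod>i=1..n. W i \<omega>)"
      then have "b \<le> T \<omega>"
        using stopped_prod_ge_or_eq[of b "\<lambda>i. W i \<omega>" N] unfolding T_def by force
      then show "1 \<le> ennreal (1/b) * ennreal (T \<omega>)"
        using b by (simp add: ennreal_mult[symmetric] field_simps)
    qed
  qed measurable
  also have "\<dots> \<le> ennreal (1/b) * (\<integral>\<^sup>+\<omega>. ennreal (T \<omega>) * indicator (space M) \<omega> \<partial>M)"
    using nn_integral_Markov_inequality[of "\<lambda>\<omega>. ennreal (T \<omega>)" "space M" M "ennreal (1/b)"] by simp
  also have "(\<integral>\<^sup>+\<omega>. ennreal (T \<omega>) * indicator (space M) \<omega> \<partial>M) = (\<integral>\<^sup>+\<omega>. T \<omega> \<partial>M)"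
    by (rule nn_integral_cong) simp
  also have "ennreal (1/b) * \<dots> \<le> ennreal (1/b) * ennreal (m ^ N)"
    unfolding T_def by (intro mult_left_mono nn_integral_stopped_prod_le[OF ind pos mean m]) simp
  also have "\<dots> = ennreal (m ^ N / b)"
    using m b by (simp add: ennreal_mult[symmetric])
  finally show ?thesis
    using m b by (simp add: emeasure_eq_measure)
qed

lemma exp_le_one_plus_square:
  fixes x :: real
  assumes "\<bar>x\<bar> \<le> 1"
  shows "exp x \<le> 1 + x + x\<^sup>2"
proof (cases "0 \<le> x")
  case True
  then show ?thesis using assms by (intro exp_bound) auto
next
  case False
  define y where "y = - x"
  have y: "0 \<le> y" "y \<le> 1" using False assms by (auto simp: y_def)
  \<comment> \<open>The product on the right equals 1 + y^3.\<close>
  have "1 \<le> (1 - y + y\<^sup>2) * (1 + y)"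
    using y by (simp add: algebra_simps power2_eq_square)
  also have "\<dots> \<le> (1 - y + y\<^sup>2) * exp y"
    using y exp_ge_add_one_self[of y] by (intro mult_left_mono) auto
  finally have "exp (- y) \<le> 1 - y + y\<^sup>2"
    by (simp add: exp_minus field_simps)
  then show ?thesis by (simp add: y_def)
qed

section \<open>The i.i.d. setting and exponential bounds for centred sums\<close>

locale iid_sequence = prob_space M for M :: "'w measure" +
  fixes Z :: "nat \<Rightarrow> 'w \<Rightarrow> 'z::topological_space" and P :: "'z measure"
  assumes indep: "indep_vars (\<lambda>_. borel) Z UNIV"
    and law: "\<And>i. distr M borel (Z i) = P"
begin

lemma measurable_Z [measurable]: "Z i \<in> measurable M borel"
  using indep by (auto simp: indep_vars_def)

lemma sets_P [measurable_cong]: "sets P = sets borel"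
  using law[of 0] by auto

lemma space_P [simp]: "space P = UNIV"
  using law[of 0] by auto

lemma prob_space_P: "prob_space P"
  using prob_space_distr[OF measurable_Z[of 0]] by (simp add: law)

sublocale P: prob_space P
  by (rule prob_space_P)

lemma prob_P_UNIV [simp]: "measure P UNIV = 1"
  using P.prob_space by simp

lemma integrable_P_bounded:
  fixes u :: "'z \<Rightarrow> real"
  assumes "u \<in> borel_measurable borel" "\<And>z. \<bar>u z\<bar> \<le> b"
  shows "integrable P u"
  using assms by (intro P.integrable_const_bound[of _ b]) auto

definition dev :: "nat \<Rightarrow> ('z \<Rightarrow> real) \<Rightarrow> 'w \<Rightarrow> real" where
  "dev n u \<omega> = (\<Sum>i=1..n. u (Z i \<omega>) - (LINT z|P. u z))"

lemma measurable_dev [measurable]: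
  "u \<in> borel_measurable borel \<Longrightarrow> dev n u \<in> borel_measurable M"
  unfolding dev_def
  by (intro borel_measurable_sum borel_measurable_diff measurable_const measurable_compose[OF measurable_Z])
    auto

lemma dev_uminus: "dev n (\<lambda>z. - u z) \<omega> = - dev n u \<omega>"
  by (simp add: dev_def sum_negf[symmetric])

lemma dev_diff:
  assumes "integrable P u" "integrable P v"
  shows "dev n (\<lambda>z. u z - v z) \<omega> = dev n u \<omega> - dev n v \<omega>"
  using assms by (simp add: dev_def sum_subtractf[symmetric] algebra_simps)

text \<open>Exponential Chebyshev bound with the factors exp(l (u - E u)). The condition 2 b l <= 1
  keeps the exponents in [-1, 1], where the quadratic bound for exp applies. The parameter
  \<open>l\<close> stays free because later uses choose it at two different scales.\<close>

lemma maximal_bernstein_one_sided: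
  assumes u[measurable]: "u \<in> borel_measurable borel" and bd: "\<And>z. \<bar>u z\<bar> \<le> b"
    and V: "(LINT z|P. (u z)\<^sup>2) \<le> V" and l: "0 < l" "2 * b * l \<le> 1"
  shows "prob {\<omega>\<in>space M. \<exists>n\<le>N. t \<le> dev n u \<omega>} \<le> exp (- l * t + real N * l\<^sup>2 * V)"
proof -
  define m where "m = (LINT z|P. u z)"
  define w where "w = (\<lambda>z. exp (l * (u z - m)))"
  have w[measurable]: "w \<in> borel_measurable borel" unfolding w_def by measurable
  have iu: "integrable P u" by (rule integrable_P_bounded[OF u bd])
  have "\<bar>(u z)\<^sup>2\<bar> \<le> b\<^sup>2" for z using bd[of z] by (simp add: abs_le_square_iff[symmetric])
  then have iu2: "integrable P (\<lambda>z. (u z)\<^sup>2)" by (intro integrable_P_bounded) measurable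
  have mb: "\<bar>m\<bar> \<le> b"
  proof -
    have "\<bar>m\<bar> \<le> (LINT z|P. \<bar>u z\<bar>)" unfolding m_def by (rule integral_abs_bound)
    also have "\<dots> \<le> (LINT z|P. b)" using iu bd by (intro integral_mono) auto
    finally show ?thesis by (simp add: P.prob_space)
  qed
  have V0: "0 \<le> V" using order_trans[OF integral_nonneg_AE V] by simp
  have small: "\<bar>l * (u z - m)\<bar> \<le> 1" for z
  proof -
    have "\<bar>l * (u z - m)\<bar> \<le> l * (2 * b)"
      unfolding abs_mult using bd[of z] mb l by (intro mult_mono) auto
    then show ?thesis using l by (simp add: algebra_simps)
  qed
  have "(LINT z|P. w z) \<le> (LINT z|P. 1 + l * (u z - m) + l\<^sup>2 * ((u z)\<^sup>2 - 2 * m * u z + m\<^sup>2))"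
  proof (rule integral_mono)
    have "\<bar>w z\<bar> \<le> exp 1" for z using small[of z] by (simp add: w_def)
    then show "integrable P w" by (intro integrable_P_bounded) measurable
    show "integrable P (\<lambda>z. 1 + l * (u z - m) + l\<^sup>2 * ((u z)\<^sup>2 - 2 * m * u z + m\<^sup>2))"
      using iu iu2 by auto
    fix z
    show "w z \<le> 1 + l * (u z - m) + l\<^sup>2 * ((u z)\<^sup>2 - 2 * m * u z + m\<^sup>2)"
      using exp_le_one_plus_square[OF small[of z]]
      by (simp add: w_def power_mult_distrib power2_diff power2_eq_square algebra_simps)
  qed
  \<comment> \<open>The linear term integrates to zero and the quadratic one to the
    variance.\<close>
  also have "\<dots> = 1 + l\<^sup>2 * ((LINT z|P. (u z)\<^sup>2) - m\<^sup>2)"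
    using iu iu2 by (simp add: P.prob_space m_def[symmetric] algebra_simps power2_eq_square)
  also have "\<dots> \<le> 1 + l\<^sup>2 * V"
    using V by (intro add_left_mono mult_left_mono) (auto intro: order_trans[OF _ V])
  also have "\<dots> \<le> exp (l\<^sup>2 * V)" by (rule exp_ge_add_one_self)
  finally have Ew: "(LINT z|P. w z) \<le> exp (l\<^sup>2 * V)" .
  have mean: "(\<integral>\<^sup>+\<omega>. w (Z i \<omega>) \<partial>M) \<le> ennreal (exp (l\<^sup>2 * V))" for i
  proof -
    have "(\<integral>\<^sup>+\<omega>. w (Z i \<omega>) \<partial>M) = (\<integral>\<^sup>+z. w z \<partial>P)"
      unfolding law[of i, symmetric] by (subst nn_integral_distr) auto
    also have "\<dots> = ennreal (LINT z|P. w z)"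
    proof (rule nn_integral_eq_integral)
      have "\<bar>w z\<bar> \<le> exp 1" for z using small[of z] by (simp add: w_def)
      then show "integrable P w" by (intro integrable_P_bounded) measurable
    qed (simp add: w_def)
    finally show ?thesis using Ew by (simp add: ennreal_leI)
  qed
  have indw: "indep_vars (\<lambda>_. borel) (\<lambda>i \<omega>. w (Z i \<omega>)) UNIV"
    by (rule indep_vars_compose2[OF indep]) simp
  have prodw: "(\<Prod>i=1..n. w (Z i \<omega>)) = exp (l * dev n u \<omega>)" for n \<omega>
    by (simp add: w_def exp_sum dev_def m_def sum_distrib_left)
  have "prob {\<omega>\<in>space M. \<exists>n\<le>N. t \<le> dev n u \<omega>} \<le> prob {\<omega>\<in>space M. \<exists>n\<le>N. exp (l * t) \<le> (\<Prod>i=1..n. w (Z i \<omega>))}"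
    unfolding prodw using l by (intro finite_measure_mono) auto
  also have "\<dots> \<le> exp (l\<^sup>2 * V) ^ N / exp (l * t)"
    by (rule prob_partial_prod_ge_le[OF indw _ mean]) (auto simp: w_def V0)
  also have "\<dots> = exp (- l * t + real N * l\<^sup>2 * V)"
    by (simp add: exp_of_nat_mult[symmetric] exp_diff[symmetric] algebra_simps)
  finally show ?thesis .
qed

lemma maximal_bernstein:
  assumes u[measurable]: "u \<in> borel_measurable borel" and bd: "\<And>z. \<bar>u z\<bar> \<le> b"
    and V: "(LINT z|P. (u z)\<^sup>2) \<le> V" and l: "0 < l" "2 * b * l \<le> 1"
  shows "prob {\<omega>\<in>space M. \<exists>n\<le>N. t \<le> \<bar>dev n u \<omega>\<bar>} \<le> 2 * exp (- l * t + real N * l\<^sup>2 * V)"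
proof -
  have "prob {\<omega>\<in>space M. \<exists>n\<le>N. t \<le> \<bar>dev n u \<omega>\<bar>} \<le>
     prob ({\<omega>\<in>space M. \<exists>n\<le>N. t \<le> dev n u \<omega>} \<union>
           {\<omega>\<in>space M. \<exists>n\<le>N. t \<le> dev n (\<lambda>z. - u z) \<omega>})"
    by (intro finite_measure_mono) (auto simp: dev_uminus abs_if split: if_splits)
  also have "\<dots> \<le> prob {\<omega>\<in>space M. \<exists>n\<le>N. t \<le> dev n u \<omega>} +
           prob {\<omega>\<in>space M. \<exists>n\<le>N. t \<le> dev n (\<lambda>z. - u z) \<omega>}"
    by (rule measure_Un_le) measurable
  also have "\<dots> \<le> exp (- l * t + real N * l\<^sup>2 * V) + exp (- l * t + real N * l\<^sup>2 * V)"
    using bd V l by (intro add_mono maximal_bernstein_one_sided[where b=b]) auto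
  finally show ?thesis by simp
qed

end

section \<open>Ghost samples\<close>

text \<open>Fix one admissible \<open>\<tau>'\<close>. In each of its at least \<open>m\<close> rows
  with a large entry in column \<open>\<tau>' i\<close>, every other admissible
  \<open>\<tau>\<close> must choose that same column. Only the remaining rows are free, which leaves
  at most q^(n - m) choices.\<close>

lemma card_forced_columns_le:
  fixes a :: "nat \<times> nat \<Rightarrow> real"
  assumes q: "1 \<le> q"
  shows "card {\<tau> \<in> {1..n} \<rightarrow>\<^sub>E {..<q}. m \<le> card {i\<in>{1..n}. c < a (i, \<tau> i)} \<and>
           (\<forall>i\<in>{1..n}. \<forall>j<q. c < a (i, j) \<longrightarrow> j = \<tau> i)} * q ^ m \<le> q ^ n" (is "card ?S * _ \<le> _")
proof (cases "?S = {}")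
  case False
  then obtain \<tau>' where \<tau>': "\<tau>' \<in> ?S" by blast
  define R where "R = {i\<in>{1..n}. c < a (i, \<tau>' i)}"
  have R: "R \<subseteq> {1..n}" "m \<le> card R" using \<tau>' by (auto simp: R_def)
  have "card ?S \<le> card (\<Pi>\<^sub>E i\<in>{1..n}. if i \<in> R then {\<tau>' i} else {..<q})"
  proof (rule card_mono)
    show "finite (\<Pi>\<^sub>E i\<in>{1..n}. if i \<in> R then {\<tau>' i} else {..<q})"
      by (rule finite_PiE) auto
    show "?S \<subseteq> (\<Pi>\<^sub>E i\<in>{1..n}. if i \<in> R then {\<tau>' i} else {..<q})"
    proof
      fix \<tau> assume \<tau>: "\<tau> \<in> ?S"
      have "\<tau>' i < q" if "i \<in> {1..n}" for i using \<tau>' that by (auto simp: PiE_iff)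
      then have "\<tau>' i = \<tau> i" if "i \<in> R" for i using \<tau> that R by (auto simp: R_def)
      then show "\<tau> \<in> (\<Pi>\<^sub>E i\<in>{1..n}. if i \<in> R then {\<tau>' i} else {..<q})"
        using \<tau> by (auto simp: PiE_iff)
    qed
  qed
  also have "\<dots> = (\<Prod>i\<in>{1..n}. if i \<in> R then 1 else q)"
    by (subst card_PiE) (auto intro!: prod.cong)
  also have "\<dots> = q ^ (n - card R)"
    using R by (simp add: prod.If_cases Diff_eq[symmetric] card_Diff_subset finite_subset)
  finally have "card ?S * q ^ m \<le> q ^ (n - card R) * q ^ card R"
    using R q by (intro mult_mono power_increasing) auto
  also have "\<dots> = q ^ n"
    using card_mono[OF _ R(1)] by (simp add: power_add[symmetric])
  finally show ?thesis .
next
  case True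
  show ?thesis unfolding True by simp
qed

text \<open>
  The sample is the column \<open>j = 0\<close> of an array with \<open>n\<close> rows and \<open>q\<close> columns. If a pair
  of functions that nearly agree \<open>P\<close>-a.e. differs at many points of column \<open>0\<close>, it most
  likely nearly agrees on all other columns. Exchanging column \<open>0\<close> with column \<open>\<tau> i\<close> in row
  \<open>i\<close> preserves the law of the array, but for a fixed pair only few \<open>\<tau>\<close> move all points of
  disagreement to column \<open>0\<close>.
\<close>

lemma measure_differ_much_le_ghost:
  fixes P :: "'z measure" and W :: "(('z \<Rightarrow> real) \<times> ('z \<Rightarrow> real)) set" and n q m :: nat
  defines "J \<equiv> {1..n} \<times> {..<q}"
  defines "\<Omega> \<equiv> PiM J (\<lambda>_. P)"
  assumes P: "prob_space P"
    and W: "countable W" "\<And>u v. (u, v) \<in> W \<Longrightarrow> u \<in> F \<and> v \<in> F"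
    and meas: "\<And>u. u \<in> F \<Longrightarrow> u \<in> borel_measurable P"
    and bd: "\<And>u z. u \<in> F \<Longrightarrow> \<bar>u z\<bar> \<le> \<kappa>"
    and q: "1 \<le> q" and \<theta>: "0 < \<theta>" "2 * \<theta> * real n \<le> 1"
    and rare: "\<And>u v. (u, v) \<in> W \<Longrightarrow>
        real n * real q * measure P {z\<in>space P. \<theta> < \<bar>u z - v z\<bar>} \<le> 1 / 2"
    and net: "\<And>z. z \<in> space \<Omega> \<Longrightarrow> \<exists>T. finite T \<and> real (card T) \<le> K \<and>
        (\<forall>u\<in>F. \<exists>v\<in>T. \<forall>p\<in>J. \<bar>u (z p) - v (z p)\<bar> \<le> \<theta> / 4)"
  shows "measure \<Omega> {z\<in>space \<Omega>. \<exists>(u, v)\<in>W.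
      2 * \<kappa> * real m + 1 < (\<Sum>i=1..n. \<bar>u (z (i, 0)) - v (z (i, 0))\<bar>)} \<le> 2 * K\<^sup>2 / real q ^ m"
proof -
  interpret D: prob_space P by fact
  interpret pp: product_prob_space "\<lambda>_::nat \<times> nat. P" by standard
  define J0 where "J0 = {1..n} \<times> {0::nat}"
  define J1 where "J1 = {1..n} \<times> {1..<q}"
  have J: "J = J0 \<union> J1" "J0 \<inter> J1 = {}" "finite J" "finite J0" "finite J1"
    using q by (auto simp: J_def J0_def J1_def)
  interpret \<Omega>: prob_space \<Omega> unfolding \<Omega>_def by (rule prob_space_PiM) (rule P)
  define E where "E = (\<lambda>u v (z :: nat \<times> nat \<Rightarrow> 'z). 2 * \<kappa> * real m + 1 < (\<Sum>i=1..n. \<bar>u (z (i, 0::nat)) - v (z (i, 0)) :: real\<bar>))"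
  define G where "G = (\<lambda>u v (z :: nat \<times> nat \<Rightarrow> 'z). \<forall>p\<in>J1. \<bar>u (z p) - v (z p) :: real\<bar> \<le> \<theta>)"
  define A where "A = {z\<in>space \<Omega>. \<exists>(u, v)\<in>W. E u v z}"
  define B where "B = {z\<in>space \<Omega>. \<exists>(u, v)\<in>W. E u v z \<and> G u v z}"
  have comp: "(\<lambda>z. u (z p)) \<in> borel_measurable (PiM I (\<lambda>_. P))" if "u \<in> F" "p \<in> I" for u p and I :: "(nat \<times> nat) set"
    using measurable_compose[OF measurable_component_singleton[of p I "\<lambda>_. P"], of u borel] that meas by simp
  have Em: "{z\<in>space \<Omega>. E u v z} \<in> sets \<Omega>" if "(u, v) \<in> W" for u v
  proof -
    have "(\<lambda>z. \<Sum>i=1..n. \<bar>u (z (i, 0::nat)) - v (z (i, 0))\<bar>) \<in> borel_measurable \<Omega>"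
      unfolding \<Omega>_def using W(2)[OF that] q
      by (intro borel_measurable_sum borel_measurable_abs borel_measurable_diff comp) (auto simp: J_def)
    then show ?thesis unfolding E_def by measurable
  qed
  have Gm': "{z\<in>space (PiM I (\<lambda>_. P)). G u v z} \<in> sets (PiM I (\<lambda>_. P))" if "(u, v) \<in> W" "J1 \<subseteq> I" for u v I
  proof -
    have "(\<lambda>z. \<bar>u (z p) - v (z p)\<bar>) \<in> borel_measurable (PiM I (\<lambda>_. P))" if "p \<in> J1" for p
      using W(2)[OF \<open>(u, v) \<in> W\<close>] that \<open>J1 \<subseteq> I\<close>
      by (intro borel_measurable_abs borel_measurable_diff comp) auto
    then have "{z\<in>space (PiM I (\<lambda>_. P)). \<bar>u (z p) - v (z p)\<bar> \<le> \<theta>} \<in> sets (PiM I (\<lambda>_. P))" if "p \<in> J1" for p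
      using that by measurable
    then show ?thesis unfolding G_def using J by (intro sets.sets_Collect_finite_All) auto
  qed
  have Gm: "{z\<in>space \<Omega>. G u v z} \<in> sets \<Omega>" if "(u, v) \<in> W" for u v
    unfolding \<Omega>_def using that J by (intro Gm') auto
  have "A = (\<Union>(u, v)\<in>W. {z\<in>space \<Omega>. E u v z})" by (auto simp: A_def)
  then have A[measurable]: "A \<in> sets \<Omega>" using Em W by (auto intro!: sets.countable_UN')
  have "B = (\<Union>(u, v)\<in>W. {z\<in>space \<Omega>. E u v z} \<inter> {z\<in>space \<Omega>. G u v z})" by (auto simp: B_def)
  then have B[measurable]: "B \<in> sets \<Omega>" using Em Gm W by (auto intro!: sets.countable_UN')

  \<comment> \<open>Union bound over the at most n q entries outside column 0: with probability at
    least 1/2 the pair agrees up to \<theta> at all of them.\<close>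
  have ghost: "1 \<le> 2 * (\<integral>\<^sup>+y. indicator {y\<in>space (PiM J1 (\<lambda>_. P)). G u v y} y \<partial>PiM J1 (\<lambda>_. P))"
    if uv: "(u, v) \<in> W" for u v
  proof -
    interpret J1: prob_space "PiM J1 (\<lambda>_. P)" by (rule prob_space_PiM) (rule P)
    let ?D = "{z\<in>space P. \<theta> < \<bar>u z - v z\<bar>}"
    have D: "?D \<in> sets P"
    proof -
      have [measurable]: "u \<in> borel_measurable P" "v \<in> borel_measurable P"
        using W(2)[OF uv] meas by auto
      show ?thesis by measurable
    qed
    let ?C = "\<lambda>p. {y\<in>space (PiM J1 (\<lambda>_. P)). y p \<in> ?D}"
    have C: "?C p \<in> sets (PiM J1 (\<lambda>_. P))" if "p \<in> J1" for p
    proof -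
      have "(\<lambda>y. y p) -` ?D \<inter> space (PiM J1 (\<lambda>_. P)) \<in> sets (PiM J1 (\<lambda>_. P))"
        using that D by (intro measurable_sets[OF measurable_component_singleton[of p J1 "\<lambda>_. P"]])
      also have "(\<lambda>y. y p) -` ?D \<inter> space (PiM J1 (\<lambda>_. P)) = ?C p" by auto
      finally show ?thesis .
    qed
    have Cm: "measure (PiM J1 (\<lambda>_. P)) (?C p) = measure P ?D" if "p \<in> J1" for p
    proof -
      have "measure P ?D = measure (distr (PiM J1 (\<lambda>_. P)) P (\<lambda>y. y p)) ?D"
        using that by (subst distr_PiM_component) (auto simp: P)
      also have "\<dots> = measure (PiM J1 (\<lambda>_. P)) ((\<lambda>y. y p) -` ?D \<inter> space (PiM J1 (\<lambda>_. P)))"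
        using that D by (intro measure_distr measurable_component_singleton)
      also have "(\<lambda>y. y p) -` ?D \<inter> space (PiM J1 (\<lambda>_. P)) = ?C p" by auto
      finally show ?thesis by simp
    qed
    have "space (PiM J1 (\<lambda>_. P)) - {y\<in>space (PiM J1 (\<lambda>_. P)). G u v y} = (\<Union>p\<in>J1. ?C p)"
    proof -
      have "y p \<in> space P" if "y \<in> space (PiM J1 (\<lambda>_. P))" "p \<in> J1" for y p
        using that by (simp add: space_PiM PiE_iff)
      then show ?thesis unfolding G_def by (auto simp: not_le)
    qed
    then have "J1.prob (space (PiM J1 (\<lambda>_. P)) - {y\<in>space (PiM J1 (\<lambda>_. P)). G u v y}) \<le> (\<Sum>p\<in>J1. J1.prob (?C p))"
      using J C by (auto intro!: J1.finite_measure_subadditive_finite)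
    also have "\<dots> = real (card J1) * measure P ?D" using Cm by simp
    also have "\<dots> \<le> real n * real q * measure P ?D"
      unfolding J1_def by (intro mult_right_mono) (auto simp flip: of_nat_mult)
    also have "\<dots> \<le> 1 / 2" by (rule rare[OF uv])
    finally have "1 / 2 \<le> J1.prob {y\<in>space (PiM J1 (\<lambda>_. P)). G u v y}"
      using Gm'[OF uv, of J1] by (subst (asm) J1.prob_compl) auto
    then have "ennreal 1 \<le> ennreal (2 * J1.prob {y\<in>space (PiM J1 (\<lambda>_. P)). G u v y})"
      by (intro ennreal_leI) simp
    also have "\<dots> = 2 * (\<integral>\<^sup>+y. indicator {y\<in>space (PiM J1 (\<lambda>_. P)). G u v y} y \<partial>PiM J1 (\<lambda>_. P))"
      using Gm'[OF uv, of J1] by (simp add: ennreal_mult J1.emeasure_eq_measure)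
    finally show ?thesis by simp
  qed

  have AB: "emeasure \<Omega> A \<le> 2 * emeasure \<Omega> B"
  proof -
    have fold: "(\<integral>\<^sup>+z. indicator X z \<partial>\<Omega>) = (\<integral>\<^sup>+x. (\<integral>\<^sup>+y. indicator X (merge J0 J1 (x, y)) \<partial>PiM J1 (\<lambda>_. P)) \<partial>PiM J0 (\<lambda>_. P))"
      if "X \<in> sets \<Omega>" for X
      using that J unfolding \<Omega>_def J(1)
      by (intro pp.product_nn_integral_fold) auto
    have Bm: "(\<lambda>x. \<integral>\<^sup>+y. indicator B (merge J0 J1 (x, y)) \<partial>PiM J1 (\<lambda>_. P)) \<in> borel_measurable (PiM J0 (\<lambda>_. P))"
    proof -
      interpret J1: finite_product_sigma_finite "\<lambda>_. P" J1 by standard (rule J)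
      have [measurable]: "B \<in> sets (PiM (J0 \<union> J1) (\<lambda>_. P))" using B by (simp add: \<Omega>_def J)
      have [measurable]: "merge J0 J1 \<in> measurable (PiM J0 (\<lambda>_. P) \<Otimes>\<^sub>M PiM J1 (\<lambda>_. P)) (PiM (J0 \<union> J1) (\<lambda>_. P))"
        by (rule measurable_merge)
      show ?thesis by (intro J1.borel_measurable_nn_integral) measurable
    qed
    have "emeasure \<Omega> A = (\<integral>\<^sup>+x. (\<integral>\<^sup>+y. indicator A (merge J0 J1 (x, y)) \<partial>PiM J1 (\<lambda>_. P)) \<partial>PiM J0 (\<lambda>_. P))"
      using fold[OF A] by simp
    also have "\<dots> \<le> (\<integral>\<^sup>+x. 2 * (\<integral>\<^sup>+y. indicator B (merge J0 J1 (x, y)) \<partial>PiM J1 (\<lambda>_. P)) \<partial>PiM J0 (\<lambda>_. P))"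
    proof (rule nn_integral_mono)
      \<comment> \<open>The pair is chosen once column 0 is known but before the other columns are
        drawn; by independence the bound 1/2 holds for it although it depends on
        \<open>x\<close>.\<close>
      fix x assume x: "x \<in> space (PiM J0 (\<lambda>_. P))"
      have Eeq: "E u v (merge J0 J1 (x, y)) \<longleftrightarrow> E u v x" for u v y
        by (auto simp: E_def merge_def J0_def)
      have Geq: "G u v (merge J0 J1 (x, y)) \<longleftrightarrow> G u v y" for u v y
        using J(2) by (auto simp: G_def merge_def)
      have sp: "merge J0 J1 (x, y) \<in> space \<Omega>" if "y \<in> space (PiM J1 (\<lambda>_. P))" for y
        using x that J(2) unfolding \<Omega>_def J(1) space_PiM by (auto simp: PiE_iff merge_def extensional_def)
      show "(\<integral>\<^sup>+y. indicator A (merge J0 J1 (x, y)) \<partial>PiM J1 (\<lambda>_. P)) \<le>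
          2 * (\<integral>\<^sup>+y. indicator B (merge J0 J1 (x, y)) \<partial>PiM J1 (\<lambda>_. P))"
      proof (cases "\<exists>(u, v)\<in>W. E u v x")
        case True
        then obtain u v where uv: "(u, v) \<in> W" "E u v x" by auto
        interpret J1: prob_space "PiM J1 (\<lambda>_. P)" by (rule prob_space_PiM) (rule P)
        have "(\<integral>\<^sup>+y. indicator A (merge J0 J1 (x, y)) \<partial>PiM J1 (\<lambda>_. P)) \<le> (\<integral>\<^sup>+y. 1 \<partial>PiM J1 (\<lambda>_. P))"
          by (intro nn_integral_mono) (auto simp: indicator_def)
        also have "\<dots> = 1" by (simp add: J1.emeasure_space_1)
        also have "\<dots> \<le> 2 * (\<integral>\<^sup>+y. indicator {y\<in>space (PiM J1 (\<lambda>_. P)). G u v y} y \<partial>PiM J1 (\<lambda>_. P))"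
          by (rule ghost[OF uv(1)])
        also have "\<dots> \<le> 2 * (\<integral>\<^sup>+y. indicator B (merge J0 J1 (x, y)) \<partial>PiM J1 (\<lambda>_. P))"
        proof (intro mult_left_mono nn_integral_mono)
          fix y assume "y \<in> space (PiM J1 (\<lambda>_. P))"
          then show "indicator {y\<in>space (PiM J1 (\<lambda>_. P)). G u v y} y \<le> (indicator B (merge J0 J1 (x, y)) :: ennreal)"
            using uv sp by (auto simp: indicator_def B_def Eeq Geq)
        qed simp
        finally show ?thesis .
      next
        case False
        then have "(\<integral>\<^sup>+y. indicator A (merge J0 J1 (x, y)) \<partial>PiM J1 (\<lambda>_. P)) = (\<integral>\<^sup>+y. 0 \<partial>PiM J1 (\<lambda>_. P))"
          by (intro nn_integral_cong) (auto simp: A_def Eeq indicator_def)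
        then show ?thesis by simp
      qed
    qed
    also have "\<dots> = 2 * (\<integral>\<^sup>+x. (\<integral>\<^sup>+y. indicator B (merge J0 J1 (x, y)) \<partial>PiM J1 (\<lambda>_. P)) \<partial>PiM J0 (\<lambda>_. P))"
      by (rule nn_integral_cmult[OF Bm])
    also have "\<dots> = 2 * emeasure \<Omega> B"
      using fold[OF B] by simp
    finally show ?thesis .
  qed

  define \<phi> where "\<phi> = (\<lambda>\<tau> (p::nat \<times> nat). (fst p, Transposition.transpose 0 (\<tau> (fst p) :: nat) (snd p)))"
  define sh where "sh = (\<lambda>\<tau> z. \<lambda>p\<in>J. (z (\<phi> \<tau> p) :: 'z))"
  define Ts where "Ts = ({1..n} \<rightarrow>\<^sub>E {..<q})"
  have finTs: "finite Ts" "card Ts = q ^ n" unfolding Ts_def by (auto simp: finite_PiE card_PiE)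
  have \<phi>J: "\<phi> \<tau> p \<in> J" if "\<tau> \<in> Ts" "p \<in> J" for \<tau> p
    using that by (auto simp: \<phi>_def J_def Ts_def PiE_iff Transposition.transpose_def)
  have \<phi>i: "\<phi> \<tau> (\<phi> \<tau> p) = p" for \<tau> p
    by (auto simp: \<phi>_def)
  have dist: "distr \<Omega> \<Omega> (sh \<tau>) = \<Omega>" if "\<tau> \<in> Ts" for \<tau>
    unfolding \<Omega>_def sh_def using \<phi>J[OF that] \<phi>i[of \<tau>]
    by (intro distr_PiM_reindex[of J "\<lambda>_. P"] P) (auto intro: inj_on_inverseI[of _ "\<phi> \<tau>"])
  have shm: "sh \<tau> \<in> measurable \<Omega> \<Omega>" if "\<tau> \<in> Ts" for \<tau>
    unfolding \<Omega>_def sh_def using \<phi>J[OF that]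
    by (intro measurable_restrict measurable_component_singleton) auto

  have count: "real (card {\<tau>\<in>Ts. sh \<tau> z \<in> B}) * real q ^ m \<le> K\<^sup>2 * real q ^ n" if z: "z \<in> space \<Omega>" for z
  proof -
    obtain T where T: "finite T" "real (card T) \<le> K"
      "\<And>u. u \<in> F \<Longrightarrow> \<exists>v\<in>T. \<forall>p\<in>J. \<bar>u (z p) - v (z p)\<bar> \<le> \<theta> / 4"
      using net[OF z] by blast
    define a where "a = (\<lambda>(v, v') p. \<bar>v (z p) - v' (z p) :: real\<bar>)"
    \<comment> \<open>The threshold 3\<theta>/2 lies midway between \<theta>, the bound off column
      0, and 2\<theta>, the level at which a row counts as differing. Replacing both functions by
      net approximations costs at most \<theta>/2, so large and small entries stay separated, and
      the admissible \<open>\<tau>\<close> are governed by a pair from a finite net.\<close>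
    define S where "S = (\<lambda>w. {\<tau>\<in>Ts. m \<le> card {i\<in>{1..n}. 3 * \<theta> / 2 < a w (i, \<tau> i)} \<and>
           (\<forall>i\<in>{1..n}. \<forall>j<q. 3 * \<theta> / 2 < a w (i, j) \<longrightarrow> j = \<tau> i)})"
    have Sc: "card (S w) * q ^ m \<le> q ^ n" for w
      unfolding S_def Ts_def by (rule card_forced_columns_le[OF q])
    have sub: "{\<tau>\<in>Ts. sh \<tau> z \<in> B} \<subseteq> (\<Union>w\<in>T\<times>T. S w)"
    proof
      fix \<tau> assume "\<tau> \<in> {\<tau>\<in>Ts. sh \<tau> z \<in> B}"
      then have \<tau>: "\<tau> \<in> Ts" and "sh \<tau> z \<in> B" by auto
      then obtain u u' where uu: "(u, u') \<in> W" "E u u' (sh \<tau> z)" "G u u' (sh \<tau> z)" by (auto simp: B_def)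
      have uF: "u \<in> F" "u' \<in> F" using W(2)[OF uu(1)] by auto
      from T(3)[OF uF(1)] obtain v where v: "v \<in> T" "\<And>p. p \<in> J \<Longrightarrow> \<bar>u (z p) - v (z p)\<bar> \<le> \<theta> / 4"
        by blast
      from T(3)[OF uF(2)] obtain v' where v': "v' \<in> T" "\<And>p. p \<in> J \<Longrightarrow> \<bar>u' (z p) - v' (z p)\<bar> \<le> \<theta> / 4"
        by blast
      have near: "\<bar>\<bar>u (z p) - u' (z p)\<bar> - a (v, v') p\<bar> \<le> \<theta> / 2" if "p \<in> J" for p
        using v(2)[OF that] v'(2)[OF that] unfolding a_def prod.case by linarith
      have \<tau>q: "\<tau> i < q" if "i \<in> {1..n}" for i using \<tau> that by (auto simp: Ts_def PiE_iff)
      \<comment> \<open>A large entry in a column other than \<open>\<tau> i\<close> would end up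
        outside column 0 after the exchange, where the pair agrees up to \<theta>.\<close>
      have off: "j = \<tau> i" if i: "i \<in> {1..n}" and j: "j < q" and big: "3 * \<theta> / 2 < a (v, v') (i, j)" for i j
      proof (rule ccontr)
        assume ne: "j \<noteq> \<tau> i"
        let ?j = "Transposition.transpose 0 (\<tau> i) j"
        have p: "(i, ?j) \<in> J1" using i j ne \<tau>q[OF i] by (auto simp: J1_def Transposition.transpose_def)
        then have "\<bar>u (sh \<tau> z (i, ?j)) - u' (sh \<tau> z (i, ?j))\<bar> \<le> \<theta>" using uu(3) by (auto simp: G_def)
        moreover have "sh \<tau> z (i, ?j) = z (i, j)"
          using p J by (auto simp: sh_def \<phi>_def)
        moreover have "(i, j) \<in> J" using i j by (auto simp: J_def)
        ultimately show False using near[of "(i, j)"] big by simp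
      qed
      have val: "sh \<tau> z (i, 0) = z (i, \<tau> i)" if "i \<in> {1..n}" for i
        using that q by (auto simp: sh_def \<phi>_def J_def)
      define d where "d = (\<lambda>i. \<bar>u (z (i, \<tau> i)) - u' (z (i, \<tau> i))\<bar>)"
      define R where "R = {i\<in>{1..n}. 2 * \<theta> < d i}"
      have d\<kappa>: "d i \<le> 2 * \<kappa>" for i
        using bd[OF uF(1), of "z (i, \<tau> i)"] bd[OF uF(2), of "z (i, \<tau> i)"] unfolding d_def by linarith
      have \<kappa>0: "0 \<le> \<kappa>" using bd[OF uF(1), of undefined] by linarith
      \<comment> \<open>With fewer than m rows above 2\<theta> the sum would be at most 2\<kappa>m +
        2\<theta>n, which by 2\<theta>n <= 1 does not exceed the level in \<open>E\<close>.\<close>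
      have "m \<le> card R"
      proof (rule ccontr)
        assume "\<not> m \<le> card R"
        then have cR: "card R \<le> m" by simp
        have "(\<Sum>i=1..n. d i) = (\<Sum>i\<in>R. d i) + (\<Sum>i\<in>{1..n} - R. d i)"
          by (subst sum.subset_diff[of R]) (auto simp: R_def)
        also have "\<dots> \<le> (\<Sum>i\<in>R. 2 * \<kappa>) + (\<Sum>i\<in>{1..n} - R. 2 * \<theta>)"
          by (intro add_mono sum_mono d\<kappa>) (auto simp: R_def)
        also have "\<dots> \<le> 2 * \<kappa> * real m + 2 * \<theta> * real n"
        proof -
          have "card ({1..n} - R) \<le> n" using card_mono[of "{1..n}" "{1..n} - R"] by simp
          then have "real (card ({1..n} - R)) * (2 * \<theta>) \<le> real n * (2 * \<theta>)"
            using \<theta> by (intro mult_right_mono) auto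
          moreover have "real (card R) * (2 * \<kappa>) \<le> real m * (2 * \<kappa>)"
            using cR \<kappa>0 by (intro mult_right_mono) auto
          ultimately show ?thesis by (simp add: algebra_simps)
        qed
        also have "\<dots> \<le> 2 * \<kappa> * real m + 1" using \<theta> by simp
        finally show False using uu(2) by (simp add: E_def val d_def)
      qed
      also have "\<dots> \<le> card {i\<in>{1..n}. 3 * \<theta> / 2 < a (v, v') (i, \<tau> i)}"
      proof (rule card_mono)
        show "R \<subseteq> {i\<in>{1..n}. 3 * \<theta> / 2 < a (v, v') (i, \<tau> i)}"
        proof
          fix i assume i: "i \<in> R"
          then have "(i, \<tau> i) \<in> J" using \<tau>q by (auto simp: J_def R_def)
          from near[OF this] have "\<bar>d i - a (v, v') (i, \<tau> i)\<bar> \<le> \<theta> / 2" by (simp add: d_def)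
          moreover have "2 * \<theta> < d i" using i by (simp add: R_def)
          ultimately have "3 * \<theta> / 2 < a (v, v') (i, \<tau> i)" by linarith
          then show "i \<in> {i\<in>{1..n}. 3 * \<theta> / 2 < a (v, v') (i, \<tau> i)}"
            using i by (simp add: R_def)
        qed
      qed simp
      finally have "\<tau> \<in> S (v, v')" using \<tau> off by (auto simp: S_def)
      then show "\<tau> \<in> (\<Union>w\<in>T\<times>T. S w)" using v v' by blast
    qed
    have "card {\<tau>\<in>Ts. sh \<tau> z \<in> B} \<le> card (\<Union>w\<in>T\<times>T. S w)"
      using T finTs by (intro card_mono sub) (auto simp: S_def)
    also have "\<dots> \<le> (\<Sum>w\<in>T\<times>T. card (S w))"
      using T by (intro card_UN_le) auto
    finally have "card {\<tau>\<in>Ts. sh \<tau> z \<in> B} * q ^ m \<le> (\<Sum>w\<in>T\<times>T. card (S w) * q ^ m)"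
      by (simp add: sum_distrib_right[symmetric])
    also have "\<dots> \<le> (\<Sum>w\<in>T\<times>T. q ^ n)" by (intro sum_mono Sc)
    also have "\<dots> = (card T)\<^sup>2 * q ^ n" by (simp add: card_cartesian_product power2_eq_square)
    finally have "real (card {\<tau>\<in>Ts. sh \<tau> z \<in> B} * q ^ m) \<le> real ((card T)\<^sup>2 * q ^ n)"
      by (simp only: of_nat_le_iff)
    also have "\<dots> \<le> K\<^sup>2 * real q ^ n"
      using T(2) by (auto intro!: mult_right_mono power_mono)
    finally show ?thesis by simp
  qed

  \<comment> \<open>Average over all q^n exchanges: each lands in \<open>B\<close> with the same
    probability, while for every fixed array at most a fraction K^2 / q^m of them does.\<close>
  have "ennreal (real q ^ n) * emeasure \<Omega> B = (\<Sum>\<tau>\<in>Ts. emeasure \<Omega> B)"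
    by (simp add: finTs ennreal_of_nat_eq_real_of_nat)
  also have "\<dots> = (\<Sum>\<tau>\<in>Ts. \<integral>\<^sup>+z. indicator B (sh \<tau> z) \<partial>\<Omega>)"
  proof (rule sum.cong)
    fix \<tau> assume \<tau>: "\<tau> \<in> Ts"
    have "emeasure \<Omega> B = (\<integral>\<^sup>+z. indicator B z \<partial>distr \<Omega> \<Omega> (sh \<tau>))" by (simp add: dist[OF \<tau>])
    also have "\<dots> = (\<integral>\<^sup>+z. indicator B (sh \<tau> z) \<partial>\<Omega>)"
      by (rule nn_integral_distr[OF shm[OF \<tau>]]) simp
    finally show "emeasure \<Omega> B = (\<integral>\<^sup>+z. indicator B (sh \<tau> z) \<partial>\<Omega>)" .
  qed simp
  also have "\<dots> = (\<integral>\<^sup>+z. (\<Sum>\<tau>\<in>Ts. indicator B (sh \<tau> z)) \<partial>\<Omega>)"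
    using shm by (intro nn_integral_sum[symmetric]) (auto intro: measurable_compose)
  also have "\<dots> \<le> (\<integral>\<^sup>+z. ennreal (K\<^sup>2 * real q ^ n / real q ^ m) \<partial>\<Omega>)"
  proof (rule nn_integral_mono)
    fix z assume z: "z \<in> space \<Omega>"
    have "(\<Sum>\<tau>\<in>Ts. indicator B (sh \<tau> z)) = (of_nat (card {\<tau>\<in>Ts. sh \<tau> z \<in> B}) :: ennreal)"
      using finTs by (simp add: indicator_def sum.If_cases Int_def)
    also have "\<dots> = ennreal (real (card {\<tau>\<in>Ts. sh \<tau> z \<in> B}))" by (simp add: ennreal_of_nat_eq_real_of_nat)
    also have "\<dots> \<le> ennreal (K\<^sup>2 * real q ^ n / real q ^ m)"
      using count[OF z] q by (intro ennreal_leI) (simp add: field_simps)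
    finally show "(\<Sum>\<tau>\<in>Ts. indicator B (sh \<tau> z)) \<le> ennreal (K\<^sup>2 * real q ^ n / real q ^ m)" .
  qed
  also have "\<dots> = ennreal (K\<^sup>2 * real q ^ n / real q ^ m)"
    by (simp add: \<Omega>.emeasure_space_1)
  finally have "real q ^ n * measure \<Omega> B \<le> K\<^sup>2 * real q ^ n / real q ^ m"
    by (simp add: \<Omega>.emeasure_eq_measure ennreal_mult[symmetric])
  then have "measure \<Omega> B \<le> K\<^sup>2 / real q ^ m"
    using q by (simp add: field_simps)
  moreover have "measure \<Omega> A \<le> 2 * measure \<Omega> B"
  proof -
    have "ennreal (measure \<Omega> A) \<le> ennreal (2 * measure \<Omega> B)"
      using AB by (simp add: \<Omega>.emeasure_eq_measure ennreal_mult)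
    then show ?thesis by simp
  qed
  ultimately show ?thesis unfolding A_def E_def by simp
qed

section \<open>Classes with polynomial uniform entropy\<close>

text \<open>Lets the ghost columns be taken from later terms of the same sequence, so that the whole
  array lives on the given probability space.\<close>

lemma (in iid_sequence) distr_sample:
  fixes J :: "'i set" and e :: "'i \<Rightarrow> nat"
  assumes e: "inj_on e J"
  shows "distr M (PiM J (\<lambda>_. P)) (\<lambda>\<omega>. \<lambda>p\<in>J. Z (e p) \<omega>) = PiM J (\<lambda>_. P)"
proof -
  have "distr M (PiM UNIV (\<lambda>_. borel)) (\<lambda>\<omega>. \<lambda>i\<in>UNIV. Z i \<omega>) = PiM UNIV (\<lambda>i. distr M borel (Z i))"
    using indep by (subst (asm) indep_vars_iff_distr_eq_PiM) auto
  then have full: "distr M (PiM UNIV (\<lambda>_. P)) (\<lambda>\<omega> i. Z i \<omega>) = PiM UNIV (\<lambda>_. P)"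
    by (simp add: law restrict_def sets_PiM_cong[OF refl sets_P] cong: distr_cong)
  have m: "(\<lambda>\<omega> i. Z i \<omega>) \<in> measurable M (PiM UNIV (\<lambda>_. P))"
  proof -
    have "(\<lambda>\<omega>. \<lambda>i\<in>UNIV. Z i \<omega>) \<in> measurable M (PiM UNIV (\<lambda>_. P))"
      using measurable_Z by (intro measurable_restrict) (simp cong: measurable_cong_sets[OF refl sets_P])
    then show ?thesis by (simp add: restrict_def)
  qed
  have "PiM J (\<lambda>_. P) = distr (PiM UNIV (\<lambda>_. P)) (PiM J (\<lambda>_. P)) (\<lambda>x. \<lambda>p\<in>J. x (e p))"
    using e by (intro distr_PiM_reindex[symmetric] prob_space_P) auto
  also have "\<dots> = distr (distr M (PiM UNIV (\<lambda>_. P)) (\<lambda>\<omega> i. Z i \<omega>)) (PiM J (\<lambda>_. P)) (\<lambda>x. \<lambda>p\<in>J. x (e p))"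
    by (simp only: full)
  also have "\<dots> = distr M (PiM J (\<lambda>_. P)) ((\<lambda>x. \<lambda>p\<in>J. x (e p)) \<circ> (\<lambda>\<omega> i. Z i \<omega>))"
    by (rule distr_distr[OF _ m]) (auto intro!: measurable_restrict measurable_component_singleton)
  finally show ?thesis by (simp add: comp_def)
qed

text \<open>Compared with a bound on the uniform covering number, nets here lie inside
  \<open>F\<close>, radii are absolute instead of multiples of the envelope norm, and the exponent
  is a natural number, so that net sizes become plain powers of n.\<close>

locale entropy_class = iid_sequence M Z P
  for M :: "'w measure" and Z :: "nat \<Rightarrow> 'w \<Rightarrow> 'z::topological_space" and P :: "'z measure" +
  fixes F :: "('z \<Rightarrow> real) set" and \<kappa> C :: real and \<nu> :: nat
  assumes F_measurable: "\<And>u. u \<in> F \<Longrightarrow> u \<in> borel_measurable borel"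
    and F_bounded: "\<And>u z. u \<in> F \<Longrightarrow> \<bar>u z\<bar> \<le> \<kappa>"
    and \<kappa>_ge_1: "1 \<le> \<kappa>" and C_ge_1: "1 \<le> C"
    and entropy: "\<And>Q \<delta>. prob_space Q \<Longrightarrow> sets Q = sets borel \<Longrightarrow> 0 < \<delta> \<Longrightarrow> \<delta> \<le> 1 \<Longrightarrow>
      \<exists>T\<subseteq>F. finite T \<and> real (card T) \<le> C * (1 / \<delta>) ^ \<nu> \<and>
        (\<forall>u\<in>F. \<exists>v\<in>T. (LINT z|Q. (u z - v z)\<^sup>2) \<le> \<delta>\<^sup>2)"
    and pointwise_measurable: "pointwise_measurable_class borel F"
begin

lemma diff_bounded: "u \<in> F \<Longrightarrow> v \<in> F \<Longrightarrow> \<bar>u z - v z\<bar> \<le> 2 * \<kappa>"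
  using F_bounded[of u z] F_bounded[of v z] by linarith

lemma integrable_F: "u \<in> F \<Longrightarrow> integrable P u"
  by (rule integrable_P_bounded[OF F_measurable F_bounded])

lemma integrable_diff_square:
  assumes "u \<in> F" "v \<in> F"
  shows "integrable P (\<lambda>z. (u z - v z)\<^sup>2)"
proof (rule integrable_P_bounded[where b="(2 * \<kappa>)\<^sup>2"])
  note [measurable] = F_measurable[OF assms(1)] F_measurable[OF assms(2)]
  show "(\<lambda>z. (u z - v z)\<^sup>2) \<in> borel_measurable borel" by measurable
  show "\<bar>(u z - v z)\<^sup>2\<bar> \<le> (2 * \<kappa>)\<^sup>2" for z
    using power_mono[OF diff_bounded[OF assms, of z] abs_ge_zero, of 2] by simp
qed

lemma integrable_square:
  assumes "u \<in> F"
  shows "integrable P (\<lambda>z. (u z)\<^sup>2)"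
proof (rule integrable_P_bounded[where b="\<kappa>\<^sup>2"])
  note [measurable] = F_measurable[OF assms]
  show "(\<lambda>z. (u z)\<^sup>2) \<in> borel_measurable borel" by measurable
  show "\<bar>(u z)\<^sup>2\<bar> \<le> \<kappa>\<^sup>2" for z
    using power_mono[OF F_bounded[OF assms, of z] abs_ge_zero, of 2] by simp
qed

text \<open>Entropy applied to the empirical measure of the points, repetitions counted. One squared
  difference is at most the sum of all, that is card J times their mean, so L_2 closeness \<delta>
  controls each point up to \<delta> sqrt(card J).\<close>

lemma empirical_net:
  fixes J :: "'i set" and z :: "'i \<Rightarrow> 'z"
  assumes J: "finite J" "J \<noteq> {}" and \<delta>: "0 < \<delta>" "\<delta> \<le> 1"
  shows "\<exists>T. finite T \<and> real (card T) \<le> C * (1 / \<delta>) ^ \<nu> \<and>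
           (\<forall>u\<in>F. \<exists>v\<in>T. \<forall>p\<in>J. \<bar>u (z p) - v (z p)\<bar> \<le> \<delta> * sqrt (real (card J)))"
proof -
  define Q where "Q = distr (measure_pmf (pmf_of_set J)) borel z"
  have "prob_space Q" unfolding Q_def by (rule prob_space.prob_space_distr) (auto intro: prob_space_measure_pmf)
  moreover have "sets Q = sets borel" by (simp add: Q_def)
  ultimately obtain T where T: "T \<subseteq> F" "finite T" "real (card T) \<le> C * (1 / \<delta>) ^ \<nu>"
    "\<And>u. u \<in> F \<Longrightarrow> \<exists>v\<in>T. (LINT z|Q. (u z - v z)\<^sup>2) \<le> \<delta>\<^sup>2"
    using entropy[of Q \<delta>] \<delta> by blast
  have near: "\<bar>u (z p) - v (z p)\<bar> \<le> \<delta> * sqrt (real (card J))"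
    if uv: "u \<in> F" "v \<in> F" and le: "(LINT z|Q. (u z - v z)\<^sup>2) \<le> \<delta>\<^sup>2" and p: "p \<in> J" for u v p
  proof -
    note [measurable] = F_measurable[OF uv(1)] F_measurable[OF uv(2)]
    have "(LINT z|Q. (u z - v z)\<^sup>2) = (\<Sum>p\<in>J. (u (z p) - v (z p))\<^sup>2) / real (card J)"
    proof -
      have [measurable]: "(\<lambda>z. (u z - v z)\<^sup>2) \<in> borel_measurable borel" by measurable
      have "(LINT z|Q. (u z - v z)\<^sup>2) = (LINT p|measure_pmf (pmf_of_set J). (u (z p) - v (z p))\<^sup>2)"
        unfolding Q_def by (rule integral_distr) simp_all
      then show ?thesis by (simp only: integral_pmf_of_set[OF J(2,1)])
    qed
    moreover have "(u (z p) - v (z p))\<^sup>2 \<le> (\<Sum>p\<in>J. (u (z p) - v (z p))\<^sup>2)"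
      using J p by (intro member_le_sum) auto
    moreover have "0 < card J" using J by (simp add: card_gt_0_iff)
    ultimately have "(u (z p) - v (z p))\<^sup>2 \<le> real (card J) * (LINT z|Q. (u z - v z)\<^sup>2)"
      by simp
    also have "\<dots> \<le> real (card J) * \<delta>\<^sup>2" using le by (rule mult_left_mono) simp
    finally have "(u (z p) - v (z p))\<^sup>2 \<le> \<delta>\<^sup>2 * real (card J)" by (simp only: mult.commute)
    then have "sqrt ((u (z p) - v (z p))\<^sup>2) \<le> sqrt (\<delta>\<^sup>2 * real (card J))" by (rule real_sqrt_le_mono)
    then show ?thesis using \<delta> by (simp add: real_sqrt_mult)
  qed
  have "\<forall>u\<in>F. \<exists>v\<in>T. \<forall>p\<in>J. \<bar>u (z p) - v (z p)\<bar> \<le> \<delta> * sqrt (real (card J))"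
  proof
    fix u assume u: "u \<in> F"
    from T(4)[OF u] obtain v where v: "v \<in> T" "(LINT z|Q. (u z - v z)\<^sup>2) \<le> \<delta>\<^sup>2" by (rule bexE)
    have "\<forall>p\<in>J. \<bar>u (z p) - v (z p)\<bar> \<le> \<delta> * sqrt (real (card J))"
      using near[OF u subsetD[OF T(1) v(1)] v(2)] by (rule ballI)
    then show "\<exists>v\<in>T. \<forall>p\<in>J. \<bar>u (z p) - v (z p)\<bar> \<le> \<delta> * sqrt (real (card J))" using v(1) by (rule bexI)
  qed
  with T(2,3) show ?thesis by (intro exI[of _ T]) simp
qed

text \<open>The level of the ghost sample bound for m = 4\<nu> + 2. At net radius of order n^-2 the
  squared net size grows like n^(4\<nu>), so division by q^m with q = n leaves the summable
  n^-2.\<close>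

definition near_bound :: real where "near_bound = 2 * \<kappa> * real (4 * \<nu> + 2) + 1"

lemma near_bound_pos: "0 < near_bound"
  using \<kappa>_ge_1 unfolding near_bound_def by (intro add_nonneg_pos mult_nonneg_nonneg) auto

text \<open>The threshold 1/(32 n^4) comes from Markov's inequality: with \<theta> = 1/(4n) it
  bounds the P-probability of a difference above \<theta> by 1/(2 n^2), just what a union over n q
  entries with q = n can afford.\<close>

lemma near_agreement_countable:
  fixes W :: "(('z \<Rightarrow> real) \<times> ('z \<Rightarrow> real)) set"
  assumes n: "1 \<le> n" and W: "countable W"
    "\<And>u v. (u, v) \<in> W \<Longrightarrow> u \<in> F \<and> v \<in> F \<and> (LINT z|P. (u z - v z)\<^sup>2) < 1 / (32 * real n ^ 4)"
  shows "{\<omega>\<in>space M. \<exists>(u, v)\<in>W. near_bound < (\<Sum>i=1..n. \<bar>u (Z i \<omega>) - v (Z i \<omega>)\<bar>)} \<in> sets M" (is "?E \<in> _")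
    and "prob {\<omega>\<in>space M. \<exists>(u, v)\<in>W. near_bound < (\<Sum>i=1..n. \<bar>u (Z i \<omega>) - v (Z i \<omega>)\<bar>)} \<le>
      2 * C\<^sup>2 * 16 ^ (2 * \<nu>) / (real n)\<^sup>2"
proof -
  define J where "J = {1..n} \<times> {..<n}"
  define \<Omega> where "\<Omega> = PiM J (\<lambda>_. P)"
  define A where "A = {z\<in>space \<Omega>. \<exists>(u, v)\<in>W. near_bound < (\<Sum>i=1..n. \<bar>u (z (i, 0)) - v (z (i, 0))\<bar>)}"
  \<comment> \<open>Column j receives the terms with indices n j + 1 to n j + n; column 0 is the
    sample itself.\<close>
  define e where "e = (\<lambda>(i, j). i + n * j)"
  have "inj_on e J"
  proof (rule inj_onI)
    fix p p' assume p: "p \<in> J" "p' \<in> J" "e p = e p'"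
    obtain i j i' j' where ij: "p = (i, j)" "p' = (i', j')" by (metis surj_pair)
    have eq: "(i - 1) + n * j = (i' - 1) + n * j'" and i: "i - 1 < n" "i' - 1 < n" "1 \<le> i" "1 \<le> i'"
      using p by (auto simp: ij e_def J_def)
    have "i - 1 = ((i - 1) + n * j) mod n" using i by (simp only: mod_mult_self2 mod_less)
    also have "\<dots> = i' - 1" unfolding eq using i by (simp only: mod_mult_self2 mod_less)
    finally have "i = i'" using i by simp
    then show "p = p'" using eq n by (simp add: ij)
  qed
  then have \<Omega>: "distr M \<Omega> (\<lambda>\<omega>. \<lambda>p\<in>J. Z (e p) \<omega>) = \<Omega>"
    unfolding \<Omega>_def by (rule distr_sample)
  have Fm: "u \<in> borel_measurable P" if "u \<in> F" for u
    using F_measurable[OF that] by (simp cong: measurable_cong_sets[OF sets_P refl])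
  have Sm: "(\<lambda>\<omega>. \<Sum>i=1..n. \<bar>u (Z i \<omega>) - v (Z i \<omega>)\<bar>) \<in> borel_measurable M" if "u \<in> F" "v \<in> F" for u v
    using that by (intro borel_measurable_sum borel_measurable_abs borel_measurable_diff
      measurable_compose[OF measurable_Z F_measurable]) auto
  have WF: "fst w \<in> F" "snd w \<in> F" if "w \<in> W" for w
    using W(2)[of "fst w" "snd w"] that by simp_all
  show E: "?E \<in> sets M"
    unfolding split_beta
    by (intro sets.sets_Collect_countable_Ex' W(1) borel_measurable_less borel_measurable_const Sm WF)
  have Am: "A \<in> sets \<Omega>"
  proof -
    have S: "(\<lambda>z. \<Sum>i=1..n. \<bar>u (z (i, 0)) - v (z (i, 0))\<bar>) \<in> borel_measurable \<Omega>" if "u \<in> F" "v \<in> F" for u v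
    proof -
      have "(\<lambda>z. w (z (i, 0))) \<in> borel_measurable \<Omega>" if "w \<in> F" "i \<in> {1..n}" for w i
        using measurable_compose[OF measurable_component_singleton[of "(i, 0)" J "\<lambda>_. P"], of w borel] that Fm n
        by (simp add: \<Omega>_def J_def)
      then show ?thesis
        using that by (intro borel_measurable_sum borel_measurable_abs borel_measurable_diff) auto
    qed
    show ?thesis
      unfolding A_def split_beta
      by (intro sets.sets_Collect_countable_Ex' W(1) borel_measurable_less borel_measurable_const S WF)
  qed
  have zm: "(\<lambda>\<omega>. \<lambda>p\<in>J. Z (e p) \<omega>) \<in> measurable M \<Omega>"
    unfolding \<Omega>_def using measurable_Z
    by (intro measurable_restrict) (simp cong: measurable_cong_sets[OF refl sets_P])
  have "prob ?E = prob ((\<lambda>\<omega>. \<lambda>p\<in>J. Z (e p) \<omega>) -` A \<inter> space M)"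
  proof (rule arg_cong[where f=prob])
    define z where "z = (\<lambda>\<omega>. \<lambda>p\<in>J. Z (e p) \<omega>)"
    have zs: "z \<omega> \<in> space \<Omega>" if "\<omega> \<in> space M" for \<omega>
      unfolding z_def by (rule measurable_space[OF zm that])
    have "z \<omega> (i, 0) = Z i \<omega>" if "i \<in> {1..n}" for i \<omega>
      using that n by (auto simp: z_def J_def e_def)
    then have Seq: "(\<Sum>i=1..n. \<bar>u (z \<omega> (i, 0)) - v (z \<omega> (i, 0))\<bar>) = (\<Sum>i=1..n. \<bar>u (Z i \<omega>) - v (Z i \<omega>)\<bar>)" for u v \<omega>
      by (intro sum.cong) simp_all
    have "?E = z -` A \<inter> space M"
      unfolding A_def split_beta using zs
      by (intro set_eqI) (simp only: mem_Collect_eq Int_iff vimage_eq Seq, blast)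
    then show "?E = (\<lambda>\<omega>. \<lambda>p\<in>J. Z (e p) \<omega>) -` A \<inter> space M" by (simp only: z_def)
  qed
  also have "\<dots> = measure \<Omega> A"
    using measure_distr[OF zm Am] by (simp add: \<Omega>)
  also have "\<dots> \<le> 2 * (C * (16 * real n ^ 2) ^ \<nu>)\<^sup>2 / real n ^ (4 * \<nu> + 2)"
    unfolding A_def \<Omega>_def J_def near_bound_def
  proof (rule measure_differ_much_le_ghost[where F=F and \<theta>="1 / (4 * real n)"])
    show "real n * real n * measure P {z \<in> space P. 1 / (4 * real n) < \<bar>u z - v z\<bar>} \<le> 1 / 2"
      if uv: "(u, v) \<in> W" for u v
    proof -
      note uvF = W(2)[OF uv]
      have [measurable]: "u \<in> borel_measurable borel" "v \<in> borel_measurable borel" using uvF F_measurable by auto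
      have "emeasure P {z\<in>space P. (u z - v z)\<^sup>2 \<ge> 1 / (16 * real n ^ 2)} \<le>
          ennreal ((1 / (1 / (16 * real n ^ 2))) * (LINT z|P. (u z - v z)\<^sup>2))"
        using n uvF integrable_diff_square[of u v] by (intro integral_Markov_inequality) auto
      then have "measure P {z\<in>space P. (u z - v z)\<^sup>2 \<ge> 1 / (16 * real n ^ 2)} \<le> 16 * real n ^ 2 * (LINT z|P. (u z - v z)\<^sup>2)"
        by (simp add: P.emeasure_eq_measure)
      moreover have "measure P {z \<in> space P. 1 / (4 * real n) < \<bar>u z - v z\<bar>} \<le>
          measure P {z\<in>space P. (u z - v z)\<^sup>2 \<ge> 1 / (16 * real n ^ 2)}"
      proof (rule P.finite_measure_mono)
        have "1 / (16 * real n ^ 2) \<le> x\<^sup>2" if "1 / (4 * real n) < \<bar>x\<bar>" for x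
          using power_mono[OF less_imp_le[OF that], of 2] n by (simp add: power_divide power_mult_distrib)
        then show "{z \<in> space P. 1 / (4 * real n) < \<bar>u z - v z\<bar>} \<subseteq> {z\<in>space P. (u z - v z)\<^sup>2 \<ge> 1 / (16 * real n ^ 2)}"
          by blast
      qed measurable
      moreover have "16 * real n ^ 2 * (LINT z|P. (u z - v z)\<^sup>2) \<le> 16 * real n ^ 2 * (1 / (32 * real n ^ 4))"
        using uvF by (intro mult_left_mono) auto
      ultimately have "measure P {z \<in> space P. 1 / (4 * real n) < \<bar>u z - v z\<bar>} \<le> 16 * real n ^ 2 * (1 / (32 * real n ^ 4))"
        by linarith
      then have "real n ^ 2 * measure P {z \<in> space P. 1 / (4 * real n) < \<bar>u z - v z\<bar>} \<le> real n ^ 2 * (16 * real n ^ 2 * (1 / (32 * real n ^ 4)))"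
        by (rule mult_left_mono) simp
      also have "\<dots> = 1 / 2" using n by (simp add: field_simps power_numeral_reduce)
      finally show ?thesis by (simp add: power2_eq_square)
    qed
    show "\<exists>T. finite T \<and> real (card T) \<le> C * (16 * real n ^ 2) ^ \<nu> \<and>
        (\<forall>u\<in>F. \<exists>v\<in>T. \<forall>p\<in>{1..n} \<times> {..<n}. \<bar>u (z p) - v (z p)\<bar> \<le> 1 / (4 * real n) / 4)" for z
    proof -
      \<comment> \<open>The array has n^2 points, so the radius 1/(16 n^2) gives accuracy 1/(16 n) =
        \<theta>/4 at each of them.\<close>
      have "1 \<le> real n ^ 2" using n by (intro one_le_power) simp
      then have "1 \<le> 16 * real n ^ 2" by linarith
      then have "\<exists>T. finite T \<and> real (card T) \<le> C * (1 / (1 / (16 * real n ^ 2))) ^ \<nu> \<and>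
        (\<forall>u\<in>F. \<exists>v\<in>T. \<forall>p\<in>{1..n} \<times> {..<n}. \<bar>u (z p) - v (z p)\<bar> \<le>
          1 / (16 * real n ^ 2) * sqrt (real (card ({1..n} \<times> {..<n}))))"
        using n by (intro empirical_net) (auto simp: field_simps lessThan_empty_iff)
      moreover have "1 / (16 * real n ^ 2) * sqrt (real (card ({1..n} \<times> {..<n}))) = 1 / (4 * real n) / 4"
        using n by (simp add: field_simps power2_eq_square)
      ultimately show ?thesis by simp
    qed
    show "2 * (1 / (4 * real n)) * real n \<le> 1" "0 < 1 / (4 * real n)" using n by simp_all
    show "u \<in> F \<and> v \<in> F" if "(u, v) \<in> W" for u v using W(2)[OF that] by simp
  qed (fact prob_space_P W(1) Fm F_bounded n)+
  also have "\<dots> = 2 * C\<^sup>2 * 16 ^ (2 * \<nu>) / (real n)\<^sup>2"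
  proof -
    have "(C * (16 * real n ^ 2) ^ \<nu>)\<^sup>2 = C\<^sup>2 * 16 ^ (2 * \<nu>) * real n ^ (4 * \<nu>)"
      by (simp add: power_mult_distrib mult.commute[of \<nu>] flip: power_mult)
    then show ?thesis using n by (simp only: power_add) (simp add: field_simps)
  qed
  finally show "prob ?E \<le> 2 * C\<^sup>2 * 16 ^ (2 * \<nu>) / (real n)\<^sup>2" .
qed

text \<open>The closeness condition is deterministic and all pairs of \<open>F\<close> are covered
  at once, so one exceptional set serves every subclass of \<open>F\<close> and every choice of
  net.\<close>

definition agrees :: "nat \<Rightarrow> 'w \<Rightarrow> bool" where
  "agrees n \<omega> \<longleftrightarrow> (\<forall>u\<in>F. \<forall>v\<in>F. (LINT z|P. (u z - v z)\<^sup>2) < 1 / (32 * real n ^ 4) \<longrightarrow>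
     (\<Sum>i=1..n. \<bar>u (Z i \<omega>) - v (Z i \<omega>)\<bar>) \<le> near_bound)"

text \<open>Closeness is a strict inequality, so by dominated convergence it passes to approximating
  pairs from the countable subclass; the bound on the sum is non-strict, so it survives the limit on
  the way back.\<close>

lemma near_agreement:
  assumes n: "1 \<le> n"
  shows "\<exists>E\<in>sets M. prob E \<le> 2 * C\<^sup>2 * 16 ^ (2 * \<nu>) / (real n)\<^sup>2 \<and> (\<forall>\<omega>\<in>space M - E. agrees n \<omega>)"
proof -
  obtain F0 where F0: "F0 \<subseteq> F" "countable F0"
    "\<And>u. u \<in> F \<Longrightarrow> \<exists>U :: nat \<Rightarrow> 'z \<Rightarrow> real. range U \<subseteq> F0 \<and> (\<forall>x. (\<lambda>m. U m x) \<longlonglongrightarrow> u x)"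
  proof -
    from pointwise_measurable[unfolded pointwise_measurable_class_def] obtain F0 where "F0 \<subseteq> F" "countable F0"
      and ex: "\<forall>u\<in>F. \<exists>U :: nat \<Rightarrow> 'z \<Rightarrow> real. range U \<subseteq> F0 \<and> (\<forall>x\<in>space borel. (\<lambda>m. U m x) \<longlonglongrightarrow> u x)"
      by (elim exE conjE) (rule that)
    then show ?thesis by (intro that[of F0]) simp_all
  qed
  define W where "W = {(u, v) \<in> F0 \<times> F0. (LINT z|P. (u z - v z)\<^sup>2) < 1 / (32 * real n ^ 4)}"
  define E where "E = {\<omega>\<in>space M. \<exists>(u, v)\<in>W. near_bound < (\<Sum>i=1..n. \<bar>u (Z i \<omega>) - v (Z i \<omega>)\<bar>)}"
  have "W \<subseteq> F0 \<times> F0" unfolding W_def by (rule subsetI) (simp add: split_beta mem_Times_iff)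
  then have W: "countable W" by (rule countable_subset[OF _ countable_SIGMA[OF F0(2) F0(2)]])
  have WF: "\<And>u v. (u, v) \<in> W \<Longrightarrow> u \<in> F \<and> v \<in> F \<and> (LINT z|P. (u z - v z)\<^sup>2) < 1 / (32 * real n ^ 4)"
    unfolding W_def by (simp add: subsetD[OF F0(1)])
  have E: "E \<in> sets M" "prob E \<le> 2 * C\<^sup>2 * 16 ^ (2 * \<nu>) / (real n)\<^sup>2"
    unfolding E_def using near_agreement_countable[OF n W WF] by (simp_all only:)
  have sum_le: "(\<Sum>i=1..n. \<bar>u (Z i \<omega>) - v (Z i \<omega>)\<bar>) \<le> near_bound"
    if \<omega>: "\<omega> \<in> space M - E" and uv: "u \<in> F" "v \<in> F" and small: "(LINT z|P. (u z - v z)\<^sup>2) < 1 / (32 * real n ^ 4)" for \<omega> u v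
  proof -
    obtain U where U: "range U \<subseteq> F0" "\<And>x. (\<lambda>m. U m x) \<longlonglongrightarrow> u x" using F0(3)[OF uv(1)] by (elim exE conjE) simp
    obtain V where V: "range V \<subseteq> F0" "\<And>x. (\<lambda>m. V m x) \<longlonglongrightarrow> v x" using F0(3)[OF uv(2)] by (elim exE conjE) simp
    have UF: "U m \<in> F" "V m \<in> F" for m using U(1) V(1) F0(1) by auto
    have "(\<lambda>m. LINT z|P. (U m z - V m z)\<^sup>2) \<longlonglongrightarrow> (LINT z|P. (u z - v z)\<^sup>2)"
    proof (rule integral_dominated_convergence[where w="\<lambda>_. (2 * \<kappa>)\<^sup>2"])
      show "AE z in P. (\<lambda>m. (U m z - V m z)\<^sup>2) \<longlonglongrightarrow> (u z - v z)\<^sup>2"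
        by (intro AE_I2 tendsto_intros U V)
      show "AE z in P. norm ((U m z - V m z)\<^sup>2) \<le> (2 * \<kappa>)\<^sup>2" for m
        using power_mono[OF diff_bounded[OF UF] abs_ge_zero, of m _ m 2] by simp
      show "(\<lambda>z. (u z - v z)\<^sup>2) \<in> borel_measurable P"
        by (rule borel_measurable_integrable[OF integrable_diff_square[OF uv]])
      show "(\<lambda>z. (U m z - V m z)\<^sup>2) \<in> borel_measurable P" for m
        by (rule borel_measurable_integrable[OF integrable_diff_square[OF UF]])
    qed simp
    then have "\<forall>\<^sub>F m in sequentially. (LINT z|P. (U m z - V m z)\<^sup>2) < 1 / (32 * real n ^ 4)"
      by (rule order_tendstoD) (rule small)
    then have "\<forall>\<^sub>F m in sequentially. (\<Sum>i=1..n. \<bar>U m (Z i \<omega>) - V m (Z i \<omega>)\<bar>) \<le> near_bound"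
    proof (rule eventually_mono)
      fix m assume "(LINT z|P. (U m z - V m z)\<^sup>2) < 1 / (32 * real n ^ 4)"
      then have "(U m, V m) \<in> W" using U(1) V(1) by (auto simp: W_def)
      then show "(\<Sum>i=1..n. \<bar>U m (Z i \<omega>) - V m (Z i \<omega>)\<bar>) \<le> near_bound"
      proof -
        have "\<forall>x\<in>W. (\<Sum>i=1..n. \<bar>fst x (Z i \<omega>) - snd x (Z i \<omega>)\<bar>) \<le> near_bound"
          using \<omega> unfolding E_def by (simp add: not_less split_beta)
        from bspec[OF this \<open>(U m, V m) \<in> W\<close>] show ?thesis by simp
      qed
    qed
    moreover have "(\<lambda>m. \<Sum>i=1..n. \<bar>U m (Z i \<omega>) - V m (Z i \<omega>)\<bar>) \<longlonglongrightarrow> (\<Sum>i=1..n. \<bar>u (Z i \<omega>) - v (Z i \<omega>)\<bar>)"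
      by (intro tendsto_intros U V)
    ultimately show ?thesis by (intro tendsto_upperbound) auto
  qed
  show ?thesis
    unfolding agrees_def by (intro bexI[OF _ E(1)] conjI ballI impI E(2) sum_le)
qed

lemma AE_eventually_agrees: "AE \<omega> in M. \<forall>\<^sub>F n in sequentially. agrees n \<omega>"
proof -
  define good where "good = (\<lambda>n E. E \<in> sets M \<and> prob E \<le> 2 * C\<^sup>2 * 16 ^ (2 * \<nu>) / (real n)\<^sup>2 \<and>
      (\<forall>\<omega>\<in>space M - E. agrees n \<omega>))"
  have "\<forall>n. \<exists>E. good (Suc n) E"
  proof
    fix n show "\<exists>E. good (Suc n) E"
      using near_agreement[of "Suc n"] unfolding good_def Bex_def by simp
  qed
  then obtain E where E: "\<And>n. good (Suc n) (E n)" by (auto simp: choice_iff)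
  have "AE \<omega> in M. \<forall>\<^sub>F n in sequentially. \<omega> \<in> space M - E n"
  proof (rule borel_cantelli_AE1)
    show "summable (\<lambda>n. measure M (E n))"
    proof (rule summable_comparison_test')
      show "summable (\<lambda>n. 2 * C\<^sup>2 * 16 ^ (2 * \<nu>) * (1 / real (Suc n) ^ 2))"
        using inverse_power_summable[of 2, where 'a=real]
        by (intro summable_mult, subst summable_Suc_iff[of "\<lambda>n. 1 / real n ^ 2"])
          (simp add: inverse_eq_divide power_one_over)
      show "norm (measure M (E n)) \<le> 2 * C\<^sup>2 * 16 ^ (2 * \<nu>) * (1 / real (Suc n) ^ 2)" for n
        using E[of n] by (simp add: good_def)
    qed
    show "E n \<in> sets M" for n using E[of n] by (simp add: good_def)
    show "emeasure M (E n) < \<infinity>" for n by (simp add: emeasure_eq_measure)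
  qed
  then show ?thesis
  proof (rule AE_mp, intro AE_I2 impI)
    fix \<omega> assume "\<forall>\<^sub>F n in sequentially. \<omega> \<in> space M - E n"
    then have "\<forall>\<^sub>F n in sequentially. agrees (Suc n) \<omega>"
      by (rule eventually_mono) (use E in \<open>auto simp: good_def\<close>)
    then show "\<forall>\<^sub>F n in sequentially. agrees n \<omega>"
      by (subst (asm) eventually_sequentially_Suc)
  qed
qed

text \<open>Agreement at the largest time \<open>N\<close> serves every n <= N because sums of
  absolute differences increase with n. Centring costs at most 1: the difference of the means is at
  most the L_2(P) distance, which is below 1/N.\<close>

lemma dev_near:
  assumes n: "1 \<le> N" "n \<le> N" and \<omega>: "agrees N \<omega>" and uv: "u \<in> F" "v \<in> F"
    and small: "(LINT z|P. (u z - v z)\<^sup>2) < 1 / (32 * real N ^ 4)"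
  shows "\<bar>dev n u \<omega> - dev n v \<omega>\<bar> \<le> near_bound + 1"
proof -
  note iu = integrable_F[OF uv(1)] and iv = integrable_F[OF uv(2)]
  have sq: "\<bar>LINT z|P. u z - v z\<bar> \<le> 1 / real N"
  proof -
    have "(LINT z|P. u z - v z)\<^sup>2 \<le> (LINT z|P. (u z - v z)\<^sup>2)"
    proof -
      have "0 \<le> P.variance (\<lambda>z. u z - v z)" by simp
      also have "\<dots> = (LINT z|P. (u z - v z)\<^sup>2) - (LINT z|P. u z - v z)\<^sup>2"
        using iu iv integrable_diff_square[OF uv] by (intro P.variance_eq) auto
      finally show ?thesis by simp
    qed
    also have "\<dots> \<le> (1 / real N)\<^sup>2"
    proof -
      have "(LINT z|P. (u z - v z)\<^sup>2) \<le> 1 / (32 * real N ^ 4)" using small by simp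
      also have "\<dots> \<le> 1 / real N ^ 2"
      proof (rule divide_left_mono)
        have "real N ^ 2 \<le> real N ^ 4" using n by (intro power_increasing) auto
        then show "real N ^ 2 \<le> 32 * real N ^ 4" using zero_le_power[of "real N" 4] by linarith
      qed (use n in auto)
      finally show ?thesis by (simp add: power_divide)
    qed
    finally show ?thesis using abs_le_square_iff[of "LINT z|P. u z - v z" "1 / real N"] by simp
  qed
  have "\<bar>dev n u \<omega> - dev n v \<omega>\<bar> = \<bar>(\<Sum>i=1..n. u (Z i \<omega>) - v (Z i \<omega>)) - real n * (LINT z|P. u z - v z)\<bar>"
    using iu iv by (simp add: dev_def sum_subtractf algebra_simps)
  also have "\<dots> \<le> \<bar>\<Sum>i=1..n. u (Z i \<omega>) - v (Z i \<omega>)\<bar> + real n * \<bar>LINT z|P. u z - v z\<bar>"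
    using abs_triangle_ineq4[of "\<Sum>i=1..n. u (Z i \<omega>) - v (Z i \<omega>)" "real n * (LINT z|P. u z - v z)"]
    by (simp only: abs_mult abs_of_nat)
  also have "\<dots> \<le> (\<Sum>i=1..n. \<bar>u (Z i \<omega>) - v (Z i \<omega>)\<bar>) + real N * (1 / real N)"
    using sq n by (intro add_mono sum_abs mult_mono) auto
  also have "\<dots> \<le> (\<Sum>i=1..N. \<bar>u (Z i \<omega>) - v (Z i \<omega>)\<bar>) + 1"
    using n by (intro add_mono sum_mono2) auto
  also have "\<dots> \<le> near_bound + 1"
    using \<omega> uv small by (simp add: agrees_def)
  finally show ?thesis .
qed

lemma dev_bound:
  assumes "u \<in> F"
  shows "\<bar>dev n u \<omega>\<bar> \<le> 2 * \<kappa> * real n"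
proof -
  have "\<bar>LINT z|P. u z\<bar> \<le> (LINT z|P. \<bar>u z\<bar>)" by (rule integral_abs_bound)
  also have "\<dots> \<le> (LINT z|P. \<kappa>)"
    using integrable_F[OF assms] F_bounded[OF assms] by (intro integral_mono) auto
  finally have m: "\<bar>LINT z|P. u z\<bar> \<le> \<kappa>" by simp
  have "\<bar>dev n u \<omega>\<bar> \<le> (\<Sum>i=1..n. \<bar>u (Z i \<omega>) - (LINT z|P. u z)\<bar>)"
    unfolding dev_def by (rule sum_abs)
  also have "\<dots> \<le> (\<Sum>i=1..n. 2 * \<kappa>)"
  proof (rule sum_mono)
    fix i show "\<bar>u (Z i \<omega>) - (LINT z|P. u z)\<bar> \<le> 2 * \<kappa>"
      using m F_bounded[OF assms, of "Z i \<omega>"] by linarith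
  qed
  finally show ?thesis by (simp add: mult.commute)
qed

end

section \<open>Uniform deviations over a dyadic block\<close>

lemma (in prob_space) prob_UN_le_card:
  assumes "finite I" "\<And>i. i \<in> I \<Longrightarrow> A i \<in> events" "\<And>i. i \<in> I \<Longrightarrow> prob (A i) \<le> p"
    "real (card I) \<le> m" "0 \<le> p"
  shows "prob (\<Union>i\<in>I. A i) \<le> m * p"
proof -
  have "prob (\<Union>i\<in>I. A i) \<le> (\<Sum>i\<in>I. prob (A i))"
    using assms by (intro finite_measure_subadditive_finite) auto
  also have "\<dots> \<le> (\<Sum>i\<in>I. p)" using assms(3) by (rule sum_mono)
  also have "\<dots> \<le> m * p" using assms(4,5) by (simp add: mult_right_mono)
  finally show ?thesis .
qed

context entropy_class
begin

lemma integral_diff_square_le: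
  assumes "u \<in> F" "v \<in> F" "w \<in> F"
  shows "(LINT z|P. (v z - w z)\<^sup>2) \<le> 2 * (LINT z|P. (u z - v z)\<^sup>2) + 2 * (LINT z|P. (u z - w z)\<^sup>2)"
proof -
  have i: "integrable P (\<lambda>z. (u z - v z)\<^sup>2)" "integrable P (\<lambda>z. (u z - w z)\<^sup>2)" "integrable P (\<lambda>z. (v z - w z)\<^sup>2)"
    using assms by (simp_all add: integrable_diff_square)
  have ineq: "(b - c)\<^sup>2 \<le> 2 * (a - b)\<^sup>2 + 2 * (a - c)\<^sup>2" for a b c :: real
  proof -
    have "2 * (a - b)\<^sup>2 + 2 * (a - c)\<^sup>2 - (b - c)\<^sup>2 = (2 * a - b - c)\<^sup>2"
      by (simp add: power2_eq_square algebra_simps)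
    then show ?thesis using zero_le_power2[of "2 * a - b - c"] by linarith
  qed
  have "(LINT z|P. (v z - w z)\<^sup>2) \<le> (LINT z|P. 2 * (u z - v z)\<^sup>2 + 2 * (u z - w z)\<^sup>2)"
    using i by (intro integral_mono ineq) auto
  then show ?thesis using i by simp
qed

lemma integral_square_le:
  assumes "u \<in> F" "v \<in> F"
  shows "(LINT z|P. (v z)\<^sup>2) \<le> 2 * (LINT z|P. (u z)\<^sup>2) + 2 * (LINT z|P. (u z - v z)\<^sup>2)"
proof -
  have i: "integrable P (\<lambda>z. (u z - v z)\<^sup>2)" "integrable P (\<lambda>z. (u z)\<^sup>2)" "integrable P (\<lambda>z. (v z)\<^sup>2)"
    using assms by (simp_all add: integrable_diff_square integrable_square)
  have ineq: "b\<^sup>2 \<le> 2 * a\<^sup>2 + 2 * (a - b)\<^sup>2" for a b :: real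
  proof -
    have "2 * a\<^sup>2 + 2 * (a - b)\<^sup>2 - b\<^sup>2 = (2 * a - b)\<^sup>2"
      by (simp add: power2_eq_square algebra_simps)
    then show ?thesis using zero_le_power2[of "2 * a - b"] by linarith
  qed
  have "(LINT z|P. (v z)\<^sup>2) \<le> (LINT z|P. 2 * (u z)\<^sup>2 + 2 * (u z - v z)\<^sup>2)"
    using i by (intro integral_mono ineq) auto
  then show ?thesis using i by simp
qed

lemma net_P:
  assumes "0 < \<delta>" "\<delta> \<le> 1"
  obtains T where "T \<subseteq> F" "finite T" "real (card T) \<le> C * (1 / \<delta>) ^ \<nu>"
    "\<And>u. u \<in> F \<Longrightarrow> \<exists>v\<in>T. (LINT z|P. (u z - v z)\<^sup>2) \<le> \<delta>\<^sup>2"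
proof -
  from entropy[OF prob_space_P sets_P assms] obtain T where T: "T \<subseteq> F" "finite T"
    "real (card T) \<le> C * (1 / \<delta>) ^ \<nu>" "\<forall>u\<in>F. \<exists>v\<in>T. (LINT z|P. (u z - v z)\<^sup>2) \<le> \<delta>\<^sup>2"
    by (elim exE conjE)
  show ?thesis by (rule that[OF T(1-3) bspec[OF T(4)]])
qed

text \<open>
  Two nets in \<open>L\<^sub>2(P)\<close> suffice, without any chaining: at radius \<open>\<surd>(h l / ln N)\<close> the
  entropy is still of order \<open>l\<close>, because \<open>l\<close> dominates both \<open>ln (1 / h)\<close> and \<open>ln (ln N)\<close>;
  the links from there to a net of radius \<open>1 / (6 N\<^sup>2)\<close> have so small a variance that its
  entropy of order \<open>ln N\<close> is affordable.
\<close>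

lemma deviation_block:
  fixes c Cv :: real
  assumes c: "0 < c" and Cv: "0 \<le> Cv"
  obtains A K where "0 < A" "0 \<le> K"
    "\<And>N h l. 1 \<le> N \<Longrightarrow> 0 < h \<Longrightarrow> h \<le> 1 \<Longrightarrow> 1 \<le> l \<Longrightarrow> l \<le> ln (real N) \<Longrightarrow> ln (real N) \<le> exp l \<Longrightarrow>
       1 / h \<le> exp l \<Longrightarrow> c * ln (real N) \<le> real N * h \<Longrightarrow> c * (ln (real N))\<^sup>2 \<le> real N * h * l \<Longrightarrow>
       \<exists>E\<in>events. prob E \<le> K * exp (- 4 * l) \<and>
         (\<forall>\<omega>\<in>space M - E. agrees N \<omega> \<longrightarrow> (\<forall>n\<le>N. \<forall>u\<in>F. (LINT z|P. (u z)\<^sup>2) \<le> Cv * h \<longrightarrow>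
            \<bar>dev n u \<omega>\<bar> \<le> A * sqrt (real N * h * l)))"
proof -
  define \<mu> where "\<mu> = sqrt c / (4 * \<kappa>)"
  define V1 where "V1 = 2 * Cv + 2"
  define V2 where "V2 = 2 + 2 / c"
  define A1 where "A1 = (real \<nu> + 4) / \<mu> + \<mu> * V1"
  define A2 where "A2 = (3 * real \<nu> + 4) / \<mu> + \<mu> * V2"
  define A where "A = A1 + A2 + (near_bound + 1) / sqrt c"
  define K where "K = 2 * C + 2 * C\<^sup>2 * 6 ^ \<nu>"
  have \<kappa>: "0 < \<kappa>" using \<kappa>_ge_1 by simp
  have \<mu>: "0 < \<mu>" using c \<kappa> by (simp add: \<mu>_def)
  have V: "0 < V1" "0 < V2" using c Cv by (simp_all add: V1_def V2_def add_pos_pos)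
  have A: "0 < A1" "0 < A2" "0 < A"
    using \<mu> V c near_bound_pos by (simp_all add: A1_def A2_def A_def add_pos_pos)
  have K: "0 \<le> K" using C_ge_1 by (simp add: K_def)
  show ?thesis
  proof (rule that[OF A(3) K])
    fix N :: nat and h l :: real
    assume N: "1 \<le> N" and h: "0 < h" "h \<le> 1" and l: "1 \<le> l" "l \<le> ln (real N)"
      and lN: "ln (real N) \<le> exp l" and lh: "1 / h \<le> exp l"
      and Nh: "c * ln (real N) \<le> real N * h" and Nhl: "c * (ln (real N))\<^sup>2 \<le> real N * h * l"
    define \<Lambda> where "\<Lambda> = ln (real N)"
    define s where "s = sqrt (real N * h * l)"
    have \<Lambda>: "1 \<le> \<Lambda>" "l \<le> \<Lambda>" using l by (simp_all add: \<Lambda>_def)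
    have s2: "s\<^sup>2 = real N * h * l" using N h l by (simp add: s_def)
    have s\<Lambda>: "sqrt c * \<Lambda> \<le> s"
    proof -
      have "sqrt (c * \<Lambda>\<^sup>2) \<le> s" unfolding s_def \<Lambda>_def using Nhl by (rule real_sqrt_le_mono)
      then show ?thesis using \<Lambda> by (simp add: real_sqrt_mult)
    qed
    have "0 < sqrt c * \<Lambda>" using c \<Lambda> by (intro mult_pos_pos) auto
    then have s: "0 < s" using s\<Lambda> by linarith
    have lam: "\<mu> * \<Lambda> / s \<le> 1 / (4 * \<kappa>)"
    proof -
      have "\<mu> * \<Lambda> = sqrt c * \<Lambda> / (4 * \<kappa>)" by (simp add: \<mu>_def)
      also have "\<dots> \<le> s / (4 * \<kappa>)" using s\<Lambda> \<kappa> by (intro divide_right_mono) auto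
      finally show ?thesis using s by (simp add: field_simps)
    qed
    have lam1: "\<mu> * l / s \<le> 1 / (4 * \<kappa>)"
    proof -
      have "\<mu> * l / s \<le> \<mu> * \<Lambda> / s" using \<mu> s \<Lambda> by (intro divide_right_mono mult_left_mono) auto
      then show ?thesis using lam by linarith
    qed
    define \<delta> where "\<delta> = sqrt (h * l / \<Lambda>)"
    have \<delta>0: "0 < \<delta>" using h l \<Lambda> by (simp add: \<delta>_def)
    have \<delta>2: "\<delta>\<^sup>2 = h * l / \<Lambda>" using h l \<Lambda> by (simp add: \<delta>_def)
    have \<delta>h: "\<delta>\<^sup>2 \<le> h"
    proof -
      have "h * l \<le> h * \<Lambda>" using h \<Lambda> by (intro mult_left_mono) auto
      then show ?thesis using \<Lambda> by (simp add: \<delta>2 divide_le_eq)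
    qed
    have \<delta>1: "\<delta> \<le> 1"
    proof -
      have "\<delta>\<^sup>2 \<le> 1\<^sup>2" using \<delta>h h by simp
      then show ?thesis by (rule power2_le_imp_le) simp
    qed
    have inv\<delta>: "1 / \<delta> \<le> exp l"
    proof (rule power2_le_imp_le)
      have "(1 / \<delta>)\<^sup>2 = \<Lambda> / l * (1 / h)" by (simp add: power_divide \<delta>2)
      also have "\<dots> \<le> exp l * exp l"
      proof (intro mult_mono)
        have "\<Lambda> / l \<le> \<Lambda> / 1" using \<Lambda> l by (intro divide_left_mono) auto
        then show "\<Lambda> / l \<le> exp l" using lN by (simp add: \<Lambda>_def)
      qed (use lh h in auto)
      finally show "(1 / \<delta>)\<^sup>2 \<le> (exp l)\<^sup>2" by (simp add: power2_eq_square)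
    qed simp
    obtain T1 where T1: "T1 \<subseteq> F" "finite T1" "real (card T1) \<le> C * (1 / \<delta>) ^ \<nu>"
      "\<And>u. u \<in> F \<Longrightarrow> \<exists>v\<in>T1. (LINT z|P. (u z - v z)\<^sup>2) \<le> \<delta>\<^sup>2"
      by (rule net_P[OF \<delta>0 \<delta>1], rule that)
    have N4: "1 \<le> real N ^ 4" "1 \<le> real N ^ 2" using N by (simp_all add: one_le_power)
    \<comment> \<open>Its square 1/(36 N^4) lies below the threshold 1/(32 N^4) of
      \<open>agrees\<close>.\<close>
    define \<eta> where "\<eta> = 1 / (6 * real N ^ 2)"
    have "1 \<le> 6 * real N ^ 2" using N4(2) by linarith
    then have \<eta>: "0 < \<eta>" "\<eta> \<le> 1" unfolding \<eta>_def using N by (simp, metis divide_le_eq_1 less_le_trans zero_less_one)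
    have \<eta>2: "\<eta>\<^sup>2 = 1 / (36 * real N ^ 4)" by (simp add: \<eta>_def power_divide power_mult_distrib flip: power_mult)
    have \<eta>2': "\<eta>\<^sup>2 < 1 / (32 * real N ^ 4)" unfolding \<eta>2 using N by (intro divide_strict_left_mono) auto
    obtain T2 where T2: "T2 \<subseteq> F" "finite T2" "real (card T2) \<le> C * (1 / \<eta>) ^ \<nu>"
      "\<And>u. u \<in> F \<Longrightarrow> \<exists>v\<in>T2. (LINT z|P. (u z - v z)\<^sup>2) \<le> \<eta>\<^sup>2"
      by (rule net_P[OF \<eta>], rule that)
    have c1: "real (card T1) \<le> C * exp (real \<nu> * l)"
    proof -
      have "(1 / \<delta>) ^ \<nu> \<le> exp l ^ \<nu>" using inv\<delta> \<delta>0 by (intro power_mono) auto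
      then have "C * (1 / \<delta>) ^ \<nu> \<le> C * exp l ^ \<nu>" using C_ge_1 by (intro mult_left_mono) auto
      then show ?thesis using T1(3) by (simp add: exp_of_nat_mult)
    qed
    have c2: "real (card T2) \<le> C * 6 ^ \<nu> * exp (2 * real \<nu> * \<Lambda>)"
    proof -
      have "(1 / \<eta>) ^ \<nu> = 6 ^ \<nu> * exp (2 * real \<nu> * \<Lambda>)"
      proof -
        have "exp (2 * real \<nu> * \<Lambda>) = exp \<Lambda> ^ (2 * \<nu>)" by (simp flip: exp_of_nat_mult)
        also have "\<dots> = (real N ^ 2) ^ \<nu>" using N by (simp add: \<Lambda>_def power_mult)
        finally show ?thesis by (simp add: \<eta>_def power_mult_distrib)
      qed
      then show ?thesis using T2(3) by simp
    qed
    have Fm: "v \<in> borel_measurable borel" "\<And>z. \<bar>v z\<bar> \<le> \<kappa>" if "v \<in> F" for v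
      using F_measurable[OF that] F_bounded[OF that] by auto

    \<comment> \<open>A coarse net point near a function of second moment at most Cv h has second
      moment at most 2 Cv h + 2 \<delta>^2 <= V1 h, so the union is restricted to such
      points.\<close>
    define E1 where "E1 = (\<Union>v\<in>{v\<in>T1. (LINT z|P. (v z)\<^sup>2) \<le> V1 * h}. {\<omega>\<in>space M. \<exists>n\<le>N. A1 * s \<le> \<bar>dev n v \<omega>\<bar>})"
    have ev1: "{\<omega>\<in>space M. \<exists>n\<le>N. A1 * s \<le> \<bar>dev n v \<omega>\<bar>} \<in> events" if "v \<in> F" for v
    proof -
      note [measurable] = Fm(1)[OF that]
      show ?thesis by measurable
    qed
    have pr1: "prob {\<omega>\<in>space M. \<exists>n\<le>N. A1 * s \<le> \<bar>dev n v \<omega>\<bar>} \<le> 2 * exp (- (real \<nu> + 4) * l)"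
      if v: "v \<in> F" "(LINT z|P. (v z)\<^sup>2) \<le> V1 * h" for v
    proof -
      have "prob {\<omega>\<in>space M. \<exists>n\<le>N. A1 * s \<le> \<bar>dev n v \<omega>\<bar>} \<le>
          2 * exp (- (\<mu> * l / s) * (A1 * s) + real N * (\<mu> * l / s)\<^sup>2 * (V1 * h))"
      proof (rule maximal_bernstein[OF Fm[OF v(1)] v(2)])
        show "0 < \<mu> * l / s" using \<mu> l s by simp
        have "2 * \<kappa> * (\<mu> * l / s) \<le> 2 * \<kappa> * (1 / (4 * \<kappa>))" using lam1 \<kappa> by (intro mult_left_mono) auto
        also have "\<dots> \<le> 1" using \<kappa> by simp
        finally show "2 * \<kappa> * (\<mu> * l / s) \<le> 1" .
      qed
      also have "- (\<mu> * l / s) * (A1 * s) + real N * (\<mu> * l / s)\<^sup>2 * (V1 * h) = - (real \<nu> + 4) * l"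
      proof -
        have "real N * (\<mu> * l / s)\<^sup>2 * (V1 * h) = \<mu>\<^sup>2 * V1 * l"
          using N h l by (simp add: power_divide power_mult_distrib s2) (simp add: field_simps power2_eq_square)
        moreover have "- (\<mu> * l / s) * (A1 * s) = - (\<mu> * A1 * l)" using s by simp
        moreover have "\<mu> * A1 = real \<nu> + 4 + \<mu>\<^sup>2 * V1" using \<mu> by (simp add: A1_def field_simps power2_eq_square)
        ultimately show ?thesis by (simp only:) (simp add: algebra_simps)
      qed
      finally show ?thesis .
    qed
    let ?I1 = "{v\<in>T1. (LINT z|P. (v z)\<^sup>2) \<le> V1 * h}"
    have I1: "v \<in> F" "(LINT z|P. (v z)\<^sup>2) \<le> V1 * h" if "v \<in> ?I1" for v
      using that T1(1) by auto
    have finI1: "finite ?I1" using T1(2) by simp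
    have E1: "E1 \<in> events" unfolding E1_def
      by (rule sets.finite_UN[OF finI1]) (rule ev1[OF I1(1)])
    have p1: "prob E1 \<le> C * exp (real \<nu> * l) * (2 * exp (- (real \<nu> + 4) * l))"
      unfolding E1_def
    proof (rule prob_UN_le_card[OF finI1 ev1[OF I1(1)] pr1[OF I1]])
      have "real (card ?I1) \<le> real (card T1)"
        using T1(2) by (intro of_nat_mono card_mono) auto
      then show "real (card ?I1) \<le> C * exp (real \<nu> * l)" using c1 by simp
    qed simp_all

    \<comment> \<open>Up to constants there are exp(\<nu> l + 2\<nu> ln N) links. As l <= ln N, the
      exponent -(3\<nu> + 4) ln N pays for all of them and leaves exp(-4 ln N).\<close>
    define E2 where "E2 = (\<Union>w\<in>{w\<in>T1 \<times> T2. (LINT z|P. (fst w z - snd w z)\<^sup>2) \<le> V2 * (h * l / \<Lambda>)}.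
      {\<omega>\<in>space M. \<exists>n\<le>N. A2 * s \<le> \<bar>dev n (\<lambda>z. fst w z - snd w z) \<omega>\<bar>})"
    have ev2: "{\<omega>\<in>space M. \<exists>n\<le>N. A2 * s \<le> \<bar>dev n (\<lambda>z. v z - w z) \<omega>\<bar>} \<in> events" if "v \<in> F" "w \<in> F" for v w
    proof -
      note [measurable] = Fm(1)[OF that(1)] Fm(1)[OF that(2)]
      show ?thesis by measurable
    qed
    have pr2: "prob {\<omega>\<in>space M. \<exists>n\<le>N. A2 * s \<le> \<bar>dev n (\<lambda>z. v z - w z) \<omega>\<bar>} \<le> 2 * exp (- (3 * real \<nu> + 4) * \<Lambda>)"
      if v: "v \<in> F" "w \<in> F" "(LINT z|P. (v z - w z)\<^sup>2) \<le> V2 * (h * l / \<Lambda>)" for v w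
    proof -
      note [measurable] = Fm(1)[OF v(1)] Fm(1)[OF v(2)]
      have "prob {\<omega>\<in>space M. \<exists>n\<le>N. A2 * s \<le> \<bar>dev n (\<lambda>z. v z - w z) \<omega>\<bar>} \<le>
          2 * exp (- (\<mu> * \<Lambda> / s) * (A2 * s) + real N * (\<mu> * \<Lambda> / s)\<^sup>2 * (V2 * (h * l / \<Lambda>)))"
      proof (rule maximal_bernstein[OF _ diff_bounded[OF v(1,2)] v(3)])
        show "(\<lambda>z. v z - w z) \<in> borel_measurable borel" by measurable
        show "0 < \<mu> * \<Lambda> / s" using \<mu> \<Lambda> s by simp
        have "2 * (2 * \<kappa>) * (\<mu> * \<Lambda> / s) \<le> 2 * (2 * \<kappa>) * (1 / (4 * \<kappa>))" using lam \<kappa> by (intro mult_left_mono) auto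
        also have "\<dots> \<le> 1" using \<kappa> by simp
        finally show "2 * (2 * \<kappa>) * (\<mu> * \<Lambda> / s) \<le> 1" .
      qed
      also have "- (\<mu> * \<Lambda> / s) * (A2 * s) + real N * (\<mu> * \<Lambda> / s)\<^sup>2 * (V2 * (h * l / \<Lambda>)) = - (3 * real \<nu> + 4) * \<Lambda>"
      proof -
        have "real N * (\<mu> * \<Lambda> / s)\<^sup>2 * (V2 * (h * l / \<Lambda>)) = \<mu>\<^sup>2 * V2 * \<Lambda>"
          using N h l \<Lambda> by (simp add: power_divide power_mult_distrib s2) (simp add: field_simps power2_eq_square)
        moreover have "- (\<mu> * \<Lambda> / s) * (A2 * s) = - (\<mu> * A2 * \<Lambda>)" using s by simp
        moreover have "\<mu> * A2 = 3 * real \<nu> + 4 + \<mu>\<^sup>2 * V2" using \<mu> by (simp add: A2_def field_simps power2_eq_square)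
        ultimately show ?thesis by (simp only:) (simp add: algebra_simps)
      qed
      finally show ?thesis .
    qed
    let ?I = "{w\<in>T1 \<times> T2. (LINT z|P. (fst w z - snd w z)\<^sup>2) \<le> V2 * (h * l / \<Lambda>)}"
    have I: "fst w \<in> F" "snd w \<in> F" if "w \<in> ?I" for w
      using that T1(1) T2(1) by (auto simp: mem_Times_iff)
    have finI: "finite ?I" using T1(2) T2(2) by simp
    have E2: "E2 \<in> events" unfolding E2_def
      by (rule sets.finite_UN[OF finI]) (rule ev2[OF I])
    have p2: "prob E2 \<le> (C * exp (real \<nu> * l)) * (C * 6 ^ \<nu> * exp (2 * real \<nu> * \<Lambda>)) * (2 * exp (- (3 * real \<nu> + 4) * \<Lambda>))"
      unfolding E2_def
    proof (rule prob_UN_le_card[OF finI ev2[OF I] pr2[OF I]])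
      have "real (card ?I) \<le> real (card (T1 \<times> T2))"
        using T1(2) T2(2) by (intro of_nat_mono card_mono) auto
      also have "\<dots> = real (card T1) * real (card T2)" by (simp add: card_cartesian_product)
      also have "\<dots> \<le> (C * exp (real \<nu> * l)) * (C * 6 ^ \<nu> * exp (2 * real \<nu> * \<Lambda>))"
        using c1 c2 C_ge_1 by (intro mult_mono) auto
      finally show "real (card ?I) \<le> (C * exp (real \<nu> * l)) * (C * 6 ^ \<nu> * exp (2 * real \<nu> * \<Lambda>))" .
    qed simp_all

    have p1': "prob E1 \<le> 2 * C * exp (- 4 * l)"
    proof -
      have "exp (real \<nu> * l) * exp (- (real \<nu> + 4) * l) = exp (- 4 * l)"
        by (simp add: exp_add[symmetric] algebra_simps)
      then show ?thesis using p1 by (simp add: algebra_simps)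
    qed
    have p2': "prob E2 \<le> 2 * C\<^sup>2 * 6 ^ \<nu> * exp (- 4 * l)"
    proof -
      have "exp (real \<nu> * l) * exp (2 * real \<nu> * \<Lambda>) * exp (- (3 * real \<nu> + 4) * \<Lambda>) = exp (real \<nu> * (l - \<Lambda>) - 4 * \<Lambda>)"
        by (simp add: exp_add[symmetric] algebra_simps)
      also have "\<dots> \<le> exp (- 4 * l)"
      proof -
        have "real \<nu> * (l - \<Lambda>) \<le> 0" using \<Lambda> by (intro mult_nonneg_nonpos) auto
        then show ?thesis using \<Lambda> by simp
      qed
      finally have "2 * C\<^sup>2 * 6 ^ \<nu> * (exp (real \<nu> * l) * exp (2 * real \<nu> * \<Lambda>) * exp (- (3 * real \<nu> + 4) * \<Lambda>)) \<le> 2 * C\<^sup>2 * 6 ^ \<nu> * exp (- 4 * l)"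
        by (intro mult_left_mono) auto
      then show ?thesis using p2 by (simp add: power2_eq_square mult.assoc mult.left_commute)
    qed
    show "\<exists>E\<in>events. prob E \<le> K * exp (- 4 * l) \<and>
         (\<forall>\<omega>\<in>space M - E. agrees N \<omega> \<longrightarrow> (\<forall>n\<le>N. \<forall>u\<in>F. (LINT z|P. (u z)\<^sup>2) \<le> Cv * h \<longrightarrow>
            \<bar>dev n u \<omega>\<bar> \<le> A * sqrt (real N * h * l)))"
    proof (intro bexI[of _ "E1 \<union> E2"] conjI ballI impI allI)
      have "prob (E1 \<union> E2) \<le> prob E1 + prob E2" using E1 E2 by (rule measure_Un_le)
      then show "prob (E1 \<union> E2) \<le> K * exp (- 4 * l)"
        using p1' p2' unfolding K_def distrib_right by linarith
      show "E1 \<union> E2 \<in> events" using E1 E2 by (rule sets.Un)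
      fix \<omega> n u
      assume \<omega>: "\<omega> \<in> space M - (E1 \<union> E2)" and ag: "agrees N \<omega>" and n: "n \<le> N"
        and u: "u \<in> F" and Pu: "(LINT z|P. (u z)\<^sup>2) \<le> Cv * h"
      \<comment> \<open>Telescope: the deviation of \<open>u\<close> is that of \<open>v\<close>,
        plus the link from \<open>v\<close> to \<open>w\<close>, plus the difference of
        \<open>u\<close> and \<open>w\<close>. These are controlled by \<open>E1\<close>,
        \<open>E2\<close> and \<open>agrees\<close> in turn.\<close>
      from T1(4)[OF u] obtain v where v: "v \<in> T1" "(LINT z|P. (u z - v z)\<^sup>2) \<le> \<delta>\<^sup>2" by (rule bexE)
      from T2(4)[OF u] obtain w where w: "w \<in> T2" "(LINT z|P. (u z - w z)\<^sup>2) \<le> \<eta>\<^sup>2" by (rule bexE)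
      have vF: "v \<in> F" and wF: "w \<in> F" using v(1) w(1) T1(1) T2(1) by auto
      have "(LINT z|P. (v z)\<^sup>2) \<le> V1 * h"
        using integral_square_le[OF u vF] Pu v(2) \<delta>h unfolding V1_def distrib_right by linarith
      then have d1: "\<bar>dev n v \<omega>\<bar> < A1 * s"
      proof -
        assume *: "(LINT z|P. (v z)\<^sup>2) \<le> V1 * h"
        have "\<omega> \<notin> {\<omega>\<in>space M. \<exists>n\<le>N. A1 * s \<le> \<bar>dev n v \<omega>\<bar>}"
          using \<omega> v(1) * unfolding E1_def by simp
        then have "\<not> A1 * s \<le> \<bar>dev n v \<omega>\<bar>" using \<omega> n by blast
        then show ?thesis by simp
      qed
      have "(LINT z|P. (v z - w z)\<^sup>2) \<le> V2 * (h * l / \<Lambda>)"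
      proof -
        \<comment> \<open>The fine radius is dominated by the coarse one: \<eta>^2 <= 1/N <= h l /
          (c ln N), because c ln N <= c (ln N)^2 <= N h l.\<close>
        have "2 * \<eta>\<^sup>2 \<le> 2 / c * (h * l / \<Lambda>)"
        proof -
          have "c * \<Lambda> \<le> c * \<Lambda>\<^sup>2" using c \<Lambda> by (intro mult_left_mono) (auto simp: power2_eq_square)
          also have "\<dots> \<le> real N * h * l" using Nhl by (simp add: \<Lambda>_def)
          finally have "1 / real N \<le> (1 / c) * (h * l / \<Lambda>)"
            using c \<Lambda> N by (simp add: field_simps)
          moreover have "\<eta>\<^sup>2 \<le> 1 / real N"
          proof -
            have "real N ^ 1 \<le> real N ^ 4" using N by (intro power_increasing) auto
            then have "real N \<le> 36 * real N ^ 4" using N4(1) unfolding power_one_right by linarith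
            then show ?thesis unfolding \<eta>2 using N by (intro divide_left_mono) auto
          qed
          ultimately have "2 * \<eta>\<^sup>2 \<le> 2 * ((1 / c) * (h * l / \<Lambda>))" by linarith
          then show ?thesis by simp
        qed
        then have "2 * \<delta>\<^sup>2 + 2 * \<eta>\<^sup>2 \<le> V2 * (h * l / \<Lambda>)"
          unfolding V2_def \<delta>2 distrib_right by simp
        then show ?thesis using integral_diff_square_le[OF u vF wF] v(2) w(2) by linarith
      qed
      then have d2: "\<bar>dev n v \<omega> - dev n w \<omega>\<bar> < A2 * s"
      proof -
        assume *: "(LINT z|P. (v z - w z)\<^sup>2) \<le> V2 * (h * l / \<Lambda>)"
        have "\<omega> \<notin> {\<omega>\<in>space M. \<exists>n\<le>N. A2 * s \<le> \<bar>dev n (\<lambda>z. fst (v, w) z - snd (v, w) z) \<omega>\<bar>}"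
          using \<omega> v(1) w(1) * unfolding E2_def by fastforce
        then have "\<not> A2 * s \<le> \<bar>dev n (\<lambda>z. fst (v, w) z - snd (v, w) z) \<omega>\<bar>" using \<omega> n by blast
        then show ?thesis by (simp add: dev_diff[OF integrable_F[OF vF] integrable_F[OF wF]])
      qed
      have "(LINT z|P. (u z - w z)\<^sup>2) < 1 / (32 * real N ^ 4)" using w(2) \<eta>2' by linarith
      then have "\<bar>dev n u \<omega> - dev n w \<omega>\<bar> \<le> near_bound + 1"
        by (rule dev_near[OF N n ag u wF])
      also have "\<dots> \<le> (near_bound + 1) / sqrt c * s"
      proof -
        have "sqrt c * 1 \<le> sqrt c * \<Lambda>" using \<Lambda> c by (intro mult_left_mono) auto
        then have "sqrt c \<le> s" using s\<Lambda> by simp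
        then have "1 \<le> s / sqrt c" using c by simp
        then have "(near_bound + 1) * 1 \<le> (near_bound + 1) * (s / sqrt c)"
          using near_bound_pos by (intro mult_left_mono) auto
        then show ?thesis by simp
      qed
      finally have d3: "\<bar>dev n u \<omega> - dev n w \<omega>\<bar> \<le> (near_bound + 1) / sqrt c * s" .
      have "\<bar>dev n u \<omega>\<bar> \<le> A1 * s + A2 * s + (near_bound + 1) / sqrt c * s"
        using d1 d2 d3 by linarith
      then show "\<bar>dev n u \<omega>\<bar> \<le> A * sqrt (real N * h * l)"
        by (simp add: A_def s_def[symmetric] distrib_right)
    qed
  qed
qed

end

section \<open>From one block to all dyadic sample sizes and bandwidths\<close>

lemma square_le_exp_half: "0 \<le> x \<Longrightarrow> x\<^sup>2 \<le> 16 * exp (x / 2)" for x :: real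
proof -
  assume x: "0 \<le> x"
  have "x / 4 \<le> exp (x / 4)" using exp_ge_add_one_self[of "x / 4"] by linarith
  then have "(x / 4)\<^sup>2 \<le> (exp (x / 4))\<^sup>2" using x by (intro power_mono) auto
  also have "(exp (x / 4))\<^sup>2 = exp (x / 2)" by (simp add: exp_double[symmetric])
  finally show ?thesis by (simp add: power_divide)
qed

lemma ln_le_mult_ln2: "1 \<le> k \<Longrightarrow> ln (real k) \<le> real k * ln 2"
proof -
  assume k: "1 \<le> k"
  have "real k \<le> 2 ^ k" using of_nat_mono[OF less_imp_le[OF less_exp[of k]], where 'a=real] by simp
  then have "ln (real k) \<le> ln (2 ^ k)" using k by (intro ln_mono) auto
  then show ?thesis by (simp add: ln_realpow)
qed

text \<open>Here \<open>ln k\<close> stands for the iterated logarithm of 2^k, from which it differs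
  by the constant ln (ln 2) only.\<close>

definition dyadic_log :: "nat \<Rightarrow> nat \<Rightarrow> real" where
  "dyadic_log k j = max (real j * ln 2) (ln (real k))"

text \<open>A maximum is at least the mean of its arguments, so the exponential splits into a
  geometric factor in \<open>j\<close> and a power of \<open>k\<close>; the factor 4 is what makes
  that power the summable k^-2.\<close>

lemma exp_dyadic_log_le:
  assumes k: "1 \<le> k"
  shows "exp (- 4 * dyadic_log k j) \<le> (1 / 4) ^ j * (1 / real k ^ 2)"
proof -
  have "- 4 * dyadic_log k j \<le> - (2 * (real j * ln 2)) - 2 * ln (real k)"
    unfolding dyadic_log_def by linarith
  then have "exp (- 4 * dyadic_log k j) \<le> exp (- (2 * (real j * ln 2)) - 2 * ln (real k))" by simp
  also have "\<dots> = (1 / 4) ^ j * (1 / real k ^ 2)"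
  proof -
    have "exp (2 * (real j * ln 2)) = (4::real) ^ j"
    proof -
      have "exp (2 * (real j * ln 2)) = exp (real j * ln 2) ^ 2" by (rule exp_double)
      also have "exp (real j * ln 2) = (2::real) ^ j" by (simp add: exp_of_nat_mult)
      finally show ?thesis by (simp add: power_mult[symmetric] mult.commute[of j] power_mult[of 2 2])
    qed
    moreover have "exp (2 * ln (real k)) = real k ^ 2"
      using k exp_double[of "ln (real k)"] by simp
    ultimately show ?thesis by (simp add: exp_diff exp_minus power_one_over inverse_eq_divide)
  qed
  finally show ?thesis .
qed

context entropy_class
begin

lemma AE_dyadic_deviation:
  fixes c Cv :: real
  assumes c: "0 < c" and Cv: "0 \<le> Cv"
  obtains A where "0 < A" "AE \<omega> in M. \<forall>\<^sub>F k in sequentially. \<forall>j. c * ln (2 ^ k) \<le> 2 ^ k * (1 / 2) ^ j \<longrightarrow>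
     (\<forall>n\<le>2 ^ k. \<forall>u\<in>F. (LINT z|P. (u z)\<^sup>2) \<le> Cv * (1 / 2) ^ j \<longrightarrow>
        \<bar>dev n u \<omega>\<bar> \<le> A * sqrt (2 ^ k * (1 / 2) ^ j * dyadic_log k j))"
proof -
  \<comment> \<open>Two cases of N h l >= c' \<Lambda>^2 with \<Lambda> = ln N have to be served. If
    j ln 2 >= \<Lambda>/2, then N h >= c \<Lambda> and l >= \<Lambda>/2 give the constant c/2.
    Otherwise N h = exp(\<Lambda> - j ln 2) >= exp(\<Lambda>/2) >= \<Lambda>^2/16.\<close>
  define c' where "c' = min (c / 2) (1 / 16)"
  have c': "0 < c'" "c' \<le> c / 2" "c' \<le> 1 / 16" using c by (auto simp: c'_def)
  obtain A K where A: "0 < A" and K: "0 \<le> K" and AK: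
    "\<And>N h l. 1 \<le> N \<Longrightarrow> 0 < h \<Longrightarrow> h \<le> 1 \<Longrightarrow> 1 \<le> l \<Longrightarrow> l \<le> ln (real N) \<Longrightarrow> ln (real N) \<le> exp l \<Longrightarrow>
       1 / h \<le> exp l \<Longrightarrow> c' * ln (real N) \<le> real N * h \<Longrightarrow> c' * (ln (real N))\<^sup>2 \<le> real N * h * l \<Longrightarrow>
       \<exists>E\<in>events. prob E \<le> K * exp (- 4 * l) \<and>
         (\<forall>\<omega>\<in>space M - E. agrees N \<omega> \<longrightarrow> (\<forall>n\<le>N. \<forall>u\<in>F. (LINT z|P. (u z)\<^sup>2) \<le> Cv * h \<longrightarrow>
            \<bar>dev n u \<omega>\<bar> \<le> A * sqrt (real N * h * l)))"
    by (rule deviation_block[OF c'(1) Cv], rule that)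
  define good where "good = (\<lambda>k j \<omega>. \<forall>n\<le>2 ^ k. \<forall>u\<in>F. (LINT z|P. (u z)\<^sup>2) \<le> Cv * (1 / 2) ^ j \<longrightarrow>
        \<bar>dev n u \<omega>\<bar> \<le> A * sqrt (2 ^ k * (1 / 2) ^ j * dyadic_log k j))"
  define pre where "pre = (\<lambda>k j. c * ln (2 ^ k) \<le> 2 ^ k * (1 / 2 :: real) ^ j)"
  \<comment> \<open>From \<open>k0\<close> on, c ln(2^k) >= 1, so the lower limit on the bandwidth
    forces 2^-j >= 2^-k, that is j <= k. The added 3 gives ln k >= 1 and hence l >= 1.\<close>
  define k0 where "k0 = nat \<lceil>1 / (c * ln 2)\<rceil> + 3"
  have k0: "3 \<le> k0" by (simp add: k0_def)
  have ck: "1 \<le> c * ln (2 ^ k)" if "k0 \<le> k" for k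
  proof -
    have "1 / (c * ln 2) \<le> real k" using that unfolding k0_def by linarith
    then show ?thesis using c by (simp add: ln_realpow field_simps)
  qed
  have jk: "j \<le> k" if "k0 \<le> k" "pre k j" for k j
  proof (rule ccontr)
    assume "\<not> j \<le> k"
    then have "(2::real) ^ k < 2 ^ j" by simp
    then have "2 ^ k * (1 / 2 :: real) ^ j < 1" by (simp add: power_one_over)
    then show False using ck[OF that(1)] that(2) unfolding pre_def by linarith
  qed
  have ex: "\<exists>E\<in>events. prob E \<le> K * ((1 / 4) ^ j * (1 / real k ^ 2)) \<and> (\<forall>\<omega>\<in>space M - E. agrees (2 ^ k) \<omega> \<longrightarrow> good k j \<omega>)"
    if k: "k0 \<le> k" and pre: "pre k j" for k j
  proof -
    define l where "l = dyadic_log k j"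
    define h :: real where "h = (1 / 2) ^ j"
    define \<Lambda> :: real where "\<Lambda> = ln (2 ^ k)"
    have k3: "3 \<le> k" using k k0 by simp
    have \<Lambda>k: "\<Lambda> = real k * ln 2" by (simp add: \<Lambda>_def ln_realpow)
    have \<Lambda>0: "0 \<le> \<Lambda>" by (simp add: \<Lambda>k)
    have h: "0 < h" "h \<le> 1" by (simp_all add: h_def power_le_one)
    have lnk: "1 \<le> ln (real k)"
    proof -
      have "exp 1 \<le> (3::real)" by (rule exp_le)
      then show ?thesis using k3 by (subst ln_ge_iff) auto
    qed
    have l1: "1 \<le> l" "ln (real k) \<le> l" "real j * ln 2 \<le> l" using lnk by (auto simp: l_def dyadic_log_def)
    have l2: "l \<le> \<Lambda>"
      using jk[OF k pre] ln_le_mult_ln2[of k] k3 unfolding l_def dyadic_log_def \<Lambda>k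
      by (intro max.boundedI mult_right_mono) auto
    have h2: "1 / h = exp (real j * ln 2)" by (simp add: h_def exp_of_nat_mult power_one_over)
    have l3: "1 / h \<le> exp l" unfolding h2 using l1(3) by simp
    have l4: "\<Lambda> \<le> exp l"
    proof -
      have "\<Lambda> \<le> real k * 1" unfolding \<Lambda>k using ln_2_less_1 by (intro mult_left_mono) auto
      also have "\<dots> = exp (ln (real k))" using k3 by simp
      also have "\<dots> \<le> exp l" using l1 by simp
      finally show ?thesis .
    qed
    have Nh: "c * \<Lambda> \<le> 2 ^ k * h" using pre by (simp add: pre_def \<Lambda>_def h_def)
    have Nh': "c' * \<Lambda> \<le> 2 ^ k * h"
    proof -
      have "c' * \<Lambda> \<le> c * \<Lambda>" using c' c \<Lambda>0 by (intro mult_right_mono) auto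
      then show ?thesis using Nh by linarith
    qed
    have Nhl: "c' * \<Lambda>\<^sup>2 \<le> 2 ^ k * h * l"
    proof (cases "\<Lambda> / 2 \<le> real j * ln 2")
      case True
      have "c' * \<Lambda>\<^sup>2 \<le> (c / 2) * \<Lambda>\<^sup>2" using c' by (intro mult_right_mono) auto
      also have "\<dots> = (c * \<Lambda>) * (\<Lambda> / 2)" by (simp add: power2_eq_square)
      also have "\<dots> \<le> (2 ^ k * h) * l"
        using True l1(3) \<Lambda>0 h by (intro mult_mono[OF Nh]) auto
      finally show ?thesis .
    next
      case False
      have "c' * \<Lambda>\<^sup>2 \<le> (1 / 16) * \<Lambda>\<^sup>2" using c' by (intro mult_right_mono) auto
      also have "\<dots> \<le> exp (\<Lambda> / 2)" using square_le_exp_half[OF \<Lambda>0] by simp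
      also have "\<dots> \<le> exp (\<Lambda> - real j * ln 2)" using False by simp
      also have "\<dots> = 2 ^ k * h"
      proof -
        have "exp \<Lambda> = 2 ^ k" by (simp add: \<Lambda>_def)
        then show ?thesis using h2 h by (simp add: exp_diff field_simps)
      qed
      also have "\<dots> \<le> 2 ^ k * h * l" using l1 h by simp
      finally show ?thesis .
    qed
    have "\<exists>E\<in>events. prob E \<le> K * exp (- 4 * l) \<and>
         (\<forall>\<omega>\<in>space M - E. agrees (2 ^ k) \<omega> \<longrightarrow> (\<forall>n\<le>2 ^ k. \<forall>u\<in>F. (LINT z|P. (u z)\<^sup>2) \<le> Cv * h \<longrightarrow>
            \<bar>dev n u \<omega>\<bar> \<le> A * sqrt (real (2 ^ k) * h * l)))"
      by (rule AK) (use h l1 l2 l3 l4 Nh' Nhl in \<open>simp_all add: \<Lambda>_def\<close>)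
    then obtain E where E: "E \<in> events" "prob E \<le> K * exp (- 4 * l)"
         "\<forall>\<omega>\<in>space M - E. agrees (2 ^ k) \<omega> \<longrightarrow> (\<forall>n\<le>2 ^ k. \<forall>u\<in>F. (LINT z|P. (u z)\<^sup>2) \<le> Cv * h \<longrightarrow>
            \<bar>dev n u \<omega>\<bar> \<le> A * sqrt (real (2 ^ k) * h * l))"
      by (elim bexE conjE)
    have "K * exp (- 4 * l) \<le> K * ((1 / 4) ^ j * (1 / real k ^ 2))"
      unfolding l_def using K k3 by (intro mult_left_mono exp_dyadic_log_le) auto
    then have "prob E \<le> K * ((1 / 4) ^ j * (1 / real k ^ 2))" using E(2) by linarith
    moreover have "\<forall>\<omega>\<in>space M - E. agrees (2 ^ k) \<omega> \<longrightarrow> good k j \<omega>"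
      using E(3) by (simp add: good_def l_def h_def)
    ultimately show ?thesis using E(1) by (intro bexI[of _ E] conjI)
  qed
  have "\<forall>k j. \<exists>E. k0 \<le> k \<longrightarrow> pre k j \<longrightarrow> E \<in> events \<and> prob E \<le> K * ((1 / 4) ^ j * (1 / real k ^ 2)) \<and>
      (\<forall>\<omega>\<in>space M - E. agrees (2 ^ k) \<omega> \<longrightarrow> good k j \<omega>)"
    using ex unfolding Bex_def by blast
  then obtain E where E: "\<And>k j. k0 \<le> k \<Longrightarrow> pre k j \<Longrightarrow> E k j \<in> events"
    "\<And>k j. k0 \<le> k \<Longrightarrow> pre k j \<Longrightarrow> prob (E k j) \<le> K * ((1 / 4) ^ j * (1 / real k ^ 2))"
    "\<And>k j \<omega>. k0 \<le> k \<Longrightarrow> pre k j \<Longrightarrow> \<omega> \<in> space M - E k j \<Longrightarrow> agrees (2 ^ k) \<omega> \<Longrightarrow> good k j \<omega>"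
    unfolding choice_iff by blast
  \<comment> \<open>The weights 4^-j keep the total over all scales of order k^-2, so Borel-Cantelli
    is applied in \<open>k\<close> alone.\<close>
  define D where "D = (\<lambda>k. \<Union>j\<in>{j. j \<le> k \<and> pre k j}. E k j)"
  have D: "D k \<in> events" if "k0 \<le> k" for k
    unfolding D_def using E(1)[OF that] by (intro sets.finite_UN) auto
  have pD: "prob (D k) \<le> 2 * K * (1 / real k ^ 2)" if k: "k0 \<le> k" for k
  proof -
    have "prob (D k) \<le> (\<Sum>j\<in>{j. j \<le> k \<and> pre k j}. prob (E k j))"
      unfolding D_def using E(1)[OF k] by (intro finite_measure_subadditive_finite) auto
    also have "\<dots> \<le> (\<Sum>j\<in>{j. j \<le> k \<and> pre k j}. K * ((1 / 4) ^ j * (1 / real k ^ 2)))"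
      using E(2)[OF k] by (intro sum_mono) auto
    also have "\<dots> \<le> (\<Sum>j\<in>{..<Suc k}. K * ((1 / 4) ^ j * (1 / real k ^ 2)))"
      using K by (intro sum_mono2) auto
    also have "\<dots> = K * (1 / real k ^ 2) * (\<Sum>j<Suc k. (1 / 4) ^ j)"
      by (simp only: sum_distrib_left mult.assoc mult.commute[of "1 / real k ^ 2"])
    also have "\<dots> \<le> K * (1 / real k ^ 2) * 2"
    proof (rule mult_left_mono)
      have eq: "(\<Sum>j<Suc k. (1 / 4 :: real) ^ j) = 4 / 3 * (1 - (1 / 4) ^ Suc k)"
        by (subst sum_gp_strict) simp
      have "0 \<le> x \<Longrightarrow> 4 / 3 * (1 - x) \<le> 2" for x :: real by simp
      from this[of "(1 / 4) ^ Suc k"] show "(\<Sum>j<Suc k. (1 / 4 :: real) ^ j) \<le> 2" by (simp only: eq) simp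
    qed (use K in simp)
    finally show ?thesis by (simp add: mult.commute mult.left_commute)
  qed
  have "AE \<omega> in M. \<forall>\<^sub>F k in sequentially. \<omega> \<in> space M - D (k + k0)"
  proof (rule borel_cantelli_AE1)
    show "summable (\<lambda>k. measure M (D (k + k0)))"
    proof (rule summable_comparison_test')
      have "summable (\<lambda>k. 2 * K * (1 / real k ^ 2))"
        using inverse_power_summable[of 2, where 'a=real]
        by (intro summable_mult) (simp add: inverse_eq_divide power_one_over)
      then show "summable (\<lambda>k. 2 * K * (1 / real (k + k0) ^ 2))"
        by (subst summable_iff_shift[of "\<lambda>k. 2 * K * (1 / real k ^ 2)"])
      show "norm (measure M (D (k + k0))) \<le> 2 * K * (1 / real (k + k0) ^ 2)" for k
        using pD[of "k + k0"] by simp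
    qed
    show "D (k + k0) \<in> sets M" for k using D[of "k + k0"] by simp
    show "emeasure M (D (k + k0)) < \<infinity>" for k by (simp add: emeasure_eq_measure)
  qed
  then have "AE \<omega> in M. \<forall>\<^sub>F k in sequentially. \<forall>j. pre k j \<longrightarrow> good k j \<omega>"
    using AE_eventually_agrees
  proof eventually_elim
    fix \<omega> assume 1: "\<forall>\<^sub>F k in sequentially. \<omega> \<in> space M - D (k + k0)"
      and 2: "\<forall>\<^sub>F n in sequentially. agrees n \<omega>"
    have "\<forall>\<^sub>F k in sequentially. \<omega> \<in> space M - D k"
      using 1 by (subst (asm) eventually_sequentially_seg)
    moreover have "\<forall>\<^sub>F k in sequentially. agrees (2 ^ k) \<omega>"
    proof (rule eventually_compose_filterlim[OF 2])
      show "filterlim (\<lambda>k. (2::nat) ^ k) at_top sequentially"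
        by (rule filterlim_subseq) (simp add: strict_mono_def)
    qed
    ultimately show "\<forall>\<^sub>F k in sequentially. \<forall>j. pre k j \<longrightarrow> good k j \<omega>"
      using eventually_ge_at_top[of k0]
    proof eventually_elim
      case (elim k)
      show ?case
      proof (intro allI impI)
        fix j assume p: "pre k j"
        have "\<omega> \<in> space M - E k j" using elim(1) jk[OF elim(3) p] p unfolding D_def by auto
        then show "good k j \<omega>" using E(3)[OF elim(3) p _ elim(2)] by simp
      qed
    qed
  qed
  then show ?thesis unfolding pre_def good_def by (rule that[OF A])
qed

end

section \<open>Almost sure constancy\<close>

lemma limsup_le_perturb:
  fixes f g :: "nat \<Rightarrow> ennreal" and e :: "nat \<Rightarrow> real"
  assumes e: "e \<longlonglongrightarrow> 0" and le: "\<forall>\<^sub>F n in sequentially. f n \<le> g n + ennreal (e n)"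
  shows "limsup f \<le> limsup g"
proof (rule ennreal_le_epsilon)
  fix \<epsilon> :: real assume \<epsilon>: "0 < \<epsilon>"
  have "\<forall>\<^sub>F n in sequentially. e n < \<epsilon>" using e \<epsilon> by (rule order_tendstoD)
  then have "\<forall>\<^sub>F n in sequentially. f n \<le> g n + ennreal \<epsilon>"
    using le
  proof eventually_elim
    case (elim n)
    have "g n + ennreal (e n) \<le> g n + ennreal \<epsilon>" using elim(1) by (intro add_left_mono ennreal_leI) simp
    then show ?case using elim(2) by (rule order_trans[rotated])
  qed
  then have "limsup f \<le> limsup (\<lambda>n. g n + ennreal \<epsilon>)" by (rule Limsup_mono)
  also have "\<dots> = limsup g + ennreal \<epsilon>"
    by (rule Limsup_compose_continuous_mono)
      (auto intro!: continuous_on_add_ennreal continuous_intros monoI add_right_mono)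
  finally show "limsup f \<le> limsup g + ennreal \<epsilon>" .
qed

text \<open>The value is the infimum of the levels \<open>q\<close> with P(f <= q) = 1. A countable
  family of such levels bounds \<open>f\<close> from above; smaller levels have probability 0, and a
  countable family of them bounds it from below.\<close>

lemma (in prob_space) AE_const_if_zero_one:
  fixes f :: "'a \<Rightarrow> ennreal"
  assumes f[measurable]: "f \<in> borel_measurable M"
    and zo: "\<And>q. prob {\<omega>\<in>space M. f \<omega> \<le> q} = 0 \<or> prob {\<omega>\<in>space M. f \<omega> \<le> q} = 1"
  shows "\<exists>G. AE \<omega> in M. f \<omega> = G"
proof -
  define Q where "Q = {q. prob {\<omega>\<in>space M. f \<omega> \<le> q} = 1}"
  define G where "G = Inf Q"
  have "top \<in> Q" by (simp add: Q_def prob_space)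
  then obtain q where q: "range q \<subseteq> Q" "Inf Q = (INF i::nat. q i)"
    using ennreal_Inf_countable_INF[of Q] by auto
  have "AE \<omega> in M. \<forall>i. f \<omega> \<le> q i"
    unfolding AE_all_countable
  proof
    fix i
    have "q i \<in> Q" using q(1) by auto
    then have "prob {\<omega>\<in>space M. f \<omega> \<le> q i} = 1" by (simp add: Q_def)
    then show "AE \<omega> in M. f \<omega> \<le> q i" by (subst (asm) prob_Collect_eq_1) auto
  qed
  then have upper: "AE \<omega> in M. f \<omega> \<le> G"
    by eventually_elim (simp add: G_def q(2) INF_greatest)
  have lower: "AE \<omega> in M. G \<le> f \<omega>"
  proof (cases "G = 0")
    case False
    then have "0 < G" by (simp add: zero_less_iff_neq_zero)
    then have SG: "Sup {0<..<G} = G" "{0<..<G} \<noteq> {}" by (auto simp: dense)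
    obtain p where p: "range p \<subseteq> {0<..<G}" "Sup {0<..<G} = (SUP i::nat. p i)"
      using ennreal_Sup_countable_SUP[OF SG(2)] by auto
    have "AE \<omega> in M. \<forall>i. p i < f \<omega>"
      unfolding AE_all_countable
    proof
      fix i
      have "p i \<in> {0<..<G}" using p(1) by (rule subsetD) (rule rangeI)
      then have "p i < G" by simp
      then have "p i \<notin> Q" unfolding G_def by (meson Inf_lower leD)
      then have "prob {\<omega>\<in>space M. f \<omega> \<le> p i} = 0" using zo[of "p i"] by (auto simp: Q_def)
      then have "AE \<omega> in M. \<not> f \<omega> \<le> p i" by (subst (asm) prob_Collect_eq_0) auto
      then show "AE \<omega> in M. p i < f \<omega>" by (simp add: not_le)
    qed
    then show ?thesis
    proof eventually_elim
      case (elim \<omega>)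
      have "(SUP i. p i) \<le> f \<omega>" using elim by (intro SUP_least less_imp_le) auto
      then show ?case using p(2) SG(1) by simp
    qed
  qed simp
  from upper lower have "AE \<omega> in M. f \<omega> = G" by eventually_elim simp
  then show ?thesis by (rule exI)
qed

section \<open>Tail functions and the zero-one law\<close>

context iid_sequence
begin

definition dev_from :: "nat \<Rightarrow> nat \<Rightarrow> ('z \<Rightarrow> real) \<Rightarrow> 'w \<Rightarrow> real" where
  "dev_from k n u \<omega> = (\<Sum>i\<in>{k<..n}. u (Z i \<omega>) - (LINT z|P. u z))"

lemma dev_from_0: "dev_from 0 n u \<omega> = dev n u \<omega>"
  by (simp add: dev_from_def dev_def atLeastSucAtMost_greaterThanAtMost[symmetric])

lemma dev_split: "k \<le> n \<Longrightarrow> dev n u \<omega> = dev k u \<omega> + dev_from k n u \<omega>"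
proof -
  assume "k \<le> n"
  then have "{1..n} = {1..k} \<union> {k<..n}" by auto
  then show ?thesis unfolding dev_def dev_from_def
    by (simp only:) (subst sum.union_disjoint, auto)
qed

text \<open>Tail measurability is encoded by quantifying over all measures \<open>N\<close> on the
  same space that make \<open>Z i\<close> measurable for i > k. Taking the one generated by the
  terms from index \<open>k\<close> on, for every \<open>k\<close>, puts each sublevel set into the
  tail \<sigma>-algebra.\<close>

lemma AE_const_if_tail_measurable:
  fixes f :: "'w \<Rightarrow> ennreal"
  assumes f: "\<And>k N. space N = space M \<Longrightarrow> (\<And>i. k < i \<Longrightarrow> Z i \<in> measurable N borel) \<Longrightarrow> f \<in> borel_measurable N"
  shows "\<exists>G. AE \<omega> in M. f \<omega> = G"
proof (rule AE_const_if_zero_one)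
  show fM: "f \<in> borel_measurable M" by (rule f[of M 0]) auto
  define A where "A = (\<lambda>i. sigma_sets (space M) {Z i -` B \<inter> space M | B. B \<in> sets borel})"
  fix q
  show "prob {\<omega>\<in>space M. f \<omega> \<le> q} = 0 \<or> prob {\<omega>\<in>space M. f \<omega> \<le> q} = 1"
  proof (rule kolmogorov_0_1_law)
    show "sigma_algebra (space M) (A i)" for i
      unfolding A_def by (rule sigma_algebra_sigma_sets) auto
    show "indep_sets A UNIV"
      using indep unfolding indep_vars_def A_def by simp
    have "{\<omega>\<in>space M. f \<omega> \<le> q} \<in> sigma_sets (space M) (\<Union> (A ` {k..}))" for k
    proof -
      define N where "N = sigma (space M) (\<Union> (A ` {k..}))"
      have sub: "\<Union> (A ` {k..}) \<subseteq> Pow (space M)"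
        unfolding A_def by (auto dest!: sigma_sets_into_sp[rotated])
      have sp: "space N = space M" unfolding N_def using sub by (rule space_measure_of)
      have st: "sets N = sigma_sets (space M) (\<Union> (A ` {k..}))" unfolding N_def using sub by (rule sets_measure_of)
      have "Z i \<in> measurable N borel" if "k < i" for i
      proof (rule measurableI)
        fix B :: "'z set" assume "B \<in> sets borel"
        then have "Z i -` B \<inter> space M \<in> A i" unfolding A_def by (intro sigma_sets.Basic) auto
        then have "Z i -` B \<inter> space M \<in> \<Union> (A ` {k..})" using that by auto
        then show "Z i -` B \<inter> space N \<in> sets N" unfolding sp st by (rule sigma_sets.Basic)
      qed simp
      then have [measurable]: "f \<in> borel_measurable N" by (rule f[OF sp])
      have "{\<omega>\<in>space N. f \<omega> \<le> q} \<in> sets N" by measurable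
      then show ?thesis by (simp only: sp st)
    qed
    then show "{\<omega>\<in>space M. f \<omega> \<le> q} \<in> tail_events A"
      unfolding tail_events_def by blast
  qed
qed

end

context entropy_class
begin

text \<open>Pigeonhole: members of \<open>S\<close> are sorted by their weight, rounded to the grid
  n^-2, and by a net point close to their function. This gives finitely many classes, and one
  representative is taken from each. Representatives lie in \<open>S\<close>, so passing to them can
  only lower a supremum.\<close>

lemma finite_subnet:
  fixes S :: "(real \<times> ('z \<Rightarrow> real)) set"
  assumes n: "1 \<le> n" and S: "\<And>w. w \<in> S \<Longrightarrow> 0 \<le> fst w \<and> fst w \<le> \<alpha> \<and> snd w \<in> F"
  shows "\<exists>D\<subseteq>S. finite D \<and> (\<forall>w\<in>S. \<exists>d\<in>D. \<bar>fst w - fst d\<bar> \<le> 1 / real n ^ 2 \<and>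
           (LINT z|P. (snd w z - snd d z)\<^sup>2) < 1 / (32 * real n ^ 4))"
proof -
  \<comment> \<open>Two members of one class are both within \<delta> of the same net point, and 4
    \<delta>^2 = 1/(36 n^4) is below the threshold of \<open>agrees\<close>.\<close>
  define \<delta> where "\<delta> = 1 / (12 * real n ^ 2)"
  have n2: "1 \<le> real n ^ 2" using n by (simp add: one_le_power)
  then have "1 \<le> 12 * real n ^ 2" by linarith
  then have \<delta>: "0 < \<delta>" "\<delta> \<le> 1"
    unfolding \<delta>_def using n by (simp, metis divide_le_eq_1 less_le_trans zero_less_one)
  have \<delta>2: "4 * \<delta>\<^sup>2 < 1 / (32 * real n ^ 4)"
  proof -
    have "4 * \<delta>\<^sup>2 = 1 / (36 * real n ^ 4)" by (simp add: \<delta>_def power_divide power_mult_distrib flip: power_mult)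
    also have "\<dots> < 1 / (32 * real n ^ 4)" using n by (intro divide_strict_left_mono) auto
    finally show ?thesis .
  qed
  obtain T where T: "T \<subseteq> F" "finite T" "real (card T) \<le> C * (1 / \<delta>) ^ \<nu>"
      "\<And>u. u \<in> F \<Longrightarrow> \<exists>v\<in>T. (LINT z|P. (u z - v z)\<^sup>2) \<le> \<delta>\<^sup>2"
    by (rule net_P[OF \<delta>], rule that)
  define v where "v = (\<lambda>u. SOME v. v \<in> T \<and> (LINT z|P. (u z - v z)\<^sup>2) \<le> \<delta>\<^sup>2)"
  have v: "v u \<in> T" "(LINT z|P. (u z - v u z)\<^sup>2) \<le> \<delta>\<^sup>2" if "u \<in> F" for u
  proof -
    have "\<exists>v. v \<in> T \<and> (LINT z|P. (u z - v z)\<^sup>2) \<le> \<delta>\<^sup>2" using T(4)[OF that] unfolding Bex_def .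
    from someI_ex[OF this] show "v u \<in> T" "(LINT z|P. (u z - v u z)\<^sup>2) \<le> \<delta>\<^sup>2" by (simp_all add: v_def)
  qed
  define key where "key = (\<lambda>w. (\<lfloor>fst w * real n ^ 2\<rfloor>, v (snd w)))"
  define D where "D = inv_into S key ` (key ` S)"
  have "key ` S \<subseteq> {0..\<lfloor>\<alpha> * real n ^ 2\<rfloor>} \<times> T"
  proof (rule image_subsetI)
    fix w assume "w \<in> S"
    note w = S[OF this]
    have "0 \<le> fst w * real n ^ 2" "fst w * real n ^ 2 \<le> \<alpha> * real n ^ 2"
      using w by (auto intro!: mult_right_mono)
    then have "0 \<le> \<lfloor>fst w * real n ^ 2\<rfloor>" "\<lfloor>fst w * real n ^ 2\<rfloor> \<le> \<lfloor>\<alpha> * real n ^ 2\<rfloor>"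
      by (simp_all only: zero_le_floor floor_mono)
    then show "key w \<in> {0..\<lfloor>\<alpha> * real n ^ 2\<rfloor>} \<times> T"
      using v(1) w by (simp add: key_def)
  qed
  then have fin: "finite (key ` S)" using T(2) by (rule finite_subset[OF _ finite_cartesian_product[OF finite_atLeastAtMost_int]])
  show ?thesis
  proof (intro exI[of _ D] conjI ballI)
    show "D \<subseteq> S" unfolding D_def by (intro image_subsetI inv_into_into)
    show "finite D" unfolding D_def using fin by (rule finite_imageI)
    fix w assume w: "w \<in> S"
    define d where "d = inv_into S key (key w)"
    have dS: "d \<in> S" and kd: "key d = key w"
      unfolding d_def using w by (simp_all only: inv_into_into f_inv_into_f imageI)
    have "d \<in> D" unfolding D_def d_def using w by auto
    moreover have "\<bar>fst w - fst d\<bar> \<le> 1 / real n ^ 2"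
    proof -
      have "\<lfloor>fst w * real n ^ 2\<rfloor> = \<lfloor>fst d * real n ^ 2\<rfloor>" using kd by (simp add: key_def)
      then have "\<bar>fst w * real n ^ 2 - fst d * real n ^ 2\<bar> \<le> 1" by linarith
      then have "\<bar>fst w - fst d\<bar> * real n ^ 2 \<le> 1" by (simp add: abs_mult flip: left_diff_distrib)
      then show ?thesis using n by (simp add: field_simps)
    qed
    moreover have "(LINT z|P. (snd w z - snd d z)\<^sup>2) < 1 / (32 * real n ^ 4)"
    proof -
      have wF: "snd w \<in> F" "snd d \<in> F" using S[OF w] S[OF dS] by auto
      have vF: "v (snd w) \<in> F" using v(1)[OF wF(1)] T(1) by auto
      have eq: "v (snd d) = v (snd w)" using kd by (simp add: key_def)
      have sym: "(LINT z|P. (v (snd w) z - u z)\<^sup>2) = (LINT z|P. (u z - v (snd w) z)\<^sup>2)" for u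
        by (simp only: power2_commute)
      have "(LINT z|P. (snd w z - snd d z)\<^sup>2) \<le> 2 * (LINT z|P. (v (snd w) z - snd w z)\<^sup>2) + 2 * (LINT z|P. (v (snd w) z - snd d z)\<^sup>2)"
        by (rule integral_diff_square_le[OF vF wF])
      also have "\<dots> \<le> 4 * \<delta>\<^sup>2"
        unfolding sym using v(2)[OF wF(1)] v(2)[OF wF(2)] by (simp add: eq)
      finally show ?thesis using \<delta>2 by linarith
    qed
    ultimately show "\<exists>d\<in>D. \<bar>fst w - fst d\<bar> \<le> 1 / real n ^ 2 \<and> (LINT z|P. (snd w z - snd d z)\<^sup>2) < 1 / (32 * real n ^ 4)"
      by blast
  qed
qed

text \<open>
  The supremum over \<open>S n\<close> need not be measurable, since subsets of a pointwise measurable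
  class can be badly behaved. Replacing \<open>S n\<close> by a finite net changes the supremum by a
  quantity that vanishes almost surely, and the limit superior over the nets is a tail function.
\<close>

lemma limsup_weighted_sup_const:
  fixes S :: "nat \<Rightarrow> (real \<times> ('z \<Rightarrow> real)) set" and \<alpha> :: "nat \<Rightarrow> real"
  assumes S: "\<And>n w. w \<in> S n \<Longrightarrow> 0 \<le> fst w \<and> fst w \<le> \<alpha> n \<and> snd w \<in> F"
    and \<alpha>: "\<alpha> \<longlonglongrightarrow> 0" "\<And>n. 0 \<le> \<alpha> n"
  shows "\<exists>G. AE \<omega> in M. limsup (\<lambda>n. SUP w\<in>S n. ennreal (fst w * \<bar>dev n (snd w) \<omega>\<bar>)) = G"
proof -
  have ex: "\<exists>D. finite D \<and> D \<subseteq> S n \<and> (1 \<le> n \<longrightarrow> (\<forall>w\<in>S n. \<exists>d\<in>D. \<bar>fst w - fst d\<bar> \<le> 1 / real n ^ 2 \<and>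
           (LINT z|P. (snd w z - snd d z)\<^sup>2) < 1 / (32 * real n ^ 4)))" for n
  proof (cases "1 \<le> n")
    case True
    have "\<exists>D\<subseteq>S n. finite D \<and> (\<forall>w\<in>S n. \<exists>d\<in>D. \<bar>fst w - fst d\<bar> \<le> 1 / real n ^ 2 \<and>
           (LINT z|P. (snd w z - snd d z)\<^sup>2) < 1 / (32 * real n ^ 4))"
      using True S by (rule finite_subnet)
    then show ?thesis by (elim exE conjE) (intro exI conjI impI)
  next
    case False
    then show ?thesis by (intro exI[of _ "{}"]) simp
  qed
  \<comment> \<open>The nets depend on \<open>n\<close> but not on \<omega>; this makes the maxima
    over them measurable.\<close>
  then obtain D where D: "\<And>n. finite (D n)" "\<And>n. D n \<subseteq> S n"
    "\<And>n. 1 \<le> n \<Longrightarrow> \<forall>w\<in>S n. \<exists>d\<in>D n. \<bar>fst w - fst d\<bar> \<le> 1 / real n ^ 2 \<and>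
           (LINT z|P. (snd w z - snd d z)\<^sup>2) < 1 / (32 * real n ^ 4)"
  proof -
    from choice[OF allI[OF ex]] obtain D where "\<forall>n. finite (D n) \<and> D n \<subseteq> S n \<and> (1 \<le> n \<longrightarrow>
      (\<forall>w\<in>S n. \<exists>d\<in>D n. \<bar>fst w - fst d\<bar> \<le> 1 / real n ^ 2 \<and> (LINT z|P. (snd w z - snd d z)\<^sup>2) < 1 / (32 * real n ^ 4)))"
      by (rule exE)
    then show ?thesis by (intro that[of D]) simp_all
  qed
  have DS: "0 \<le> fst w" "fst w \<le> \<alpha> n" "snd w \<in> F" if "w \<in> D n" for w n
    using S[OF subsetD[OF D(2) that]] by simp_all
  define \<Phi> where "\<Phi> = (\<lambda>n \<omega>. SUP w\<in>S n. ennreal (fst w * \<bar>dev n (snd w) \<omega>\<bar>))"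
  define \<Psi> where "\<Psi> = (\<lambda>k n \<omega>. SUP w\<in>D n. ennreal (fst w * \<bar>dev_from k n (snd w) \<omega>\<bar>))"
  have perturb: "ennreal (a * x) \<le> ennreal (a' * x') + ennreal e"
    if "a * x \<le> a' * x' + e" "0 \<le> a' * x'" "0 \<le> e" for a a' x x' e :: real
    using that by (simp add: ennreal_leI flip: ennreal_plus)

  \<comment> \<open>Dropping the first \<open>k\<close> terms changes every deviation by at most
    2\<kappa>k, and the weights tend to zero uniformly, so the limit superior does not
    notice.\<close>
  have tail: "limsup (\<lambda>n. \<Psi> k n \<omega>) = limsup (\<lambda>n. \<Psi> 0 n \<omega>)" for k \<omega>
  proof -
    define e where "e = (\<lambda>n. \<alpha> n * (2 * \<kappa> * real k))"
    have e: "e \<longlonglongrightarrow> 0" unfolding e_def using \<alpha>(1) by (rule tendsto_mult_left_zero)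
    have dif: "\<bar>dev n (snd w) \<omega> - dev_from k n (snd w) \<omega>\<bar> \<le> 2 * \<kappa> * real k" if "k \<le> n" "w \<in> D n" for n w
      using dev_bound[OF DS(3)[OF that(2)], of k \<omega>] by (simp add: dev_split[OF that(1)])
    have fste: "fst w * y \<le> e n" if "w \<in> D n" "y \<le> 2 * \<kappa> * real k" "0 \<le> y" for w n y
      unfolding e_def using DS[OF that(1)] that(2,3) \<alpha>(2) by (intro mult_mono) auto
    have e0: "0 \<le> e n" for n using \<alpha>(2) \<kappa>_ge_1 by (simp add: e_def)
    have bound: "ennreal (fst w * \<bar>x\<bar>) \<le> ennreal (fst w * \<bar>y\<bar>) + ennreal (e n)"
      if w: "w \<in> D n" and xy: "\<bar>x - y\<bar> \<le> 2 * \<kappa> * real k" for w n x y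
    proof (rule perturb)
      have w0: "0 \<le> fst w" using w by (rule DS)
      then show "0 \<le> fst w * \<bar>y\<bar>" by simp
      have "fst w * \<bar>x\<bar> \<le> fst w * (\<bar>y\<bar> + \<bar>x - y\<bar>)" using w0 by (intro mult_left_mono) auto
      also have "\<dots> \<le> fst w * \<bar>y\<bar> + e n" using fste[OF w xy] by (simp add: distrib_left)
      finally show "fst w * \<bar>x\<bar> \<le> fst w * \<bar>y\<bar> + e n" .
    qed (rule e0)
    have up: "ennreal (fst w * \<bar>dev_from i n (snd w) \<omega>\<bar>) \<le> \<Psi> i n \<omega>" if "w \<in> D n" for w i n
      unfolding \<Psi>_def using that by (rule SUP_upper)
    show ?thesis
    proof (rule antisym)
      show "limsup (\<lambda>n. \<Psi> k n \<omega>) \<le> limsup (\<lambda>n. \<Psi> 0 n \<omega>)"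
      proof (rule limsup_le_perturb[OF e], rule eventually_mono[OF eventually_ge_at_top[of k]])
        fix n assume n: "k \<le> n"
        show "\<Psi> k n \<omega> \<le> \<Psi> 0 n \<omega> + ennreal (e n)"
          unfolding \<Psi>_def
        proof (rule SUP_least)
          fix w assume w: "w \<in> D n"
          have "ennreal (fst w * \<bar>dev_from k n (snd w) \<omega>\<bar>) \<le> ennreal (fst w * \<bar>dev_from 0 n (snd w) \<omega>\<bar>) + ennreal (e n)"
            using dif[OF n w] by (intro bound[OF w]) (simp add: dev_from_0 abs_minus_commute)
          also have "\<dots> \<le> \<Psi> 0 n \<omega> + ennreal (e n)" by (intro add_right_mono up w)
          finally show "ennreal (fst w * \<bar>dev_from k n (snd w) \<omega>\<bar>) \<le> (SUP w\<in>D n. ennreal (fst w * \<bar>dev_from 0 n (snd w) \<omega>\<bar>)) + ennreal (e n)"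
            by (simp only: \<Psi>_def)
        qed
      qed
      show "limsup (\<lambda>n. \<Psi> 0 n \<omega>) \<le> limsup (\<lambda>n. \<Psi> k n \<omega>)"
      proof (rule limsup_le_perturb[OF e], rule eventually_mono[OF eventually_ge_at_top[of k]])
        fix n assume n: "k \<le> n"
        show "\<Psi> 0 n \<omega> \<le> \<Psi> k n \<omega> + ennreal (e n)"
          unfolding \<Psi>_def
        proof (rule SUP_least)
          fix w assume w: "w \<in> D n"
          have "ennreal (fst w * \<bar>dev_from 0 n (snd w) \<omega>\<bar>) \<le> ennreal (fst w * \<bar>dev_from k n (snd w) \<omega>\<bar>) + ennreal (e n)"
            using dif[OF n w] by (intro bound[OF w]) (simp add: dev_from_0)
          also have "\<dots> \<le> \<Psi> k n \<omega> + ennreal (e n)" by (intro add_right_mono up w)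
          finally show "ennreal (fst w * \<bar>dev_from 0 n (snd w) \<omega>\<bar>) \<le> (SUP w\<in>D n. ennreal (fst w * \<bar>dev_from k n (snd w) \<omega>\<bar>)) + ennreal (e n)"
            by (simp only: \<Psi>_def)
        qed
      qed
    qed
  qed

  have "\<exists>G. AE \<omega> in M. limsup (\<lambda>n. \<Psi> 0 n \<omega>) = G"
  proof (rule AE_const_if_tail_measurable)
    fix k and N :: "'w measure"
    assume "space N = space M" and Z: "\<And>i. k < i \<Longrightarrow> Z i \<in> measurable N borel"
    have "(\<lambda>\<omega>. dev_from k n (snd w) \<omega>) \<in> borel_measurable N" if "w \<in> D n" for w n
    proof -
      have u: "snd w \<in> borel_measurable borel" using DS(3)[OF that] by (rule F_measurable)
      show ?thesis unfolding dev_from_def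
        by (intro borel_measurable_sum borel_measurable_diff borel_measurable_const measurable_compose[OF Z u]) auto
    qed
    then have "(\<lambda>\<omega>. \<Psi> k n \<omega>) \<in> borel_measurable N" for n
      unfolding \<Psi>_def using D(1)
      by (intro borel_measurable_SUP measurable_compose[OF _ measurable_ennreal] borel_measurable_times
          borel_measurable_abs borel_measurable_const) (auto intro: countable_finite)
    then have "(\<lambda>\<omega>. limsup (\<lambda>n. \<Psi> k n \<omega>)) \<in> borel_measurable N" by measurable
    then show "(\<lambda>\<omega>. limsup (\<lambda>n. \<Psi> 0 n \<omega>)) \<in> borel_measurable N" by (simp only: tail[of k])
  qed
  then obtain G where G: "AE \<omega> in M. limsup (\<lambda>n. \<Psi> 0 n \<omega>) = G" by (rule exE)
  have "AE \<omega> in M. limsup (\<lambda>n. \<Phi> n \<omega>) = limsup (\<lambda>n. \<Psi> 0 n \<omega>)"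
    using AE_eventually_agrees
  proof eventually_elim
    fix \<omega> assume ag: "\<forall>\<^sub>F n in sequentially. agrees n \<omega>"
    \<comment> \<open>First error: weights differ by at most n^-2, while deviations are at most
      2\<kappa>n. Second error: nearly equal functions have deviations within near_bound + 1,
      multiplied by a weight that tends to zero.\<close>
    define e where "e = (\<lambda>n. 2 * \<kappa> * (1 / real n) + \<alpha> n * (near_bound + 1))"
    have "e \<longlonglongrightarrow> 2 * \<kappa> * 0 + 0 * (near_bound + 1)"
      unfolding e_def by (intro tendsto_intros \<alpha>(1) lim_1_over_n)
    then have e: "e \<longlonglongrightarrow> 0" by simp
    show "limsup (\<lambda>n. \<Phi> n \<omega>) = limsup (\<lambda>n. \<Psi> 0 n \<omega>)"
    proof (rule antisym)
      show "limsup (\<lambda>n. \<Psi> 0 n \<omega>) \<le> limsup (\<lambda>n. \<Phi> n \<omega>)"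
        unfolding \<Psi>_def \<Phi>_def dev_from_0 using D(2) by (intro Limsup_mono always_eventually allI SUP_subset_mono) auto
      show "limsup (\<lambda>n. \<Phi> n \<omega>) \<le> limsup (\<lambda>n. \<Psi> 0 n \<omega>)"
      proof (rule limsup_le_perturb[OF e])
        show "\<forall>\<^sub>F n in sequentially. \<Phi> n \<omega> \<le> \<Psi> 0 n \<omega> + ennreal (e n)"
          using ag eventually_ge_at_top[of 1]
        proof eventually_elim
          case (elim n)
          note n = elim(2)
          show ?case unfolding \<Phi>_def
          proof (rule SUP_least)
            fix w assume w: "w \<in> S n"
            from bspec[OF D(3)[OF n] w] obtain d where d: "d \<in> D n" "\<bar>fst w - fst d\<bar> \<le> 1 / real n ^ 2"
              "(LINT z|P. (snd w z - snd d z)\<^sup>2) < 1 / (32 * real n ^ 4)" by (elim bexE conjE)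
            have dS: "d \<in> S n" using d(1) D(2) by auto
            note wF = S[OF w] and dF = S[OF dS]
            define x where "x = \<bar>dev n (snd w) \<omega>\<bar>"
            define y where "y = \<bar>dev n (snd d) \<omega>\<bar>"
            have xy: "x \<le> y + (near_bound + 1)"
              using dev_near[OF n order_refl elim(1) conjunct2[OF conjunct2[OF wF]] conjunct2[OF conjunct2[OF dF]] d(3)]
              unfolding x_def y_def by linarith
            have x: "x \<le> 2 * \<kappa> * real n" "0 \<le> x" unfolding x_def using wF by (auto intro: dev_bound)
            have "fst w * x \<le> (fst d + 1 / real n ^ 2) * x"
              using d(2) x(2) by (intro mult_right_mono) auto
            also have "\<dots> \<le> fst d * (y + (near_bound + 1)) + 1 / real n ^ 2 * (2 * \<kappa> * real n)"
              unfolding distrib_right using dF xy x by (intro add_mono mult_left_mono) auto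
            also have "\<dots> = fst d * y + fst d * (near_bound + 1) + 2 * \<kappa> * (1 / real n)"
              using n by (simp add: distrib_left power2_eq_square)
            also have "\<dots> \<le> fst d * y + e n"
            proof -
              have "fst d * (near_bound + 1) \<le> \<alpha> n * (near_bound + 1)"
                using dF near_bound_pos by (intro mult_right_mono) auto
              then show ?thesis by (simp add: e_def)
            qed
            finally have "ennreal (fst w * x) \<le> ennreal (fst d * y) + ennreal (e n)"
            proof (rule perturb)
              show "0 \<le> fst d * y" using dF by (simp add: y_def)
              show "0 \<le> e n" using \<alpha>(2) \<kappa>_ge_1 near_bound_pos by (simp add: e_def)
            qed
            also have "ennreal (fst d * y) \<le> \<Psi> 0 n \<omega>"
              unfolding \<Psi>_def y_def dev_from_0 using d(1) by (rule SUP_upper)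
            finally show "ennreal (fst w * \<bar>dev n (snd w) \<omega>\<bar>) \<le> \<Psi> 0 n \<omega> + ennreal (e n)"
              unfolding x_def by (simp add: add_right_mono)
          qed
        qed
      qed
    qed
  qed
  with G have "AE \<omega> in M. limsup (\<lambda>n. \<Phi> n \<omega>) = G" by eventually_elim simp
  then show ?thesis unfolding \<Phi>_def by (rule exI)
qed

end

section \<open>Uniform deviations for all bandwidths\<close>

text \<open>Rounding \<open>h\<close> upwards preserves second moment bounds of the form Cv h and
  does not increase the logarithm; the price is a factor 2.\<close>

lemma dyadic_scale:
  fixes h :: real
  assumes h: "0 < h" "h \<le> 1"
  obtains j where "h \<le> (1 / 2) ^ j" "(1 / 2) ^ j \<le> 2 * h" "real j * ln 2 \<le> \<bar>ln h\<bar>"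
proof -
  define Q where "Q = (\<lambda>j. (1 / 2) ^ Suc j \<le> h)"
  obtain i where "(1 / 2) ^ i < h" using real_arch_pow_inv[OF h(1), of "1 / 2"] by auto
  then have ex: "Q i" unfolding Q_def using zero_le_power[of "1 / 2 :: real" i] by (simp del: zero_le_power)
  define j where "j = (LEAST j. Q j)"
  have Qj: "Q j" unfolding j_def using ex by (rule LeastI)
  have hj: "h \<le> (1 / 2) ^ j"
  proof (cases j)
    case 0
    then show ?thesis using h by simp
  next
    case (Suc j')
    then have "\<not> Q j'" using not_less_Least[of j' Q] by (simp add: j_def)
    then show ?thesis by (simp add: Q_def Suc del: power_Suc)
  qed
  have "ln h \<le> ln ((1 / 2) ^ j)" using h hj by (intro ln_mono) auto
  also have "\<dots> = - (real j * ln 2)" by (simp add: ln_realpow ln_div)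
  finally have "real j * ln 2 \<le> \<bar>ln h\<bar>" by linarith
  with hj Qj show ?thesis by (intro that[of j]) (auto simp: Q_def)
qed

text \<open>Rounding \<open>n\<close> up to a power of two must be harmless for the iterated
  logarithm. The comparison of ln k with 2 ln (ln n) rests on k <= (ln n)^2, and the threshold 2^6
  makes \<open>k\<close> large enough for it.\<close>

lemma dyadic_size:
  fixes n :: nat
  assumes n: "2 ^ 6 < n"
  obtains k where "n \<le> 2 ^ k" "2 ^ k \<le> 2 * n" "6 < k" "real k / 2 * ln 2 \<le> ln (real n)"
    "ln (real k) \<le> 2 * ln (ln (real n))"
proof -
  define k where "k = (LEAST k. n \<le> 2 ^ k)"
  have "n \<le> 2 ^ n" by (rule less_imp_le[OF less_exp])
  then have nk: "n \<le> 2 ^ k" unfolding k_def by (rule LeastI)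
  have k6: "6 < k"
  proof (rule ccontr)
    assume "\<not> 6 < k"
    then have "(2::nat) ^ k \<le> 2 ^ 6" by (intro power_increasing) auto
    then show False using nk n by linarith
  qed
  then obtain k' where k': "k = Suc k'" by (cases k) auto
  then have "\<not> n \<le> 2 ^ k'" using not_less_Least[of k' "\<lambda>k. n \<le> 2 ^ k"] by (simp add: k_def)
  then have kn: "2 ^ k' < n" by simp
  then have "2 ^ k \<le> 2 * n" by (simp add: k')
  have "real (2 ^ k') < real n" using kn by (simp only: of_nat_less_iff)
  then have "ln (2 ^ k') \<le> ln (real n)" by (intro ln_mono) (auto simp: n)
  then have ln_n: "real k' * ln 2 \<le> ln (real n)" by (simp add: ln_realpow)
  have "real k / 2 * ln 2 \<le> real k' * ln 2" using k6 k' by (intro mult_right_mono) auto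
  then have half: "real k / 2 * ln 2 \<le> ln (real n)" using ln_n by linarith
  have ln2: "1 / 2 \<le> ln (2::real)" using ln2_ge_two_thirds by linarith
  have "real k' * (1 / 2) \<le> real k' * ln 2" using ln2 by (intro mult_left_mono) auto
  then have "real k' / 2 \<le> ln (real n)" using ln_n by linarith
  then have "(real k' / 2)\<^sup>2 \<le> (ln (real n))\<^sup>2" by (intro power_mono) auto
  \<comment> \<open>As k' = k - 1 >= 6, k'^2 / 4 >= 6 k' / 4 >= k.\<close>
  moreover have "real k \<le> (real k' / 2)\<^sup>2"
  proof -
    have k'6: "6 \<le> real k'" using k6 k' by simp
    then have "6 * real k' \<le> real k' * real k'" by (intro mult_right_mono) auto
    moreover have "4 * real k \<le> 6 * real k'" using k'6 k' by simp
    ultimately show ?thesis by (simp add: power2_eq_square)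
  qed
  ultimately have "real k \<le> (ln (real n))\<^sup>2" by linarith
  moreover have ln_pos: "0 < ln (real n)" using n by (intro ln_gt_zero) auto
  ultimately have "ln (real k) \<le> ln ((ln (real n))\<^sup>2)" using k6 by (intro ln_mono) auto
  also have "\<dots> = 2 * ln (ln (real n))" using ln_pos by (simp add: ln_realpow)
  finally show ?thesis using nk \<open>2 ^ k \<le> 2 * n\<close> k6 half by (intro that[of k])
qed

lemma (in entropy_class) AE_deviation:
  fixes c Cv :: real
  assumes c: "0 < c" and Cv: "0 \<le> Cv"
  obtains A where "0 < A" "AE \<omega> in M. \<forall>\<^sub>F n in sequentially. \<forall>h u. 0 < h \<longrightarrow> h \<le> 1 \<longrightarrow>
     c * ln (real n) / real n \<le> h \<longrightarrow> u \<in> F \<longrightarrow> (LINT z|P. (u z)\<^sup>2) \<le> Cv * h \<longrightarrow>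
     \<bar>dev n u \<omega>\<bar> \<le> A * sqrt (real n * h * max \<bar>ln h\<bar> (ln (ln (real n))))"
proof -
  \<comment> \<open>The next power of two satisfies ln(2^k) <= 2 ln n, so a lower limit with
    constant \<open>c\<close> for \<open>n\<close> becomes one with c/2 for 2^k.\<close>
  have c2: "0 < c / 2" using c by simp
  obtain A where A: "0 < A" and AE: "AE \<omega> in M. \<forall>\<^sub>F k in sequentially. \<forall>j. c / 2 * ln (2 ^ k) \<le> 2 ^ k * (1 / 2) ^ j \<longrightarrow>
     (\<forall>n\<le>2 ^ k. \<forall>u\<in>F. (LINT z|P. (u z)\<^sup>2) \<le> Cv * (1 / 2) ^ j \<longrightarrow>
        \<bar>dev n u \<omega>\<bar> \<le> A * sqrt (2 ^ k * (1 / 2) ^ j * dyadic_log k j))"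
    by (rule AE_dyadic_deviation[OF c2 Cv], rule that)
  have "AE \<omega> in M. \<forall>\<^sub>F n in sequentially. \<forall>h u. 0 < h \<longrightarrow> h \<le> 1 \<longrightarrow>
     c * ln (real n) / real n \<le> h \<longrightarrow> u \<in> F \<longrightarrow> (LINT z|P. (u z)\<^sup>2) \<le> Cv * h \<longrightarrow>
     \<bar>dev n u \<omega>\<bar> \<le> A * sqrt 8 * sqrt (real n * h * max \<bar>ln h\<bar> (ln (ln (real n))))"
    using AE
  proof eventually_elim
    fix \<omega> assume "\<forall>\<^sub>F k in sequentially. \<forall>j. c / 2 * ln (2 ^ k) \<le> 2 ^ k * (1 / 2) ^ j \<longrightarrow>
     (\<forall>n\<le>2 ^ k. \<forall>u\<in>F. (LINT z|P. (u z)\<^sup>2) \<le> Cv * (1 / 2) ^ j \<longrightarrow>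
        \<bar>dev n u \<omega>\<bar> \<le> A * sqrt (2 ^ k * (1 / 2) ^ j * dyadic_log k j))"
    then obtain K where "\<forall>k\<ge>K. \<forall>j. c / 2 * ln (2 ^ k) \<le> 2 ^ k * (1 / 2) ^ j \<longrightarrow>
     (\<forall>n\<le>2 ^ k. \<forall>u\<in>F. (LINT z|P. (u z)\<^sup>2) \<le> Cv * (1 / 2) ^ j \<longrightarrow>
        \<bar>dev n u \<omega>\<bar> \<le> A * sqrt (2 ^ k * (1 / 2) ^ j * dyadic_log k j))"
      unfolding eventually_sequentially by (elim exE)
    then have K: "\<And>k j n u. K \<le> k \<Longrightarrow> c / 2 * ln (2 ^ k) \<le> 2 ^ k * (1 / 2) ^ j \<Longrightarrow>
       n \<le> 2 ^ k \<Longrightarrow> u \<in> F \<Longrightarrow> (LINT z|P. (u z)\<^sup>2) \<le> Cv * (1 / 2) ^ j \<Longrightarrow>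
        \<bar>dev n u \<omega>\<bar> \<le> A * sqrt (2 ^ k * (1 / 2) ^ j * dyadic_log k j)"
      by simp
    show "\<forall>\<^sub>F n in sequentially. \<forall>h u. 0 < h \<longrightarrow> h \<le> 1 \<longrightarrow>
     c * ln (real n) / real n \<le> h \<longrightarrow> u \<in> F \<longrightarrow> (LINT z|P. (u z)\<^sup>2) \<le> Cv * h \<longrightarrow>
     \<bar>dev n u \<omega>\<bar> \<le> A * sqrt 8 * sqrt (real n * h * max \<bar>ln h\<bar> (ln (ln (real n))))"
      using eventually_gt_at_top[of "2 ^ 6"] eventually_gt_at_top[of "2 ^ K"]
    proof eventually_elim
      case (elim n)
      show ?case
      proof (intro allI impI)
        fix h u assume h: "0 < h" "h \<le> 1" and hn: "c * ln (real n) / real n \<le> h"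
          and u: "u \<in> F" and Pu: "(LINT z|P. (u z)\<^sup>2) \<le> Cv * h"
        obtain j where j: "h \<le> (1 / 2) ^ j" "(1 / 2) ^ j \<le> 2 * h" "real j * ln 2 \<le> \<bar>ln h\<bar>"
          by (rule dyadic_scale[OF h])
        obtain k where k: "n \<le> 2 ^ k" "2 ^ k \<le> 2 * n" "6 < k" "real k / 2 * ln 2 \<le> ln (real n)"
          "ln (real k) \<le> 2 * ln (ln (real n))" by (rule dyadic_size[OF elim(1)])
        have Kk: "K \<le> k"
        proof (rule ccontr)
          assume "\<not> K \<le> k"
          then have "(2::nat) ^ k \<le> 2 ^ K" by (intro power_increasing) auto
          then show False using k(1) elim(2) by linarith
        qed
        have n0: "0 < real n" using elim(1) by simp
        have rk: "real n \<le> 2 ^ k" "2 ^ k \<le> 2 * real n"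
          using of_nat_mono[OF k(1), where 'a=real] of_nat_mono[OF k(2), where 'a=real] by simp_all
        have pre: "c / 2 * ln (2 ^ k) \<le> 2 ^ k * (1 / 2) ^ j"
        proof -
          have "c / 2 * ln (2 ^ k) = c * (real k / 2 * ln 2)" by (simp add: ln_realpow)
          also have "\<dots> \<le> c * ln (real n)" using k(4) c by (intro mult_left_mono) auto
          also have "\<dots> \<le> real n * h" using hn n0 by (simp add: field_simps)
          also have "\<dots> \<le> 2 ^ k * (1 / 2) ^ j" using rk j h by (intro mult_mono) auto
          finally show ?thesis .
        qed
        define m where "m = max \<bar>ln h\<bar> (ln (ln (real n)))"
        have dl: "dyadic_log k j \<le> 2 * m" "0 \<le> dyadic_log k j"
          using j(3) k(3,5) by (auto simp: dyadic_log_def m_def max_def)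
        have "(LINT z|P. (u z)\<^sup>2) \<le> Cv * (1 / 2) ^ j"
          using Pu mult_left_mono[OF j(1) Cv] by linarith
        from K[OF Kk pre k(1) u this]
        have "\<bar>dev n u \<omega>\<bar> \<le> A * sqrt (2 ^ k * (1 / 2) ^ j * dyadic_log k j)" .
        \<comment> \<open>Sample size, bandwidth and logarithm each lose at most a factor 2 in the
          rounding, whence sqrt 8.\<close>
        also have "\<dots> \<le> A * sqrt ((2 * real n) * (2 * h) * (2 * m))"
          using A rk j dl h n0 by (intro mult_left_mono real_sqrt_le_mono mult_mono) auto
        also have "(2 * real n) * (2 * h) * (2 * m) = 8 * (real n * h * m)" by simp
        finally show "\<bar>dev n u \<omega>\<bar> \<le> A * sqrt 8 * sqrt (real n * h * max \<bar>ln h\<bar> (ln (ln (real n))))"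
          by (simp only: m_def real_sqrt_mult mult.assoc)
      qed
    qed
  qed
  moreover have "0 < A * sqrt 8" using A by simp
  ultimately show ?thesis using that by blast
qed

section \<open>Dilation classes\<close>

lemma integrable_diff_square_L2:
  assumes "u \<in> L2_functions Q" "v \<in> L2_functions Q"
  shows "integrable Q (\<lambda>z. (u z - v z)\<^sup>2)"
proof (rule Bochner_Integration.integrable_bound)
  have [measurable]: "u \<in> borel_measurable Q" "v \<in> borel_measurable Q"
    and "integrable Q (\<lambda>z. (u z)\<^sup>2)" "integrable Q (\<lambda>z. (v z)\<^sup>2)"
    using assms by (auto simp: L2_functions_def)
  then show "integrable Q (\<lambda>z. 2 * (u z)\<^sup>2 + 2 * (v z)\<^sup>2)" by auto
  show "(\<lambda>z. (u z - v z)\<^sup>2) \<in> borel_measurable Q" by measurable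
  have "(a - b)\<^sup>2 \<le> 2 * a\<^sup>2 + 2 * b\<^sup>2" for a b :: real
  proof -
    have "2 * a\<^sup>2 + 2 * b\<^sup>2 - (a - b)\<^sup>2 = (a + b)\<^sup>2" by (simp add: power2_eq_square algebra_simps)
    then show ?thesis using zero_le_power2[of "a + b"] by linarith
  qed
  then show "AE z in Q. norm ((u z - v z)\<^sup>2) \<le> norm (2 * (u z)\<^sup>2 + 2 * (v z)\<^sup>2)"
    by (intro AE_I2) (simp add: abs_of_nonneg)
qed

text \<open>Centres of a cover may lie outside \<open>F\<close>; picking one member of
  \<open>F\<close> for each centre in use doubles the radius. The slack from N to N + 1 provides the
  strict inequality that extracts an actual cover from the infimum.\<close>

lemma finite_internal_net:
  assumes F: "F \<subseteq> L2_functions Q" and r: "0 < r" and N: "0 \<le> N"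
    and cov: "covering_number (L2_functions Q) (L2_dist Q) r F \<le> ennreal N"
  shows "\<exists>T\<subseteq>F. finite T \<and> real (card T) \<le> N + 1 \<and> (\<forall>u\<in>F. \<exists>v\<in>T. (LINT z|Q. (u z - v z)\<^sup>2) \<le> (2 * r)\<^sup>2)"
proof -
  have "covering_number (L2_functions Q) (L2_dist Q) r F < ennreal (N + 1)"
    using N by (intro order_le_less_trans[OF cov]) (simp add: ennreal_lessI)
  then obtain V where V: "finite V" "V \<subseteq> L2_functions Q"
      "F \<subseteq> (\<Union>v\<in>V. {u \<in> L2_functions Q. L2_dist Q u v < r})" "of_nat (card V) < ennreal (N + 1)"
    unfolding covering_number_def INF_less_iff by auto
  have cV: "real (card V) \<le> N + 1"
    using V(4) N by (simp add: ennreal_of_nat_eq_real_of_nat ennreal_less_iff del: ennreal_plus)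
  define near where "near = (\<lambda>u. SOME v. v \<in> V \<and> L2_dist Q u v < r)"
  have near: "near u \<in> V" "L2_dist Q u (near u) < r" if "u \<in> F" for u
  proof -
    have "\<exists>v. v \<in> V \<and> L2_dist Q u v < r" using V(3) that by auto
    from someI_ex[OF this] show "near u \<in> V" "L2_dist Q u (near u) < r" by (simp_all add: near_def)
  qed
  define T where "T = inv_into F near ` (near ` F)"
  have sub: "near ` F \<subseteq> V" using near(1) by (rule image_subsetI)
  have fin: "finite (near ` F)" using sub V(1) by (rule finite_subset)
  have "card T \<le> card (near ` F)" unfolding T_def using fin by (rule card_image_le)
  also have "\<dots> \<le> card V" using V(1) sub by (rule card_mono)
  finally have "real (card T) \<le> real (card V)" by (rule of_nat_mono)
  then have cT: "real (card T) \<le> N + 1" using cV by linarith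
  have sq: "(LINT z|Q. (u z - w z)\<^sup>2) \<le> r\<^sup>2" if "L2_dist Q u w < r" for u w
  proof -
    have "(sqrt (LINT z|Q. (u z - w z)\<^sup>2))\<^sup>2 \<le> r\<^sup>2"
      using that unfolding L2_dist_def by (intro power_mono) auto
    then show ?thesis by simp
  qed
  show ?thesis
  proof (intro exI[of _ T] conjI ballI cT)
    show "T \<subseteq> F" unfolding T_def by (intro image_subsetI inv_into_into)
    show "finite T" unfolding T_def using fin by (rule finite_imageI)
    fix u assume u: "u \<in> F"
    define v where "v = inv_into F near (near u)"
    define w where "w = near u"
    have vF: "v \<in> F" and nv: "near v = w"
      unfolding v_def w_def using u by (simp_all only: inv_into_into f_inv_into_f imageI)
    have L: "u \<in> L2_functions Q" "v \<in> L2_functions Q" "w \<in> L2_functions Q"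
      using u vF F near(1)[OF u] V(2) by (auto simp: w_def)
    have i: "integrable Q (\<lambda>z. (u z - w z)\<^sup>2)" "integrable Q (\<lambda>z. (v z - w z)\<^sup>2)" "integrable Q (\<lambda>z. (u z - v z)\<^sup>2)"
      using L by (simp_all add: integrable_diff_square_L2)
    have ineq: "(a - b)\<^sup>2 \<le> 2 * (a - c)\<^sup>2 + 2 * (b - c)\<^sup>2" for a b c :: real
    proof -
      have "2 * (a - c)\<^sup>2 + 2 * (b - c)\<^sup>2 - (a - b)\<^sup>2 = (a + b - 2 * c)\<^sup>2"
        by (simp add: power2_eq_square algebra_simps)
      then show ?thesis using zero_le_power2[of "a + b - 2 * c"] by linarith
    qed
    have "(LINT z|Q. (u z - v z)\<^sup>2) \<le> (LINT z|Q. 2 * (u z - w z)\<^sup>2 + 2 * (v z - w z)\<^sup>2)"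
      using i by (intro integral_mono ineq) auto
    also have "\<dots> = 2 * (LINT z|Q. (u z - w z)\<^sup>2) + 2 * (LINT z|Q. (v z - w z)\<^sup>2)" using i by simp
    also have "\<dots> \<le> (2 * r)\<^sup>2"
      using sq[OF near(2)[OF u]] sq[OF near(2)[OF vF]] by (simp add: nv w_def[symmetric] power_mult_distrib)
    finally have "(LINT z|Q. (u z - v z)\<^sup>2) \<le> (2 * r)\<^sup>2" .
    moreover have "v \<in> T" unfolding T_def v_def using u by (intro imageI)
    ultimately show "\<exists>v\<in>T. (LINT z|Q. (u z - v z)\<^sup>2) \<le> (2 * r)\<^sup>2" by (rule bexI)
  qed
qed

lemma entropy_of_uniform_covering_number:
  fixes F :: "('z::topological_space \<Rightarrow> real) set" and \<kappa> C\<^sub>0 \<nu>\<^sub>0 :: real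
  assumes meas: "\<And>u. u \<in> F \<Longrightarrow> u \<in> borel_measurable borel" and bd: "\<And>u z. u \<in> F \<Longrightarrow> \<bar>u z\<bar> \<le> \<kappa>"
    and \<kappa>: "0 \<le> \<kappa>" and C: "0 < C\<^sub>0" "0 < \<nu>\<^sub>0"
    and cov: "\<And>\<epsilon>. 0 < \<epsilon> \<Longrightarrow> \<epsilon> < 1 \<Longrightarrow>
           uniform_covering_number borel (\<lambda>_. \<kappa>) \<epsilon> F \<le> ennreal (C\<^sub>0 * \<epsilon> powr (- \<nu>\<^sub>0))"
    and Q: "prob_space Q" "sets Q = sets borel" and \<delta>: "0 < \<delta>" "\<delta> \<le> 1"
  shows "\<exists>T\<subseteq>F. finite T \<and> real (card T) \<le> (C\<^sub>0 * (2 * (\<kappa> + 1)) powr \<nu>\<^sub>0 + 1) * (1 / \<delta>) ^ nat \<lceil>\<nu>\<^sub>0\<rceil> \<and>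
        (\<forall>u\<in>F. \<exists>v\<in>T. (LINT z|Q. (u z - v z)\<^sup>2) \<le> \<delta>\<^sup>2)"
proof (cases "\<kappa> = 0")
  \<comment> \<open>With envelope 0 no measure is admissible in the uniform covering number, so the
    entropy hypothesis is void; but then \<open>F\<close> contains at most the zero
    function.\<close>
  case True
  have zero: "u = (\<lambda>_. 0)" if "u \<in> F" for u using bd[OF that] True by (auto simp: fun_eq_iff)
  then have sub: "F \<subseteq> {\<lambda>_. 0}" by auto
  have fin: "finite F" using sub by (rule finite_subset) simp
  have "real (card F) \<le> 1" using card_mono[OF _ sub] by simp
  also have "1 \<le> (C\<^sub>0 * (2 * (\<kappa> + 1)) powr \<nu>\<^sub>0 + 1) * (1 / \<delta>) ^ nat \<lceil>\<nu>\<^sub>0\<rceil>"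
  proof -
    have "1 * 1 \<le> (C\<^sub>0 * (2 * (\<kappa> + 1)) powr \<nu>\<^sub>0 + 1) * (1 / \<delta>) ^ nat \<lceil>\<nu>\<^sub>0\<rceil>"
      using C \<delta> by (intro mult_mono one_le_power) auto
    then show ?thesis by simp
  qed
  finally have "real (card F) \<le> (C\<^sub>0 * (2 * (\<kappa> + 1)) powr \<nu>\<^sub>0 + 1) * (1 / \<delta>) ^ nat \<lceil>\<nu>\<^sub>0\<rceil>" .
  moreover have "\<exists>v\<in>F. (LINT z|Q. (u z - v z)\<^sup>2) \<le> \<delta>\<^sup>2" if "u \<in> F" for u
    using that by (intro bexI[of _ u]) simp_all
  ultimately show ?thesis using fin by (intro exI[of _ F]) simp
next
  case False
  then have \<kappa>0: "0 < \<kappa>" using \<kappa> by simp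
  interpret Q: prob_space Q by fact
  \<comment> \<open>The factor 2 anticipates the doubled radius of the internal net, and \<kappa> +
    1 in place of \<kappa> keeps \<epsilon> below 1.\<close>
  define \<epsilon> where "\<epsilon> = \<delta> / (2 * (\<kappa> + 1))"
  have \<epsilon>: "0 < \<epsilon>" "\<epsilon> < 1" using \<delta> \<kappa>0 by (auto simp: \<epsilon>_def divide_less_eq)
  define N where "N = C\<^sub>0 * \<epsilon> powr (- \<nu>\<^sub>0)"
  have N0: "0 \<le> N" using C by (simp add: N_def)
  have nn: "(\<integral>\<^sup>+x. ennreal (\<kappa>\<^sup>2) \<partial>Q) = ennreal (\<kappa>\<^sup>2)" by (simp add: Q.emeasure_space_1)
  have "covering_number (L2_functions Q) (L2_dist Q) (\<epsilon> * sqrt (LINT x|Q. \<kappa>\<^sup>2)) F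
      \<le> uniform_covering_number borel (\<lambda>_. \<kappa>) \<epsilon> F"
    unfolding uniform_covering_number_def using Q \<kappa>0 nn by (intro SUP_upper) simp
  also have "\<dots> \<le> ennreal N" unfolding N_def by (rule cov[OF \<epsilon>])
  finally have cv: "covering_number (L2_functions Q) (L2_dist Q) (\<epsilon> * \<kappa>) F \<le> ennreal N"
    using \<kappa>0 by (simp add: Q.prob_space)
  have FL: "F \<subseteq> L2_functions Q"
  proof
    fix u assume u: "u \<in> F"
    have m: "u \<in> borel_measurable Q" using meas[OF u] by (simp cong: measurable_cong_sets[OF Q(2) refl])
    moreover have "integrable Q (\<lambda>x. (u x)\<^sup>2)"
    proof (rule Q.integrable_const_bound[of _ "\<kappa>\<^sup>2"])
      show "AE x in Q. norm ((u x)\<^sup>2) \<le> \<kappa>\<^sup>2"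
        using power_mono[OF bd[OF u] abs_ge_zero, of _ 2] by simp
      show "(\<lambda>x. (u x)\<^sup>2) \<in> borel_measurable Q" using m by measurable
    qed
    ultimately show "u \<in> L2_functions Q" by (simp add: L2_functions_def)
  qed
  have r: "0 < \<epsilon> * \<kappa>" using \<epsilon> \<kappa>0 by simp
  from finite_internal_net[OF FL r N0 cv] obtain T where T: "T \<subseteq> F" "finite T" "real (card T) \<le> N + 1"
    "\<forall>u\<in>F. \<exists>v\<in>T. (LINT z|Q. (u z - v z)\<^sup>2) \<le> (2 * (\<epsilon> * \<kappa>))\<^sup>2" by (elim exE conjE)
  have small: "(2 * (\<epsilon> * \<kappa>))\<^sup>2 \<le> \<delta>\<^sup>2"
  proof (rule power_mono)
    have "2 * (\<epsilon> * \<kappa>) = \<delta> * (\<kappa> / (\<kappa> + 1))" using \<kappa>0 by (simp add: \<epsilon>_def field_simps)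
    also have "\<dots> \<le> \<delta> * 1" using \<delta> \<kappa>0 by (intro mult_left_mono) auto
    finally show "2 * (\<epsilon> * \<kappa>) \<le> \<delta>" by simp
  qed (use r in simp)
  have inv: "1 \<le> 1 / \<delta>" using \<delta> by simp
  have pw: "(1 / \<delta>) powr \<nu>\<^sub>0 \<le> (1 / \<delta>) ^ nat \<lceil>\<nu>\<^sub>0\<rceil>"
  proof -
    have "(1 / \<delta>) powr \<nu>\<^sub>0 \<le> (1 / \<delta>) powr real (nat \<lceil>\<nu>\<^sub>0\<rceil>)"
      using inv by (intro powr_mono) linarith+
    also have "\<dots> = (1 / \<delta>) ^ nat \<lceil>\<nu>\<^sub>0\<rceil>" using \<delta> by (intro powr_realpow) simp
    finally show ?thesis .
  qed
  have "N = C\<^sub>0 * (2 * (\<kappa> + 1)) powr \<nu>\<^sub>0 * (1 / \<delta>) powr \<nu>\<^sub>0"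
  proof -
    have "\<epsilon> powr (- \<nu>\<^sub>0) = (1 / \<epsilon>) powr \<nu>\<^sub>0" using \<epsilon> by (simp add: powr_minus powr_divide inverse_eq_divide)
    also have "1 / \<epsilon> = (2 * (\<kappa> + 1)) * (1 / \<delta>)" by (simp add: \<epsilon>_def)
    also have "\<dots> powr \<nu>\<^sub>0 = (2 * (\<kappa> + 1)) powr \<nu>\<^sub>0 * (1 / \<delta>) powr \<nu>\<^sub>0"
      by (rule powr_mult)
    finally show ?thesis by (simp add: N_def)
  qed
  also have "\<dots> \<le> C\<^sub>0 * (2 * (\<kappa> + 1)) powr \<nu>\<^sub>0 * (1 / \<delta>) ^ nat \<lceil>\<nu>\<^sub>0\<rceil>"
    using pw C by (intro mult_left_mono) auto
  finally have "N + 1 \<le> (C\<^sub>0 * (2 * (\<kappa> + 1)) powr \<nu>\<^sub>0 + 1) * (1 / \<delta>) ^ nat \<lceil>\<nu>\<^sub>0\<rceil>"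
    using one_le_power[OF inv, of "nat \<lceil>\<nu>\<^sub>0\<rceil>"] by (simp add: distrib_right)
  then have "real (card T) \<le> (C\<^sub>0 * (2 * (\<kappa> + 1)) powr \<nu>\<^sub>0 + 1) * (1 / \<delta>) ^ nat \<lceil>\<nu>\<^sub>0\<rceil>"
    using T(3) by linarith
  moreover have "\<exists>v\<in>T. (LINT z|Q. (u z - v z)\<^sup>2) \<le> \<delta>\<^sup>2" if u: "u \<in> F" for u
  proof -
    from bspec[OF T(4) u] obtain v where v: "v \<in> T" "(LINT z|Q. (u z - v z)\<^sup>2) \<le> (2 * (\<epsilon> * \<kappa>))\<^sup>2" by (rule bexE)
    show ?thesis using order_trans[OF v(2) small] v(1) by (rule bexI)
  qed
  ultimately show ?thesis using T(1,2) by (intro exI[of _ T] conjI ballI)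
qed

text \<open>The source of the factor \<open>h\<close> in the second moments: for l = h^(-1/d) the
  constant is exactly \<open>h\<close>. The reflection in the first variable leaves Lebesgue measure
  unchanged.\<close>

lemma nn_integral_dilation:
  fixes \<phi> :: "'a::euclidean_space \<times> 'b::euclidean_space \<Rightarrow> ennreal"
  assumes \<phi>: "\<phi> \<in> borel_measurable borel" and l: "0 < l"
  shows "(\<integral>\<^sup>+p. \<phi> (z - l *\<^sub>R fst p, snd p) \<partial>lborel) = ennreal ((1 / l) ^ DIM('a)) * (\<integral>\<^sup>+p. \<phi> p \<partial>lborel)"
proof -
  have \<phi>m: "\<phi> \<in> borel_measurable (lborel \<Otimes>\<^sub>M lborel)" using \<phi> by (simp add: lborel_prod)
  have "(\<lambda>p::'a \<times> 'b. (z - l *\<^sub>R fst p, snd p)) \<in> borel_measurable borel"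
    by (intro borel_measurable_continuous_onI continuous_intros)
  then have dil: "(\<lambda>p::'a \<times> 'b. \<phi> (z - l *\<^sub>R fst p, snd p)) \<in> borel_measurable (lborel \<Otimes>\<^sub>M lborel)"
    using measurable_compose[OF _ \<phi>] by (simp add: lborel_prod)
  have sec: "(\<lambda>s. \<phi> (s, t)) \<in> borel_measurable borel" for t
    using measurable_Pair1[OF \<phi>m, of t] by simp
  have inner: "(\<integral>\<^sup>+s. \<phi> (z - l *\<^sub>R s, t) \<partial>lborel) = ennreal ((1 / l) ^ DIM('a)) * (\<integral>\<^sup>+s. \<phi> (s, t) \<partial>lborel)" for t
  proof -
    have "(\<integral>\<^sup>+s. \<phi> (s, t) \<partial>lborel) = (\<integral>\<^sup>+s. \<phi> (s, t) \<partial>density (distr lborel borel (\<lambda>x. z + (- l) *\<^sub>R x)) (\<lambda>_. ennreal (\<bar>- l\<bar> ^ DIM('a))))"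
      using l by (subst lborel_affine[of "- l" z]) auto
    also have "\<dots> = (\<integral>\<^sup>+s. ennreal (l ^ DIM('a)) * \<phi> (s, t) \<partial>distr lborel borel (\<lambda>x. z + (- l) *\<^sub>R x))"
      using sec[of t] l by (subst nn_integral_density) auto
    also have "\<dots> = (\<integral>\<^sup>+s. ennreal (l ^ DIM('a)) * \<phi> (z + (- l) *\<^sub>R s, t) \<partial>lborel)"
      using sec[of t] by (subst nn_integral_distr) auto
    also have "\<dots> = ennreal (l ^ DIM('a)) * (\<integral>\<^sup>+s. \<phi> (z - l *\<^sub>R s, t) \<partial>lborel)"
      using measurable_compose[OF _ sec[of t], of "\<lambda>s. z + (- l) *\<^sub>R s" lborel]
      by (subst nn_integral_cmult) auto
    finally have eq: "(\<integral>\<^sup>+s. \<phi> (s, t) \<partial>lborel) = ennreal (l ^ DIM('a)) * (\<integral>\<^sup>+s. \<phi> (z - l *\<^sub>R s, t) \<partial>lborel)" .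
    have "ennreal ((1 / l) ^ DIM('a)) * ennreal (l ^ DIM('a)) = 1"
      using l by (simp add: power_one_over flip: ennreal_mult)
    then show ?thesis unfolding eq by (simp flip: mult.assoc)
  qed
  have "(\<integral>\<^sup>+p. \<phi> (z - l *\<^sub>R fst p, snd p) \<partial>lborel) = (\<integral>\<^sup>+t. (\<integral>\<^sup>+s. \<phi> (z - l *\<^sub>R s, t) \<partial>lborel) \<partial>lborel)"
    using lborel_pair.nn_integral_snd[OF dil] by (simp add: lborel_prod)
  also have "\<dots> = (\<integral>\<^sup>+t. ennreal ((1 / l) ^ DIM('a)) * (\<integral>\<^sup>+s. \<phi> (s, t) \<partial>lborel) \<partial>lborel)"
    by (simp only: inner)
  also have "\<dots> = ennreal ((1 / l) ^ DIM('a)) * (\<integral>\<^sup>+t. (\<integral>\<^sup>+s. \<phi> (s, t) \<partial>lborel) \<partial>lborel)"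
    by (rule nn_integral_cmult) (use \<phi>m in measurable)
  also have "(\<integral>\<^sup>+t. (\<integral>\<^sup>+s. \<phi> (s, t) \<partial>lborel) \<partial>lborel) = (\<integral>\<^sup>+p. \<phi> p \<partial>lborel)"
    using lborel_pair.nn_integral_snd[OF \<phi>m] by (simp add: lborel_prod)
  finally show ?thesis .
qed

section \<open>Kernel averages\<close>

lemma borel_measurable_dilation:
  fixes g :: "'a::euclidean_space \<times> 'b::euclidean_space \<Rightarrow> real"
  assumes "g \<in> borel_measurable borel"
  shows "(\<lambda>(s, t). g (z - l *\<^sub>R s, t)) \<in> borel_measurable borel"
proof -
  have "(\<lambda>p::'a \<times> 'b. (z - l *\<^sub>R fst p, snd p)) \<in> borel_measurable borel"
    by (intro borel_measurable_continuous_onI continuous_intros)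
  from measurable_compose[OF this assms] show ?thesis by (simp add: split_beta')
qed

theorem theorem2:
  fixes M :: "'w measure"
    and X :: "nat \<Rightarrow> 'w \<Rightarrow> real^'d"
    and Y :: "nat \<Rightarrow> 'w \<Rightarrow> real^'r"
    and f :: "(real^'d) \<times> (real^'r) \<Rightarrow> real"
    and \<G> :: "((real^'d) \<times> (real^'r) \<Rightarrow> real) set"
    and \<kappa> L C\<^sub>0 \<nu>\<^sub>0 :: real
  assumes "prob_space M"
    and "prob_space.indep_vars M (\<lambda>_. borel) (\<lambda>i \<omega>. (X i \<omega>, Y i \<omega>)) UNIV"
    and "\<And>i. distributed M lborel (\<lambda>\<omega>. (X i \<omega>, Y i \<omega>)) (\<lambda>z. ennreal (f z))"
    and "\<And>z. 0 \<le> f z"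
    and "bounded (range f)"
    and "\<And>g. g \<in> \<G> \<Longrightarrow> g \<in> borel_measurable borel"
    and "0 \<le> \<kappa>" and "(SUP g\<in>\<G>. sup_norm g) = ennreal \<kappa>"
    and "0 \<le> L" and "(SUP g\<in>\<G>. \<integral>\<^sup>+z. ennreal ((g z)\<^sup>2) \<partial>lborel) = ennreal L"
    and "0 < C\<^sub>0" and "0 < \<nu>\<^sub>0"
    and "\<And>\<epsilon>. 0 < \<epsilon> \<Longrightarrow> \<epsilon> < 1 \<Longrightarrow>
           uniform_covering_number borel (\<lambda>_. \<kappa>) \<epsilon> (dilation_class \<G>)
             \<le> ennreal (C\<^sub>0 * \<epsilon> powr (- \<nu>\<^sub>0))"
    and "pointwise_measurable_class borel (dilation_class \<G>)"
  shows "\<forall>c h\<^sub>0. 0 < c \<and> 0 < h\<^sub>0 \<and> h\<^sub>0 < 1 \<longrightarrow>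
    (\<exists>G::ennreal. G < \<infinity> \<and>
      (AE \<omega> in M.
        limsup (\<lambda>n. SUP h \<in> {h. 0 < h \<and> c * ln (real n) / real n \<le> h \<and> h \<le> h\<^sub>0}.
          SUP g\<in>\<G>.
            ennreal (sqrt (real n * h)) *
            sup_norm (\<lambda>x. kernel_average X Y g n h \<omega> x
                           - (LINT \<omega>'|M. kernel_average X Y g n h \<omega>' x))
            / ennreal (sqrt (max \<bar>ln h\<bar> (ln (ln (real n)))))) = G))"
proof (intro allI impI)
  fix c h\<^sub>0 :: real assume ch: "0 < c \<and> 0 < h\<^sub>0 \<and> h\<^sub>0 < 1"
  then have c: "0 < c" and h0: "h\<^sub>0 < 1" by auto
  define Z where "Z = (\<lambda>i \<omega>. (X i \<omega>, Y i \<omega>))"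
  define P where "P = density lborel (\<lambda>z. ennreal (f z))"
  define F where "F = dilation_class \<G>"
  interpret M: prob_space M by fact
  have Fform: "\<exists>l z g. u = (\<lambda>(s, t). g (z - l *\<^sub>R s, t)) \<and> g \<in> \<G>" if "u \<in> F" for u
    using that unfolding F_def dilation_class_def by (elim CollectE exE conjE) (intro exI conjI)
  have gbd: "\<bar>g z\<bar> \<le> \<kappa>" if "g \<in> \<G>" for g z
  proof -
    have "ennreal \<bar>g z\<bar> \<le> sup_norm g" unfolding sup_norm_def by (rule SUP_upper) simp
    also have "\<dots> \<le> ennreal \<kappa>" unfolding assms(8)[symmetric] using that by (rule SUP_upper)
    finally show ?thesis using assms(7) by simp
  qed
  have Fm: "u \<in> borel_measurable borel" if "u \<in> F" for u
    using Fform[OF that] borel_measurable_dilation[OF assms(6)] by (elim exE conjE) simp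
  have Fbd: "\<bar>u z\<bar> \<le> \<kappa>" if "u \<in> F" for u z
    using Fform[OF that] gbd by (elim exE conjE) (simp add: split_beta)
  have law: "distr M borel (Z i) = P" for i
  proof -
    have "distr M borel (Z i) = distr M lborel (Z i)" by (rule distr_cong) simp_all
    then show ?thesis unfolding Z_def P_def using distributed_distr_eq_density[OF assms(3)] by simp
  qed
  \<comment> \<open>\<kappa> may vanish, whereas the locale asks for a bound of at least 1.\<close>
  interpret entropy_class M Z P F "\<kappa> + 1" "C\<^sub>0 * (2 * (\<kappa> + 1)) powr \<nu>\<^sub>0 + 1" "nat \<lceil>\<nu>\<^sub>0\<rceil>"
  proof
    show "M.indep_vars (\<lambda>_. borel) Z UNIV" unfolding Z_def by (rule assms(2))
    show "pointwise_measurable_class borel F" unfolding F_def by (rule assms(14))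
    show "\<bar>u z\<bar> \<le> \<kappa> + 1" if "u \<in> F" for u z using Fbd[OF that, of z] by linarith
    show "\<exists>T\<subseteq>F. finite T \<and> real (card T) \<le> (C\<^sub>0 * (2 * (\<kappa> + 1)) powr \<nu>\<^sub>0 + 1) * (1 / \<delta>) ^ nat \<lceil>\<nu>\<^sub>0\<rceil> \<and>
        (\<forall>u\<in>F. \<exists>v\<in>T. (LINT z|Q. (u z - v z)\<^sup>2) \<le> \<delta>\<^sup>2)"
      if "prob_space Q" "sets Q = sets borel" "0 < \<delta>" "\<delta> \<le> 1" for Q \<delta>
      by (rule entropy_of_uniform_covering_number[of F \<kappa> C\<^sub>0 \<nu>\<^sub>0 Q \<delta>, OF Fm _ assms(7,11,12) assms(13)[folded F_def] that])
        (assumption | erule Fbd)+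
  qed (use law Fm assms(7,11) in auto)

  define b where "b = (\<lambda>h. h powr (1 / real CARD('d)))"
  define u where "u = (\<lambda>h (g :: (real^'d) \<times> (real^'r) \<Rightarrow> real) x. \<lambda>(s, t). g (x /\<^sub>R b h - (1 / b h) *\<^sub>R s, t))"
  have b: "0 < b h" "b h \<le> 1" "b h ^ CARD('d) = h" if h: "0 < h" "h \<le> 1" for h
  proof -
    show "0 < b h" using h by (simp add: b_def)
    show "b h \<le> 1" using h powr_mono2[of "1 / real CARD('d)" h 1] by (simp add: b_def)
    have "b h ^ CARD('d) = b h powr real CARD('d)" using h by (simp add: b_def powr_realpow)
    also have "\<dots> = h" using h by (simp add: b_def powr_powr)
    finally show "b h ^ CARD('d) = h" .
  qed
  have uF: "u h g x \<in> F" if h: "0 < h" "h \<le> 1" and g: "g \<in> \<G>" for h g x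
  proof -
    have "1 \<le> 1 / b h" using b[OF h] by simp
    then show ?thesis unfolding F_def dilation_class_def u_def using g
      by (intro CollectI exI conjI) (rule refl)
  qed
  have uZ: "g ((x - X i \<omega>) /\<^sub>R b h, Y i \<omega>) = u h g x (Z i \<omega>)" for g x i \<omega> h
    by (simp add: u_def Z_def scaleR_diff_right inverse_eq_divide)

  obtain B where B: "\<And>z. f z \<le> B" "0 \<le> B"
  proof -
    from assms(5) obtain B where B: "\<forall>z. \<bar>f z\<bar> \<le> B" unfolding bounded_iff by auto
    have "f z \<le> B" for z using B abs_ge_self[of "f z"] by (meson order_trans)
    moreover have "0 \<le> B" using B[rule_format, of undefined] abs_ge_zero[of "f undefined"] by linarith
    ultimately show ?thesis by (rule that)
  qed
  \<comment> \<open>Measurability comes with the density as an extended nonnegative function; f >= 0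
    carries it back to the real one.\<close>
  have f_meas: "f \<in> borel_measurable borel"
  proof -
    have "(\<lambda>z. ennreal (f z)) \<in> borel_measurable lborel" using distributed_borel_measurable[OF assms(3)] .
    then have "(\<lambda>z. enn2real (ennreal (f z))) \<in> borel_measurable lborel" by measurable
    then show ?thesis using assms(4) by simp
  qed
  have var: "(LINT z|P. (u h g x z)\<^sup>2) \<le> B * L * h" if h: "0 < h" "h \<le> 1" and g: "g \<in> \<G>" for h g x
  proof -
    have um: "u h g x \<in> borel_measurable borel" by (rule Fm[OF uF[OF h g]])
    define \<phi> where "\<phi> = (\<lambda>p. ennreal ((g p)\<^sup>2))"
    have \<phi>: "\<phi> \<in> borel_measurable borel" unfolding \<phi>_def using assms(6)[OF g] by measurable
    have "ennreal (LINT z|P. (u h g x z)\<^sup>2) = (\<integral>\<^sup>+z. ennreal ((u h g x z)\<^sup>2) \<partial>P)"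
      by (rule nn_integral_eq_integral[symmetric, OF integrable_square[OF uF[OF h g]]]) simp
    also have "\<dots> = (\<integral>\<^sup>+z. ennreal (f z) * ennreal ((u h g x z)\<^sup>2) \<partial>lborel)"
      unfolding P_def using um f_meas by (intro nn_integral_density) auto
    also have "\<dots> \<le> (\<integral>\<^sup>+z. ennreal B * ennreal ((u h g x z)\<^sup>2) \<partial>lborel)"
      using B(1) by (intro nn_integral_mono mult_right_mono ennreal_leI) auto
    also have "\<dots> = ennreal B * (\<integral>\<^sup>+z. ennreal ((u h g x z)\<^sup>2) \<partial>lborel)"
      using um by (intro nn_integral_cmult) auto
    also have "(\<integral>\<^sup>+z. ennreal ((u h g x z)\<^sup>2) \<partial>lborel) = (\<integral>\<^sup>+p. \<phi> (x /\<^sub>R b h - (1 / b h) *\<^sub>R fst p, snd p) \<partial>lborel)"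
      by (simp add: u_def \<phi>_def split_beta)
    also have "\<dots> = ennreal ((1 / (1 / b h)) ^ DIM(real^'d)) * (\<integral>\<^sup>+p. \<phi> p \<partial>lborel)"
      using b(1)[OF h] by (intro nn_integral_dilation[OF \<phi>]) simp
    also have "(1 / (1 / b h)) ^ DIM(real^'d) = h" using b(3)[OF h] by simp
    also have "ennreal B * (ennreal h * (\<integral>\<^sup>+p. \<phi> p \<partial>lborel)) \<le> ennreal B * (ennreal h * ennreal L)"
    proof (intro mult_left_mono)
      show "(\<integral>\<^sup>+p. \<phi> p \<partial>lborel) \<le> ennreal L"
        unfolding \<phi>_def assms(10)[symmetric] using g by (rule SUP_upper)
    qed auto
    also have "\<dots> = ennreal (B * L * h)" using B(2) h assms(9) by (simp add: ennreal_mult mult_ac)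
    finally show ?thesis using B(2) h assms(9) by simp
  qed
  have centre: "kernel_average X Y g n h \<omega> x - (LINT \<omega>'|M. kernel_average X Y g n h \<omega>' x) = dev n (u h g x) \<omega> / (real n * h)"
    if h: "0 < h" "h \<le> 1" and g: "g \<in> \<G>" for g n h \<omega> x
  proof -
    have um: "u h g x \<in> borel_measurable borel" by (rule Fm[OF uF[OF h g]])
    have ka: "kernel_average X Y g n h \<omega> x = 1 / (real n * h) * (\<Sum>i=1..n. u h g x (Z i \<omega>))" for \<omega>
      unfolding kernel_average_def by (simp only: uZ[unfolded b_def])
    have int: "integrable M (\<lambda>\<omega>. u h g x (Z i \<omega>))" for i
      using Fbd[OF uF[OF h g]] by (intro M.integrable_const_bound[of _ \<kappa>] measurable_compose[OF measurable_Z um]) auto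
    have "(LINT \<omega>|M. u h g x (Z i \<omega>)) = (LINT z|P. u h g x z)" for i
      unfolding law[of i, symmetric] using um by (subst integral_distr) auto
    then have "(LINT \<omega>'|M. kernel_average X Y g n h \<omega>' x) = 1 / (real n * h) * (\<Sum>i=1..n. (LINT z|P. u h g x z))"
      unfolding ka using int by (simp add: Bochner_Integration.integral_sum)
    then show ?thesis unfolding ka dev_def sum_subtractf by (simp add: right_diff_distrib diff_divide_distrib)
  qed

  define m where "m = (\<lambda>n h. max \<bar>ln h\<bar> (ln (ln (real n))))"
  define I where "I = (\<lambda>n. {h. 0 < h \<and> c * ln (real n) / real n \<le> h \<and> h \<le> h\<^sub>0})"
  \<comment> \<open>For small n, ln (ln n) need not be positive, and 16 > e is a safe start. The
    empty sets before it do not affect the limit superior.\<close>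
  define S where "S = (\<lambda>n::nat. if n < 16 then {} else
    {(1 / sqrt (real n * h * m n h), u h g x) | h g x. h \<in> I n \<and> g \<in> \<G>})"
  define \<Phi> where "\<Phi> = (\<lambda>n \<omega>. SUP h\<in>I n. SUP g\<in>\<G>. ennreal (sqrt (real n * h)) *
      sup_norm (\<lambda>x. kernel_average X Y g n h \<omega> x - (LINT \<omega>'|M. kernel_average X Y g n h \<omega>' x))
            / ennreal (sqrt (m n h)))"
  define \<Psi> where "\<Psi> = (\<lambda>n \<omega>. SUP w\<in>S n. ennreal (fst w * \<bar>dev n (snd w) \<omega>\<bar>))"
  have hI: "0 < h" "h \<le> 1" "c * ln (real n) / real n \<le> h" if "h \<in> I n" for h n
    using that h0 by (auto simp: I_def)
  have loglog: "0 < ln (real n)" "0 < ln (ln (real n))" if "16 \<le> n" for n :: nat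
  proof -
    have "exp 1 < (16::real)" using exp_le by linarith
    also have "16 \<le> real n" using that by simp
    finally have "exp 1 < real n" .
    then have "ln (exp 1) < ln (real n)" using that by (subst ln_less_cancel_iff) auto
    then have "1 < ln (real n)" by simp
    then show "0 < ln (real n)" "0 < ln (ln (real n))" by simp_all
  qed
  have mpos: "0 < m n h" "ln (ln (real n)) \<le> m n h" if "16 \<le> n" for n h
    using loglog[OF that] by (auto simp: m_def less_max_iff_disj)
  \<comment> \<open>Since sqrt(n h) |D / (n h)| / sqrt m = |D| / sqrt(n h m), the normalisation
    becomes a single real weight, and the suprema over h, g and x merge into one over
    \<open>S n\<close>.\<close>
  have summand: "ennreal (sqrt (real n * h)) *
      sup_norm (\<lambda>x. kernel_average X Y g n h \<omega> x - (LINT \<omega>'|M. kernel_average X Y g n h \<omega>' x))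
            / ennreal (sqrt (m n h)) = (SUP x. ennreal (1 / sqrt (real n * h * m n h) * \<bar>dev n (u h g x) \<omega>\<bar>))"
    if n: "16 \<le> n" and h: "h \<in> I n" and g: "g \<in> \<G>" for n h g \<omega>
  proof -
    have nh: "0 < real n * h" using n hI[OF h] by simp
    have "ennreal (sqrt (real n * h)) * ennreal \<bar>D / (real n * h)\<bar> / ennreal (sqrt (m n h)) =
        ennreal (1 / sqrt (real n * h * m n h) * \<bar>D\<bar>)" for D
    proof -
      have "ennreal (sqrt (real n * h)) * ennreal \<bar>D / (real n * h)\<bar> / ennreal (sqrt (m n h)) =
          ennreal (sqrt (real n * h) * \<bar>D / (real n * h)\<bar> / sqrt (m n h))"
        using nh mpos(1)[OF n, of h] by (simp add: divide_ennreal flip: ennreal_mult)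
      also have "sqrt (real n * h) * \<bar>D / (real n * h)\<bar> / sqrt (m n h) = 1 / sqrt (real n * h * m n h) * \<bar>D\<bar>"
      proof -
        have "sqrt (real n * h) * \<bar>D / (real n * h)\<bar> = \<bar>D\<bar> / sqrt (real n * h)"
        proof -
          define r where "r = sqrt (real n * h)"
          have "0 < r" "real n * h = r * r" using nh by (simp_all add: r_def)
          then show ?thesis by (simp add: r_def[symmetric])
        qed
        then show ?thesis by (simp add: real_sqrt_mult[of "real n * h"])
      qed
      finally show ?thesis .
    qed
    then show ?thesis
      unfolding sup_norm_def SUP_mult_left_ennreal SUP_divide_ennreal centre[OF hI(1,2)[OF h] g] by simp
  qed
  have \<Phi>\<Psi>: "\<Phi> n \<omega> = \<Psi> n \<omega>" if n: "16 \<le> n" for n \<omega>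
  proof (rule antisym)
    show "\<Phi> n \<omega> \<le> \<Psi> n \<omega>"
      unfolding \<Phi>_def
    proof (intro SUP_least)
      fix h g assume h: "h \<in> I n" and g: "g \<in> \<G>"
      have "(1 / sqrt (real n * h * m n h), u h g x) \<in> S n" for x
        unfolding S_def using n h g by auto
      then have "ennreal (1 / sqrt (real n * h * m n h) * \<bar>dev n (u h g x) \<omega>\<bar>) \<le> \<Psi> n \<omega>" for x
        unfolding \<Psi>_def by (intro SUP_upper2[of "(1 / sqrt (real n * h * m n h), u h g x)"]) simp_all
      then show "ennreal (sqrt (real n * h)) *
        sup_norm (\<lambda>x. kernel_average X Y g n h \<omega> x - (LINT \<omega>'|M. kernel_average X Y g n h \<omega>' x))
            / ennreal (sqrt (m n h)) \<le> \<Psi> n \<omega>"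
        unfolding summand[OF n h g] by (intro SUP_least)
    qed
    show "\<Psi> n \<omega> \<le> \<Phi> n \<omega>"
      unfolding \<Psi>_def
    proof (rule SUP_least)
      fix w assume "w \<in> S n"
      then obtain h g x where w: "w = (1 / sqrt (real n * h * m n h), u h g x)" "h \<in> I n" "g \<in> \<G>"
        unfolding S_def using n by (auto split: if_splits)
      have "ennreal (fst w * \<bar>dev n (snd w) \<omega>\<bar>) \<le> (SUP x. ennreal (1 / sqrt (real n * h * m n h) * \<bar>dev n (u h g x) \<omega>\<bar>))"
        unfolding w(1) by (intro SUP_upper2[of x]) simp_all
      also have "\<dots> \<le> \<Phi> n \<omega>"
        unfolding \<Phi>_def summand[OF n w(2,3), symmetric]
        by (intro SUP_upper2[OF w(2)] SUP_upper w(3))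
      finally show "ennreal (fst w * \<bar>dev n (snd w) \<omega>\<bar>) \<le> \<Phi> n \<omega>" .
    qed
  qed
  then have "\<forall>\<^sub>F n in sequentially. \<Phi> n \<omega> = \<Psi> n \<omega>" for \<omega>
    by (intro eventually_mono[OF eventually_ge_at_top[of 16]]) simp
  then have lim_eq: "limsup (\<lambda>n. \<Phi> n \<omega>) = limsup (\<lambda>n. \<Psi> n \<omega>)" for \<omega>
    by (intro Limsup_eq)

  \<comment> \<open>By n h >= c ln n and m >= ln (ln n), this bounds the weights uniformly in
    \<open>h\<close>. The absolute value keeps \<alpha> nonnegative at n = 2, where ln (ln n) is
    negative and \<open>sqrt\<close> of a negative number is negative.\<close>
  define \<alpha> where "\<alpha> = (\<lambda>n::nat. 1 / sqrt \<bar>c * ln (real n) * ln (ln (real n))\<bar>)"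
  have "\<alpha> \<longlonglongrightarrow> 0" unfolding \<alpha>_def using c by real_asymp
  then have "\<exists>G. AE \<omega> in M. limsup (\<lambda>n. SUP w\<in>S n. ennreal (fst w * \<bar>dev n (snd w) \<omega>\<bar>)) = G"
  proof (rule limsup_weighted_sup_const[rotated 1])
    fix n w assume wS: "w \<in> S n"
    then have n: "16 \<le> n" by (auto simp: S_def split: if_splits)
    obtain h g x where w: "w = (1 / sqrt (real n * h * m n h), u h g x)" and h: "h \<in> I n" and g: "g \<in> \<G>"
      using wS n unfolding S_def by (auto split: if_splits)
    have n0: "0 < real n" using n by simp
    have nh: "c * ln (real n) \<le> real n * h" using hI(3)[OF h] n0 by (simp add: field_simps)
    have le: "c * ln (real n) * ln (ln (real n)) \<le> real n * h * m n h"
      using mpos(2)[OF n, of h] loglog[OF n] hI(1)[OF h] by (intro mult_mono[OF nh]) auto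
    have pos: "0 < c * ln (real n) * ln (ln (real n))" using loglog[OF n] c by simp
    have "1 / sqrt (real n * h * m n h) \<le> \<alpha> n"
      unfolding \<alpha>_def using le pos by (intro divide_left_mono real_sqrt_le_mono) auto
    then show "0 \<le> fst w \<and> fst w \<le> \<alpha> n \<and> snd w \<in> F"
      using uF[OF hI(1,2)[OF h] g] le pos by (simp add: w)
  qed (simp add: \<alpha>_def)
  then obtain G where G: "AE \<omega> in M. limsup (\<lambda>n. \<Psi> n \<omega>) = G" unfolding \<Psi>_def by (rule exE)

  have BL: "0 \<le> B * L" using B(2) assms(9) by simp
  obtain A where A: "0 < A" "AE \<omega> in M. \<forall>\<^sub>F n in sequentially. \<forall>h u. 0 < h \<longrightarrow> h \<le> 1 \<longrightarrow>
     c * ln (real n) / real n \<le> h \<longrightarrow> u \<in> F \<longrightarrow> (LINT z|P. (u z)\<^sup>2) \<le> B * L * h \<longrightarrow>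
     \<bar>dev n u \<omega>\<bar> \<le> A * sqrt (real n * h * max \<bar>ln h\<bar> (ln (ln (real n))))"
    by (rule AE_deviation[OF c BL], rule that)
  from A(2) G have "AE \<omega> in M. G \<le> ennreal A"
  proof eventually_elim
    fix \<omega> assume G: "limsup (\<lambda>n. \<Psi> n \<omega>) = G" and
     bound: "\<forall>\<^sub>F n in sequentially. \<forall>h u. 0 < h \<longrightarrow> h \<le> 1 \<longrightarrow>
     c * ln (real n) / real n \<le> h \<longrightarrow> u \<in> F \<longrightarrow> (LINT z|P. (u z)\<^sup>2) \<le> B * L * h \<longrightarrow>
     \<bar>dev n u \<omega>\<bar> \<le> A * sqrt (real n * h * max \<bar>ln h\<bar> (ln (ln (real n))))"
    from bound have "\<forall>\<^sub>F n in sequentially. \<Psi> n \<omega> \<le> ennreal A"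
      using eventually_ge_at_top[of 16]
    proof eventually_elim
      case (elim n)
      show ?case unfolding \<Psi>_def
      proof (rule SUP_least)
        fix w assume "w \<in> S n"
        then obtain h g x where w: "w = (1 / sqrt (real n * h * m n h), u h g x)" and h: "h \<in> I n" and g: "g \<in> \<G>"
          unfolding S_def using elim(2) by (auto split: if_splits)
        have "0 < real n * h * m n h" using elim(2) hI(1)[OF h] mpos(1)[OF elim(2), of h] by simp
        moreover have "\<bar>dev n (u h g x) \<omega>\<bar> \<le> A * sqrt (real n * h * m n h)"
          unfolding m_def
          by (rule elim(1)[rule_format, OF hI[OF h] uF[OF hI(1,2)[OF h] g] var[OF hI(1,2)[OF h] g]])
        ultimately show "ennreal (fst w * \<bar>dev n (snd w) \<omega>\<bar>) \<le> ennreal A"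
          by (intro ennreal_leI) (simp add: w divide_le_eq)
      qed
    qed
    then have "limsup (\<lambda>n. \<Psi> n \<omega>) \<le> ennreal A" by (rule Limsup_bounded)
    then show "G \<le> ennreal A" using G by simp
  qed
  \<comment> \<open>A statement free of \<omega> that holds almost everywhere on a probability space
    is true.\<close>
  then have "G \<le> ennreal A" by simp
  then have "G < \<infinity>" by (rule order_le_less_trans) simp
  moreover have "AE \<omega> in M. limsup (\<lambda>n. \<Phi> n \<omega>) = G" unfolding lim_eq by (rule G)
  ultimately show "\<exists>G::ennreal. G < \<infinity> \<and>
      (AE \<omega> in M.
        limsup (\<lambda>n. SUP h \<in> {h. 0 < h \<and> c * ln (real n) / real n \<le> h \<and> h \<le> h\<^sub>0}.
          SUP g\<in>\<G>.
            ennreal (sqrt (real n * h)) *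
            sup_norm (\<lambda>x. kernel_average X Y g n h \<omega> x
                           - (LINT \<omega>'|M. kernel_average X Y g n h \<omega>' x))
            / ennreal (sqrt (max \<bar>ln h\<bar> (ln (ln (real n)))))) = G)"
    unfolding \<Phi>_def I_def m_def by (intro exI[of _ G] conjI)
qed

end
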